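(* Let $d\to\infty$ and let $n=n(d)$ be positive integers such that $\frac{\ln n}{d\ln d}\to\infty$. Then $$ \mathbb{E} f_{d-1}(P^{(d)}_n) = 2^d\,\pi^{\frac{d-1}{2}}\,d^{-\frac12}\,(\ln n)^{\frac{d-1}{2}}\,(1+o(1)) $$ as $d\to\infty$.
   Context: For integers $n,d\ge1$, the Gaussian polytope $P^{(d)}_n=[X_1,\dots,X_n]$ is the convex hull of $n$ independent standard Gaussian random points $X_1,\dots,X_n$ in $\mathbb{R}^d$. For a polytope $Q$, $f_{i}(Q)$ denotes the number of $i$-dimensional faces of $Q$; thus $f_{d-1}(P^{(d)}_n)$ is its number of facets. *)

theory Defs
  imports
    "HOL-Probability.Probability"
    "HOL-Analysis.Finite_Function_Topology"
    "HOL-Library.Landau_Symbols"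
begin

text \<open>
  The dimension \<open>d\<close> tends to infinity, so it cannot be the index of a type. All the spaces
  \<open>\<real>\<^sup>d\<close> are regarded as linear subspaces of one real vector space, that of the finitely
  supported functions \<^typ>\<open>nat \<Rightarrow>\<^sub>0 real\<close>: \<open>\<real>\<^sup>d\<close> is the set of those functions that vanish outside
  \<open>{..<d}\<close>. Convex hulls and faces are intrinsic to the linear structure and do not depend on the
  ambient space. Elements of the product space \<open>PiM {..<d} _\<close> take the value \<^const>\<open>undefined\<close> outside
  \<open>{..<d}\<close>; \<open>point\<close> resets these coordinates to zero.
\<close>

definition point :: "nat \<Rightarrow> (nat \<Rightarrow> real) \<Rightarrow> (nat \<Rightarrow>\<^sub>0 real)" where
  "point d x = Abs_poly_mapping (\<lambda>k. if k < d then x k else 0)"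

lemma lookup_point: "Poly_Mapping.lookup (point d x) k = (if k < d then x k else 0)"
proof -
  have *: "finite {k. (if k < d then x k else 0) \<noteq> 0}"
    by (rule finite_subset[of _ "{..<d}"]) auto
  show ?thesis
    unfolding point_def lookup_Abs_poly_mapping[OF *] ..
qed

text \<open>
  The library's \<^const>\<open>aff_dim\<close> is restricted to the class \<^class>\<open>euclidean_space\<close>. The following is
  the same notion for subsets of an arbitrary real vector space; see \<open>has_aff_dim_iff\<close> below.
\<close>

definition has_aff_dim :: "'a::real_vector set \<Rightarrow> nat \<Rightarrow> bool" where
  "has_aff_dim F i \<longleftrightarrow>
     (\<exists>B. finite B \<and> \<not> affine_dependent B \<and> affine hull B = affine hull F \<and> card B = i + 1)"

lemma has_aff_dim_iff:
  fixes F :: "'a::euclidean_space set"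
  shows "has_aff_dim F i \<longleftrightarrow> aff_dim F = int i"
proof
  assume "has_aff_dim F i"
  then obtain B where "\<not> affine_dependent B" "affine hull B = affine hull F" "card B = i + 1"
    by (auto simp: has_aff_dim_def)
  then show "aff_dim F = int i"
    by (metis aff_dim_affine_hull aff_dim_affine_independent add_diff_cancel_right' of_nat_1 of_nat_add)
next
  assume *: "aff_dim F = int i"
  obtain B where "affine hull B = affine hull F" "\<not> affine_dependent B"
      "int (card B) = aff_dim F + 1"
    using aff_dim_basis_exists by blast
  with * show "has_aff_dim F i"
    unfolding has_aff_dim_def
    by (metis aff_independent_finite of_nat_1 of_nat_add of_nat_eq_iff)
qed

text \<open>The number \<open>f\<^sub>i(Q)\<close> of \<open>i\<close>-dimensional faces of a polytope \<open>Q\<close>.\<close>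

definition num_faces :: "nat \<Rightarrow> 'a::real_vector set \<Rightarrow> nat" where
  "num_faces i Q = card {F. F face_of Q \<and> has_aff_dim F i}"

definition std_gaussian :: "nat \<Rightarrow> (nat \<Rightarrow> real) measure" where
  "std_gaussian d = PiM {..<d} (\<lambda>_. density lborel (\<lambda>x. ennreal (std_normal_density x)))"

definition indep_std_gaussians ::
    "'a measure \<Rightarrow> nat \<Rightarrow> nat \<Rightarrow> (nat \<Rightarrow> 'a \<Rightarrow> nat \<Rightarrow> real) \<Rightarrow> bool" where
  "indep_std_gaussians M d n X \<longleftrightarrow>
     prob_space M \<and>
     prob_space.indep_vars M (\<lambda>_. PiM {..<d} (\<lambda>_. borel)) X {..<n} \<and>
     (\<forall>i<n. distr M (PiM {..<d} (\<lambda>_. borel)) (X i) = std_gaussian d)"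

definition gaussian_polytope ::
    "nat \<Rightarrow> nat \<Rightarrow> (nat \<Rightarrow> 'a \<Rightarrow> nat \<Rightarrow> real) \<Rightarrow> 'a \<Rightarrow> (nat \<Rightarrow>\<^sub>0 real) set" where
  "gaussian_polytope d n X \<omega> = convex hull ((\<lambda>i. point d (X i \<omega>)) ` {..<n})"

end

theory Submission
  imports Defs "Jordan_Normal_Form.Determinant" "HOL-Real_Asymp.Real_Asymp"
begin

text \<open>
  The polytope is almost surely simplicial, so a facet is a set of \<open>d\<close> of the \<open>n\<close> points such that the
  hyperplane spanned by them has all the other points on one side. Given the hyperplane, each of the
  other \<open>n - d\<close> points is independently on a given side with a probability that depends only on the
  distance of the hyperplane from the origin; \<open>\<Phi> h\<close> is this probability for the side of the origin at
  distance \<open>h\<close>, where \<open>\<Phi>\<close> is the normal distribution function with density \<open>\<phi>\<close>. The distance is distributed as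
  \<open>\<bar>N\<bar> / sqrt d\<close> with \<open>N\<close> standard normal (\<open>nn_integral_hyp_dist_ones\<close>). One sees this by solving the
  linear system \<open>p i \<bullet> v = 1\<close> for the hyperplane: by the rotation invariance of the Gaussian array, the
  right-hand side \<open>(1, \<dots>, 1)\<close> may be replaced by \<open>(sqrt d, 0, \<dots>, 0)\<close>, and then the solution can be
  read off. By linearity of the expectation (\<open>expectation_num_facets\<close>),
  \<open>E f = 2 * (n choose d) * E (\<Phi> (N / sqrt d) ^ (n - d))\<close>.

  The substitution \<open>s = 1 - \<Phi> h\<close> in this integral produces a Beta distribution. Let \<open>\<lambda>\<close> denote the hazard
  rate \<open>\<phi> / (1 - \<Phi>)\<close>, as a function of the tail probability \<open>s\<close>, and let \<open>S\<close> have the distribution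
  \<open>Beta(d, n - d + 1)\<close>. The binomial coefficient cancels against the Beta integral, and
  \<open>E f = 2 * d powr (- 1 / 2) * (2 * pi) powr ((d - 1) / 2) * E (\<lambda> S ^ (d - 1))\<close>
  (\<open>expectation_num_facets_eq_moment\<close>). It remains to see that \<open>E (\<lambda> S ^ (d - 1))\<close> is asymptotically
  \<open>(2 * ln n) powr ((d - 1) / 2)\<close>. The variable \<open>S\<close> is of the order \<open>d / n\<close>, and \<open>\<lambda> s ^ 2\<close> differs from
  \<open>2 * ln (1 / s)\<close> by a bounded amount from above (\<open>hazard_rate_bound\<close>) and by a term of the order of
  \<open>ln (ln (1 / s))\<close> from below (\<open>std_tail_lower\<close>). So \<open>\<lambda> S ^ 2\<close> equals \<open>2 * ln n\<close> up to a relative error of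
  the order of \<open>(ln d + ln (ln n)) / ln n\<close>. Raising this to the power \<open>(d - 1) / 2\<close> is harmless precisely
  because \<open>ln n\<close> is large compared with \<open>d * ln d\<close>. The moments of \<open>1 / S\<close> and \<open>S\<close> control the
  exceptional values of \<open>S\<close> (\<open>density_moment_upper\<close>, \<open>density_moment_lower\<close>).

  The number of facets must be a measurable function of the points also in degenerate positions, since
  the underlying probability spaces need not be complete. Therefore it is described for arbitrary
  points (\<open>num_facets_eq\<close>) by the supporting hyperplanes through \<open>d\<close> of the points, whose normal vectors
  are given by determinants.
\<close>

section \<open>Determinants as functions of the rows\<close>

definition unit_row :: "nat \<Rightarrow> nat \<Rightarrow> real" where
  "unit_row k l = (if l = k then 1 else 0)"

definition rows_det :: "nat \<Rightarrow> (nat \<Rightarrow> nat \<Rightarrow> real) \<Rightarrow> real" where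
  "rows_det d q = det (mat d d (\<lambda>(i, k). q i k))"

text \<open>
  The cofactor of an entry is written as the determinant with row \<open>i\<close> replaced by a unit vector,
  so that it visibly does not depend on row \<open>i\<close>. This is what makes it independent of that row when
  the rows are random.
\<close>

definition rows_cof :: "nat \<Rightarrow> (nat \<Rightarrow> nat \<Rightarrow> real) \<Rightarrow> nat \<Rightarrow> nat \<Rightarrow> real" where
  "rows_cof d q i k = rows_det d (q(i := unit_row k))"

lemma rows_det_cong:
  assumes "\<And>i k. i < d \<Longrightarrow> k < d \<Longrightarrow> q i k = q' i k"
  shows "rows_det d q = rows_det d q'"
  unfolding rows_det_def by (rule arg_cong[where f = det]) (auto simp: assms)

lemma rows_det_unit: "rows_det d unit_row = 1"
proof -
  have "mat d d (\<lambda>(i, k). unit_row i k) = (1\<^sub>m d :: real mat)"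
    by (auto simp: unit_row_def)
  then show ?thesis by (simp add: rows_det_def)
qed

lemma rows_det_expand:
  assumes i: "i < d"
  shows "rows_det d (q(i := x)) = (\<Sum>k<d. x k * rows_cof d q i k)"
proof -
  define c where "c k = cofactor (mat d d (\<lambda>(i, k). q i k)) i k" for k
  have del: "mat_delete (mat d d (\<lambda>(a, b). (q(i := y)) a b)) i j = mat_delete (mat d d (\<lambda>(i, k). q i k)) i j"
    if "j < d" for j y
    using i that by (intro eq_matI) (auto simp: mat_delete_def)
  have *: "rows_det d (q(i := y)) = (\<Sum>j<d. y j * c j)" for y
  proof -
    have "rows_det d (q(i := y)) = (\<Sum>j<d. mat d d (\<lambda>(a, b). (q(i := y)) a b) $$ (i,j) * cofactor (mat d d (\<lambda>(a, b). (q(i := y)) a b)) i j)"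
      unfolding rows_det_def by (rule laplace_expansion_row[OF _ i]) auto
    also have "\<dots> = (\<Sum>j<d. y j * c j)"
    proof (rule sum.cong[OF refl])
      fix j assume "j \<in> {..<d}"
      then have "j < d" by simp
      then have "mat d d (\<lambda>(a, b). (q(i := y)) a b) $$ (i, j) = y j" using i by simp
      then show "mat d d (\<lambda>(a, b). (q(i := y)) a b) $$ (i, j) * cofactor (mat d d (\<lambda>(a, b). (q(i := y)) a b)) i j = y j * c j"
        unfolding c_def cofactor_def del[OF \<open>j < d\<close>] by (rule arg_cong)
    qed
    finally show ?thesis .
  qed
  have "rows_cof d q i k = c k" if "k < d" for k
    using that by (simp add: rows_cof_def * unit_row_def if_distrib[where f = "\<lambda>t. t * _"] sum.delta cong: if_cong)
  then show ?thesis by (simp add: *)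
qed

lemma rows_det_identical:
  assumes "i < d" "j < d" "i \<noteq> j" "\<And>k. k < d \<Longrightarrow> q i k = q j k"
  shows "rows_det d q = 0"
  unfolding rows_det_def
  by (rule det_identical_rows[of _ d i j]) (use assms in \<open>auto simp: row_def\<close>)

text \<open>
  The cofactors along row \<open>i\<close> form a vector that is orthogonal to all the other rows: pairing them
  with row \<open>j\<close> gives the determinant in which row \<open>i\<close> has been overwritten by row \<open>j\<close>.
\<close>

lemma rows_cof_mult:
  assumes "i < d" "j < d"
  shows "(\<Sum>k<d. q j k * rows_cof d q i k) = (if i = j then rows_det d q else 0)"
proof -
  have "(\<Sum>k<d. q j k * rows_cof d q i k) = rows_det d (q(i := q j))"
    by (simp add: rows_det_expand assms)
  also have "\<dots> = (if i = j then rows_det d q else 0)"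
    using rows_det_identical[of i d j "q(i := q j)"] assms by auto
  finally show ?thesis .
qed

lemma rows_det_zero_iff_kernel:
  "rows_det d q = 0 \<longleftrightarrow> (\<exists>v. (\<exists>k<d. v k \<noteq> 0) \<and> (\<forall>i<d. (\<Sum>k<d. q i k * v k) = 0))"
proof -
  let ?A = "mat d d (\<lambda>(i, k). q i k)"
  have "rows_det d q = 0 \<longleftrightarrow> (\<exists>v. v \<in> carrier_vec d \<and> v \<noteq> 0\<^sub>v d \<and> ?A *\<^sub>v v = 0\<^sub>v d)"
    unfolding rows_det_def by (rule det_0_iff_vec_prod_zero) auto
  also have "\<dots> \<longleftrightarrow> (\<exists>v. (\<exists>k<d. v k \<noteq> 0) \<and> (\<forall>i<d. (\<Sum>k<d. q i k * v k) = 0))"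
  proof safe
    fix v :: "real vec" assume v: "v \<in> carrier_vec d" "v \<noteq> 0\<^sub>v d" "?A *\<^sub>v v = 0\<^sub>v d"
    have "\<exists>k<d. v $ k \<noteq> 0" using v(1,2) by (auto simp: vec_eq_iff)
    moreover have "(\<Sum>k<d. q i k * v $ k) = 0" if "i < d" for i
    proof -
      have "(?A *\<^sub>v v) $ i = 0" using v(3) that by simp
      then show ?thesis using that v(1)
        by (simp add: scalar_prod_def atLeast0LessThan)
    qed
    ultimately show "\<exists>v. (\<exists>k<d. v k \<noteq> 0) \<and> (\<forall>i<d. (\<Sum>k<d. q i k * v k) = 0)"
      by (intro exI[of _ "\<lambda>k. v $ k"]) auto
  next
    fix v k assume v: "k < d" "v k \<noteq> (0::real)" "\<forall>i<d. (\<Sum>k<d. q i k * v k) = 0"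
    show "\<exists>v. v \<in> carrier_vec d \<and> v \<noteq> 0\<^sub>v d \<and> ?A *\<^sub>v v = 0\<^sub>v d"
      by (rule exI[of _ "vec d v"])
        (use v in \<open>auto simp: vec_eq_iff scalar_prod_def atLeast0LessThan\<close>)
  qed
  finally show ?thesis .
qed

lemma rows_det_transpose: "rows_det d (\<lambda>i k. q k i) = rows_det d q"
proof -
  have "mat d d (\<lambda>(i, k). q k i) = transpose_mat (mat d d (\<lambda>(i, k). q i k))"
    by auto
  then show ?thesis by (simp add: rows_det_def det_transpose[of _ d])
qed

lemma rows_det_zero_iff_dependent:
  "rows_det d q = 0 \<longleftrightarrow> (\<exists>v. (\<exists>i<d. v i \<noteq> 0) \<and> (\<forall>k<d. (\<Sum>i<d. v i * q i k) = 0))"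
  using rows_det_zero_iff_kernel[of d "\<lambda>i k. q k i"]
  unfolding rows_det_transpose[of d q] by (simp only: mult.commute)

lemma borel_measurable_rows_det [measurable (raw)]:
  assumes "\<And>i k. i < d \<Longrightarrow> k < d \<Longrightarrow> (\<lambda>x. q x i k) \<in> borel_measurable M"
  shows "(\<lambda>x. rows_det d (q x)) \<in> borel_measurable M"
proof -
  have perm: "p i < d" if "p permutes {0..<d}" "i < d" for p i
    using permutes_in_image[OF that(1), of i] that(2) by auto
  have "rows_det d (q x) = (\<Sum>p | p permutes {0..<d}. signof p * (\<Prod>i = 0..<d. q x i (p i)))" for x
    unfolding rows_det_def det_def'[OF mat_carrier]
    by (intro sum.cong prod.cong arg_cong2[where f = "(*)"] refl) (auto simp: perm)
  then show ?thesis
    by (simp only:) (intro borel_measurable_sum borel_measurable_times borel_measurable_prod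
        borel_measurable_const assms; simp add: perm)
qed

section \<open>Facets and supporting hyperplanes\<close>

text \<open>
  A normal vector of the hyperplane through the points \<open>p 0, \<dots>, p (d - 1)\<close>: the generalized cross
  product of the differences \<open>p i - p 0\<close>. Row \<open>0\<close> of the matrix of differences is zero, but its
  entries do not enter the cofactors along that row.
\<close>

definition hyp_normal :: "nat \<Rightarrow> (nat \<Rightarrow> nat \<Rightarrow> real) \<Rightarrow> nat \<Rightarrow> real" where
  "hyp_normal d p k = rows_cof d (\<lambda>i l. p i l - p 0 l) 0 k"

text \<open>
  The affine functional that vanishes on the hyperplane through \<open>p 0, \<dots>, p (d - 1)\<close>; it is a
  polynomial in all the coordinates, hence measurable.
\<close>

definition offset :: "nat \<Rightarrow> (nat \<Rightarrow> nat \<Rightarrow> real) \<Rightarrow> (nat \<Rightarrow> real) \<Rightarrow> real" where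
  "offset d p x = (\<Sum>k<d. hyp_normal d p k * (x k - p 0 k))"

text \<open>
  Affine independence of \<open>p 0, \<dots>, p (d - 1)\<close>, expressed by the nonvanishing of polynomials. The
  equivalence is the content of the next lemmas.
\<close>

definition spanning :: "nat \<Rightarrow> (nat \<Rightarrow> nat \<Rightarrow> real) \<Rightarrow> bool" where
  "spanning d p \<longleftrightarrow> (\<exists>k<d. hyp_normal d p k \<noteq> 0)"

lemma offset_vertex:
  assumes "i < d"
  shows "offset d p (p i) = 0"
proof (cases "i = 0")
  case False
  have "offset d p (p i) = (\<Sum>k<d. (\<lambda>i l. p i l - p 0 l) i k * rows_cof d (\<lambda>i l. p i l - p 0 l) 0 k)"
    by (simp add: offset_def hyp_normal_def mult.commute)
  also have "\<dots> = 0"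
    using False assms by (subst rows_cof_mult) auto
  finally show ?thesis .
qed (simp add: offset_def)

lemma offset_eq_rows_det:
  assumes "0 < d"
  shows "offset d p x = rows_det d ((\<lambda>i l. p i l - p 0 l)(0 := \<lambda>l. x l - p 0 l))"
  by (simp add: rows_det_expand assms offset_def hyp_normal_def mult.commute)

lemma hyp_normal_eq_rows_det:
  "hyp_normal d p k = rows_det d ((\<lambda>i l. p i l - p 0 l)(0 := unit_row k))"
  by (simp add: hyp_normal_def rows_cof_def)

lemma sum_split_first:
  fixes f :: "nat \<Rightarrow> 'a::comm_monoid_add"
  assumes "0 < d"
  shows "(\<Sum>i<d. f i) = f 0 + (\<Sum>i\<in>{1..<d}. f i)"
  using assms by (simp add: lessThan_atLeast0 sum.atLeast_Suc_lessThan)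

lemma sum_spanning_rows:
  fixes c :: "nat \<Rightarrow> real"
  assumes "0 < d"
  shows "(\<Sum>i<d. c i * ((\<lambda>i l. p i l - p 0 l)(0 := y)) i k) = c 0 * y k + (\<Sum>i\<in>{1..<d}. c i * (p i k - p 0 k))"
  by (simp add: sum_split_first[OF assms])

text \<open>
  A nontrivial linear relation among the differences \<open>p i - p 0\<close>, \<open>1 \<le> i\<close>, is a relation among the rows
  of every matrix obtained by putting a unit vector in row \<open>0\<close>, so all components of the normal vector
  would vanish.
\<close>

lemma spanning_imp_independent_rows:
  assumes "spanning d p" and "\<And>k. k < d \<Longrightarrow> (\<Sum>i\<in>{1..<d}. c i * (p i k - p 0 k)) = 0"
    and "1 \<le> i" "i < d"
  shows "c i = 0"
proof (rule ccontr)
  assume "c i \<noteq> 0"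
  have d: "0 < d" using assms by simp
  obtain j where j: "j < d" "hyp_normal d p j \<noteq> 0" using assms by (auto simp: spanning_def)
  have "rows_det d ((\<lambda>i l. p i l - p 0 l)(0 := unit_row j)) = 0"
    unfolding rows_det_zero_iff_dependent
  proof (rule exI[of _ "c(0 := 0)"], rule conjI)
    show "\<exists>i<d. (c(0 := 0)) i \<noteq> 0" using assms \<open>c i \<noteq> 0\<close> by (intro exI[of _ i]) auto
    show "\<forall>k<d. (\<Sum>i<d. (c(0 := 0)) i * ((\<lambda>i l. p i l - p 0 l)(0 := unit_row j)) i k) = 0"
      unfolding sum_spanning_rows[OF d] using assms(2) by auto
  qed
  with j show False by (simp add: hyp_normal_eq_rows_det)
qed

lemma spanning_imp_affinely_independent:
  assumes sp: "spanning d p" and c: "(\<Sum>i<d. c i) = 0" "\<And>k. k < d \<Longrightarrow> (\<Sum>i<d. c i * p i k) = 0"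
    and i: "i < d"
  shows "c i = 0"
proof -
  have d: "0 < d" using i by simp
  have c0: "c 0 = - (\<Sum>i\<in>{1..<d}. c i)" using c(1) by (simp add: sum_split_first[OF d])
  have z: "c i = 0" if "1 \<le> i" "i < d" for i
  proof (rule spanning_imp_independent_rows[OF sp _ that])
    fix k assume k: "k < d"
    have "(\<Sum>i\<in>{1..<d}. c i * (p i k - p 0 k)) = (\<Sum>i\<in>{1..<d}. c i * p i k) - (\<Sum>i\<in>{1..<d}. c i) * p 0 k"
      by (simp add: algebra_simps sum_subtractf sum_distrib_left)
    also have "\<dots> = (\<Sum>i<d. c i * p i k)"
      by (simp add: sum_split_first[OF d] c0)
    finally show "(\<Sum>i\<in>{1..<d}. c i * (p i k - p 0 k)) = 0" using c(2)[OF k] by simp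
  qed
  moreover have "c 0 = 0" using c0 z by simp
  ultimately show ?thesis using i by (cases "i = 0") auto
qed

text \<open>
  If the functional vanishes at \<open>x\<close>, then the rows \<open>x - p 0\<close> and \<open>p i - p 0\<close> are linearly dependent.
  In such a relation the coefficient of \<open>x - p 0\<close> is not zero, because the other rows are independent,
  and one can solve for \<open>x\<close>.
\<close>

lemma on_hyperplane_imp_affine_combination:
  assumes sp: "spanning d p" and x: "offset d p x = 0"
  obtains b where "(\<Sum>i<d. b i) = 1" "\<And>k. k < d \<Longrightarrow> x k = (\<Sum>i<d. b i * p i k)"
proof -
  have d: "0 < d" using sp by (auto simp: spanning_def)
  have "rows_det d ((\<lambda>i l. p i l - p 0 l)(0 := \<lambda>l. x l - p 0 l)) = 0"
    using x by (simp add: offset_eq_rows_det[OF d])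
  then obtain v where v: "\<exists>i<d. v i \<noteq> 0"
      "\<And>k. k < d \<Longrightarrow> v 0 * (x k - p 0 k) + (\<Sum>i\<in>{1..<d}. v i * (p i k - p 0 k)) = 0"
    unfolding rows_det_zero_iff_dependent sum_spanning_rows[OF d] by blast
  have v0: "v 0 \<noteq> 0"
  proof
    assume "v 0 = 0"
    then have "v i = 0" if "1 \<le> i" "i < d" for i
      using spanning_imp_independent_rows[OF sp _ that, of v] v(2) by simp
    with \<open>v 0 = 0\<close> v(1) show False by (metis less_one not_le)
  qed
  define b where "b i = (if i = 0 then 1 + (\<Sum>i\<in>{1..<d}. v i) / v 0 else - v i / v 0)" for i
  have b1: "(\<Sum>i\<in>{1..<d}. b i * f i) = - (\<Sum>i\<in>{1..<d}. v i * f i) / v 0" for f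
    by (simp add: b_def sum_negf sum_divide_distrib)
  have "(\<Sum>i<d. b i) = 1"
    using b1[of "\<lambda>_. 1"] by (simp add: sum_split_first[OF d] b_def)
  moreover have "x k = (\<Sum>i<d. b i * p i k)" if "k < d" for k
  proof -
    define s t where "s = (\<Sum>i\<in>{1..<d}. v i * p i k)" and "t = (\<Sum>i\<in>{1..<d}. v i)"
    have "(\<Sum>i\<in>{1..<d}. v i * (p i k - p 0 k)) = s - t * p 0 k"
      by (simp add: s_def t_def algebra_simps sum_subtractf sum_distrib_left)
    with v(2)[OF that] have *: "v 0 * (x k - p 0 k) + (s - t * p 0 k) = 0" by simp
    have "(\<Sum>i<d. b i * p i k) = (1 + t / v 0) * p 0 k + - s / v 0"
      unfolding sum_split_first[OF d] b1 by (simp add: b_def s_def t_def)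
    also have "\<dots> = x k"
    proof -
      have "v 0 * ((1 + t / v 0) * p 0 k + - s / v 0) = v 0 * x k"
        using * v0 by (simp add: algebra_simps)
      then show ?thesis using v0 by simp
    qed
    finally show ?thesis by simp
  qed
  ultimately show ?thesis using that by blast
qed

text \<open>
  If the normal vector were zero, then every unit vector would be a combination of the differences
  \<open>p i - p 0\<close>. But these \<open>d - 1\<close> differences have a common nonzero orthogonal vector (the square matrix
  with the additional row \<open>p 0 - p 0\<close> is singular), which would then be orthogonal to all unit vectors.
\<close>

lemma affinely_independent_imp_spanning:
  assumes d: "0 < d"
    and ind: "\<And>c. (\<Sum>i<d. c i) = 0 \<Longrightarrow> (\<And>k. k < d \<Longrightarrow> (\<Sum>i<d. c i * p i k) = 0) \<Longrightarrow> (\<forall>i<d. c i = 0)"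
  shows "spanning d p"
proof (rule ccontr)
  assume "\<not> spanning d p"
  then have z: "hyp_normal d p k = 0" if "k < d" for k using that by (auto simp: spanning_def)
  have comb: "\<exists>b. \<forall>l<d. unit_row k l = (\<Sum>i\<in>{1..<d}. b i * (p i l - p 0 l))" if k: "k < d" for k
  proof -
    obtain v where v: "\<exists>i<d. v i \<noteq> 0"
      "\<And>l. l < d \<Longrightarrow> v 0 * unit_row k l + (\<Sum>i\<in>{1..<d}. v i * (p i l - p 0 l)) = 0"
      using z[OF k] unfolding hyp_normal_eq_rows_det rows_det_zero_iff_dependent sum_spanning_rows[OF d] by blast
    have v0: "v 0 \<noteq> 0"
    proof
      assume v0: "v 0 = 0"
      define c where "c i = (if i = 0 then - (\<Sum>i\<in>{1..<d}. v i) else v i)" for i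
      have c1: "(\<Sum>i\<in>{1..<d}. c i * f i) = (\<Sum>i\<in>{1..<d}. v i * f i)" for f
        by (simp add: c_def)
      have "\<forall>i<d. c i = 0"
      proof (rule ind)
        show "(\<Sum>i<d. c i) = 0" using c1[of "\<lambda>_. 1"] by (simp add: sum_split_first[OF d] c_def)
        show "(\<Sum>i<d. c i * p i l) = 0" if "l < d" for l
          using v(2)[OF that] v0 unfolding sum_split_first[OF d] c1
          by (simp add: c_def algebra_simps sum_subtractf sum_distrib_left)
      qed
      with v0 have "\<forall>i<d. v i = 0" by (metis c_def)
      with v(1) show False by blast
    qed
    have "unit_row k l = (\<Sum>i\<in>{1..<d}. (- v i / v 0) * (p i l - p 0 l))" if "l < d" for l
    proof -
      have "(\<Sum>i\<in>{1..<d}. (- v i / v 0) * (p i l - p 0 l)) = - (\<Sum>i\<in>{1..<d}. v i * (p i l - p 0 l)) / v 0"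
        by (simp add: sum_negf sum_divide_distrib)
      also have "(\<Sum>i\<in>{1..<d}. v i * (p i l - p 0 l)) = - (v 0 * unit_row k l)"
        using v(2)[OF that] by linarith
      finally show ?thesis using v0 by simp
    qed
    then show ?thesis by (intro exI[of _ "\<lambda>i. - v i / v 0"] allI impI)
  qed
  have "rows_det d (\<lambda>i l. p i l - p 0 l) = 0"
    unfolding rows_det_zero_iff_dependent using d
    by (intro exI[of _ "\<lambda>i. if i = 0 then 1 else 0"]) (auto simp: sum_split_first)
  then obtain v where v: "\<exists>k<d. v k \<noteq> 0" "\<And>i. i < d \<Longrightarrow> (\<Sum>k<d. (p i k - p 0 k) * v k) = 0"
    unfolding rows_det_zero_iff_kernel by blast
  have "v k = 0" if k: "k < d" for k
  proof -
    obtain b where b: "\<And>l. l < d \<Longrightarrow> unit_row k l = (\<Sum>i\<in>{1..<d}. b i * (p i l - p 0 l))"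
      using comb[OF k] by blast
    have "v k = (\<Sum>l<d. unit_row k l * v l)"
      using k by (simp add: unit_row_def if_distrib[where f = "\<lambda>t. t * _"] sum.delta cong: if_cong)
    also have "\<dots> = (\<Sum>l<d. \<Sum>i\<in>{1..<d}. b i * ((p i l - p 0 l) * v l))"
      by (intro sum.cong) (auto simp: b sum_distrib_left sum_distrib_right mult_ac)
    also have "\<dots> = (\<Sum>i\<in>{1..<d}. b i * (\<Sum>l<d. (p i l - p 0 l) * v l))"
      by (subst sum.swap) (simp add: sum_distrib_left)
    also have "\<dots> = 0" using v(2) by simp
    finally show ?thesis .
  qed
  with v(1) show False by blast
qed

text \<open>
  A point of a face is a convex combination of generators, and every generator \<open>s\<close> with positive
  weight lies in the face: the point is on the open segment between \<open>s\<close> and the normalized rest of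
  the combination. No topology is used, so this holds in every real vector space.
\<close>

lemma face_of_finite_convex_hull:
  fixes S :: "'a::real_vector set"
  assumes S: "finite S" and F: "F face_of convex hull S"
  shows "F = convex hull (F \<inter> S)"
proof
  show "convex hull (F \<inter> S) \<subseteq> F"
    using F by (intro hull_minimal) (auto simp: face_of_def)
  show "F \<subseteq> convex hull (F \<inter> S)"
  proof
    fix x assume x: "x \<in> F"
    then have "x \<in> convex hull S" using F face_of_imp_subset by blast
    then obtain u where u: "\<And>s. s \<in> S \<Longrightarrow> 0 \<le> u s" "sum u S = 1" "(\<Sum>s\<in>S. u s *\<^sub>R s) = x"
      unfolding convex_hull_finite[OF S] by blast
    have pos: "s \<in> F" if s: "s \<in> S" "0 < u s" for s
    proof (cases "x = s")
      case False
      have sum1: "sum u (S - {s}) = 1 - u s" using S s u(2) by (simp add: sum_diff1)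
      have "u s < 1"
      proof (rule ccontr)
        assume "\<not> u s < 1"
        moreover have "0 \<le> sum u (S - {s})" using u(1) by (intro sum_nonneg) auto
        ultimately have z: "sum u (S - {s}) = 0" "u s = 1" using sum1 by auto
        then have "\<forall>t\<in>S - {s}. u t = 0" using S u(1) by (subst (asm) sum_nonneg_eq_0_iff) auto
        then have "(\<Sum>t\<in>S - {s}. u t *\<^sub>R t) = 0" by (intro sum.neutral) auto
        then have "x = s" using u(3) z S s by (simp add: sum.remove)
        with False show False by simp
      qed
      define y where "y = (\<Sum>t\<in>S - {s}. (u t / (1 - u s)) *\<^sub>R t)"
      have y: "y \<in> convex hull S"
        unfolding y_def
      proof (rule convex_sum)
        show "(\<Sum>t\<in>S - {s}. u t / (1 - u s)) = 1"
          using sum1 \<open>u s < 1\<close> by (simp flip: sum_divide_distrib)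
      qed (use S u(1) \<open>u s < 1\<close> in \<open>auto simp: hull_inc\<close>)
      have "x = u s *\<^sub>R s + (1 - u s) *\<^sub>R y"
        using u(3) S s \<open>u s < 1\<close> unfolding y_def scaleR_sum_right by (simp add: sum.remove)
      moreover from this have "s \<noteq> y" using False by (metis add.commute diff_add_cancel scaleR_left_distrib scaleR_one)
      ultimately have "x \<in> open_segment y s"
        using s \<open>u s < 1\<close> by (auto simp: in_segment intro!: exI[of _ "u s"])
      moreover have "s \<in> convex hull S" using s by (simp add: hull_inc)
      ultimately show ?thesis using F x y unfolding face_of_def by blast
    qed (use x in simp)
    have "u s = 0" if "s \<in> S - F \<inter> S" for s
      using pos[of s] u(1)[of s] that by (cases "u s = 0") auto
    moreover from calculation have "sum u (F \<inter> S) = sum u S"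
      using S by (intro sum.mono_neutral_left) auto
    moreover from calculation have "(\<Sum>s\<in>F \<inter> S. u s *\<^sub>R s) = (\<Sum>s\<in>S. u s *\<^sub>R s)"
      using S by (intro sum.mono_neutral_left) auto
    ultimately have "sum u (F \<inter> S) = 1" "(\<Sum>s\<in>F \<inter> S. u s *\<^sub>R s) = x"
      using u(2,3) by auto
    then show "x \<in> convex hull (F \<inter> S)"
      using S u(1) by (subst convex_hull_finite) auto
  qed
qed

text \<open>
  The exchange lemma of linear algebra, applied to the differences with a base point of each set.
\<close>

lemma card_affine_basis_le:
  fixes A B :: "'a::real_vector set"
  assumes B: "finite B" and A: "\<not> affine_dependent A" and AB: "A \<subseteq> affine hull B"
  shows "finite A \<and> card A \<le> card B"
proof (cases "A = {}")
  case False
  then obtain a where a: "a \<in> A" by blast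
  have "B \<noteq> {}" using a AB by auto
  then obtain b where b: "b \<in> B" by blast
  let ?A = "(\<lambda>x. - a + x) ` (A - {a})" and ?B = "(\<lambda>x. - b + x) ` (B - {b})"
  have "independent ?A" using A affine_dependent_iff_dependent2[OF a] by blast
  moreover have "?A \<subseteq> span ?B"
  proof (rule image_subsetI)
    fix x assume "x \<in> A - {a}"
    then obtain s t where "x = b + s" "a = b + t" "s \<in> span ?B" "t \<in> span ?B"
      using AB a unfolding affine_hull_span2[OF b] by blast
    then show "- a + x \<in> span ?B" using span_diff[of s ?B t] by simp
  qed
  ultimately have "finite ?A \<and> card ?A \<le> card ?B"
    using B by (intro independent_span_bound) auto
  moreover have "finite (A - {a})" using calculation finite_imageD[of "\<lambda>x. - a + x" "A - {a}"] by simp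
  moreover have "card ?A = card (A - {a})" "card ?B = card (B - {b})" by (auto intro!: card_image)
  ultimately show ?thesis
    using card_Suc_Diff1[of A a] card_Suc_Diff1[OF B b] a by (metis Suc_le_mono finite_Diff_insert finite_Diff2 finite.emptyI finite_insert)
qed simp

lemma has_aff_dim_basis:
  fixes F T :: "'a::real_vector set"
  assumes "has_aff_dim F i" and "affine hull F = affine hull T"
  obtains A where "A \<subseteq> T" "finite A" "\<not> affine_dependent A" "card A = i + 1"
    "affine hull A = affine hull F"
proof -
  obtain B where B: "finite B" "\<not> affine_dependent B" "affine hull B = affine hull F" "card B = i + 1"
    using assms by (auto simp: has_aff_dim_def)
  obtain A where A: "A \<subseteq> T" "\<not> affine_dependent A" "affine hull T = affine hull A"
    using affine_basis_exists by blast
  have "finite A \<and> card A \<le> card B"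
    using A B assms by (intro card_affine_basis_le) (auto simp: hull_inc)
  moreover from this have "card B \<le> card A"
    using A B assms card_affine_basis_le[of A B] by (metis hull_subset)
  ultimately show ?thesis using that[of A] A B assms by simp
qed

lemma lookup_scaleR: "Poly_Mapping.lookup (r *\<^sub>R x) k = r *\<^sub>R Poly_Mapping.lookup x k"
proof -
  have "finite {i. r *\<^sub>R Poly_Mapping.lookup x i \<noteq> 0}"
    by (rule finite_subset[OF _ finite_lookup[of x]]) auto
  then show ?thesis by (simp add: scaleR_poly_mapping_def lookup_Abs_poly_mapping)
qed

lemma affine_combination_in_hull:
  fixes r :: "'b \<Rightarrow> 'a::real_vector"
  assumes K: "finite K" and "sum b K = 1"
  shows "(\<Sum>i\<in>K. b i *\<^sub>R r i) \<in> affine hull (r ` K)"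
proof -
  have "(\<Sum>v\<in>r ` K. sum b {i \<in> K. r i = v}) = sum b K"
    using K by (intro sum.group) auto
  moreover have "(\<Sum>v\<in>r ` K. sum b {i \<in> K. r i = v} *\<^sub>R v) = (\<Sum>v\<in>r ` K. \<Sum>i\<in>{i \<in> K. r i = v}. b i *\<^sub>R r i)"
    by (intro sum.cong) (auto simp: scaleR_sum_left)
  moreover have "\<dots> = (\<Sum>i\<in>K. b i *\<^sub>R r i)"
    using K by (intro sum.group) auto
  ultimately show ?thesis
    using assms by (subst affine_hull_finite) (auto intro!: exI[of _ "\<lambda>v. sum b {i \<in> K. r i = v}"])
qed

definition height :: "nat \<Rightarrow> (nat \<Rightarrow> nat \<Rightarrow> real) \<Rightarrow> (nat \<Rightarrow>\<^sub>0 real) \<Rightarrow> real" where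
  "height d q x = offset d q (Poly_Mapping.lookup x)"

lemma height_point: "height d q (point d x) = offset d q x"
  by (simp add: height_def offset_def lookup_point)

lemma height_affine_combination:
  assumes "sum u T = 1"
  shows "height d q (\<Sum>s\<in>T. u s *\<^sub>R r s) = (\<Sum>s\<in>T. u s * height d q (r s))"
proof -
  have "height d q (\<Sum>s\<in>T. u s *\<^sub>R r s)
      = (\<Sum>k<d. hyp_normal d q k * ((\<Sum>s\<in>T. u s * Poly_Mapping.lookup (r s) k) - (\<Sum>s\<in>T. u s * q 0 k)))"
    by (simp add: height_def offset_def lookup_sum lookup_scaleR assms flip: sum_distrib_right)
  also have "\<dots> = (\<Sum>k<d. \<Sum>s\<in>T. u s * (hyp_normal d q k * (Poly_Mapping.lookup (r s) k - q 0 k)))"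
    by (simp add: sum_distrib_left sum_distrib_right algebra_simps flip: sum_subtractf)
  also have "\<dots> = (\<Sum>s\<in>T. u s * height d q (r s))"
    by (subst sum.swap) (simp add: height_def offset_def sum_distrib_left)
  finally show ?thesis .
qed

lemma height_affine_hull:
  assumes "finite T" "\<And>s. s \<in> T \<Longrightarrow> height d q s = 0" "x \<in> affine hull T"
  shows "height d q x = 0"
proof -
  obtain u where u: "sum u T = 1" "(\<Sum>s\<in>T. u s *\<^sub>R s) = x"
    using assms by (auto simp: affine_hull_finite)
  have "height d q x = (\<Sum>s\<in>T. u s * height d q s)"
    using height_affine_combination[OF u(1), of d q "\<lambda>s. s"] u(2) by simp
  then show ?thesis using assms by simp
qed

lemma height_convex_hull_pos:
  assumes "finite T" "\<And>s. s \<in> T \<Longrightarrow> 0 < \<sigma> * height d q s" "x \<in> convex hull T"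
  shows "0 < \<sigma> * height d q x"
proof -
  obtain u where u: "\<And>s. s \<in> T \<Longrightarrow> 0 \<le> u s" "sum u T = 1" "(\<Sum>s\<in>T. u s *\<^sub>R s) = x"
    using assms by (auto simp: convex_hull_finite)
  have "height d q x = (\<Sum>s\<in>T. u s * height d q s)"
    using height_affine_combination[OF u(2), of d q "\<lambda>s. s"] u(3) by simp
  then have *: "\<sigma> * height d q x = (\<Sum>s\<in>T. u s * (\<sigma> * height d q s))"
    by (simp add: sum_distrib_left mult_ac)
  obtain s where "s \<in> T" "u s \<noteq> 0" using u(2) by (metis sum.neutral zero_neq_one)
  then have "0 < u s * (\<sigma> * height d q s)" using u(1)[of s] assms(2)[of s] by simp
  with \<open>s \<in> T\<close> show ?thesis unfolding *
    by (intro sum_pos2[of _ s]) (use assms u in \<open>auto intro: mult_nonneg_nonneg less_imp_le\<close>)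
qed

lemma lookup_convex_hull_points:
  assumes "x \<in> convex hull (point d ` A)" "d \<le> k"
  shows "Poly_Mapping.lookup x k = 0"
proof -
  have "convex hull (point d ` A) \<subseteq> {x. Poly_Mapping.lookup x k = 0}"
  proof (rule hull_minimal)
    show "convex {x. Poly_Mapping.lookup x k = (0::real)}"
      by (auto simp: convex_def lookup_add lookup_scaleR)
  qed (use assms in \<open>auto simp: lookup_point\<close>)
  then show ?thesis using assms by auto
qed

lemma on_hyperplane_imp_point_combination:
  assumes sp: "spanning d q" and x: "height d q x = 0" and sup: "\<And>k. d \<le> k \<Longrightarrow> Poly_Mapping.lookup x k = 0"
  obtains b where "(\<Sum>i<d. b i) = 1" "x = (\<Sum>i<d. b i *\<^sub>R point d (q i))"
proof -
  obtain b where b: "(\<Sum>i<d. b i) = 1" "\<And>k. k < d \<Longrightarrow> Poly_Mapping.lookup x k = (\<Sum>i<d. b i * q i k)"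
    using on_hyperplane_imp_affine_combination[OF sp] x unfolding height_def by blast
  have "x = (\<Sum>i<d. b i *\<^sub>R point d (q i))"
  proof (rule poly_mapping_eqI)
    fix k show "Poly_Mapping.lookup x k = Poly_Mapping.lookup (\<Sum>i<d. b i *\<^sub>R point d (q i)) k"
      using b(2)[of k] sup[of k] by (cases "k < d") (auto simp: lookup_sum lookup_scaleR lookup_point)
  qed
  with b(1) that show ?thesis by blast
qed

lemma spanning_imp_affinely_independent_points:
  assumes sp: "spanning d q"
  shows "inj_on (\<lambda>i. point d (q i)) {..<d}" "\<not> affine_dependent ((\<lambda>i. point d (q i)) ` {..<d})"
proof -
  have key: "c i = 0" if "(\<Sum>i<d. c i) = 0" "(\<Sum>i<d. c i *\<^sub>R point d (q i)) = 0" "i < d" for c i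
  proof (rule spanning_imp_affinely_independent[OF sp that(1) _ that(3)])
    fix k assume "k < d"
    then have "(\<Sum>i<d. c i * q i k) = Poly_Mapping.lookup (\<Sum>i<d. c i *\<^sub>R point d (q i)) k"
      by (simp add: lookup_sum lookup_scaleR lookup_point)
    then show "(\<Sum>i<d. c i * q i k) = 0" by (simp add: that(2))
  qed
  show inj: "inj_on (\<lambda>i. point d (q i)) {..<d}"
  proof (rule inj_onI, rule ccontr)
    fix i j assume ij: "i \<in> {..<d}" "j \<in> {..<d}" "point d (q i) = point d (q j)" "i \<noteq> j"
    let ?c = "\<lambda>l. (if l = i then 1 else 0) - (if l = j then 1 else 0 :: real)"
    have "?c i = 0"
    proof (rule key[of ?c i])
      show "(\<Sum>i<d. ?c i) = 0" using ij by (simp add: sum_subtractf)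
      show "(\<Sum>i<d. ?c i *\<^sub>R point d (q i)) = 0"
        using ij by (simp add: scaleR_diff_left sum_subtractf if_distrib[where f = "\<lambda>t. t *\<^sub>R _"] cong: if_cong)
    qed (use ij in simp)
    with ij show False by simp
  qed
  show "\<not> affine_dependent ((\<lambda>i. point d (q i)) ` {..<d})"
  proof
    assume "affine_dependent ((\<lambda>i. point d (q i)) ` {..<d})"
    then obtain U i where U: "(\<Sum>i<d. U (point d (q i))) = 0" "i < d" "U (point d (q i)) \<noteq> 0"
       "(\<Sum>i<d. U (point d (q i)) *\<^sub>R point d (q i)) = 0"
      by (auto simp: affine_dependent_explicit_finite sum.reindex[OF inj])
    then show False using key[of "\<lambda>i. U (point d (q i))" i] by simp
  qed
qed

text \<open>
  Any enumeration of \<open>I\<close> would do; a canonical one makes the points a function of the index set.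
\<close>

definition vertices :: "(nat \<Rightarrow> nat \<Rightarrow> real) \<Rightarrow> nat set \<Rightarrow> nat \<Rightarrow> nat \<Rightarrow> real" where
  "vertices p I i = p (sorted_list_of_set I ! i)"

definition on_facet :: "nat \<Rightarrow> nat \<Rightarrow> (nat \<Rightarrow> nat \<Rightarrow> real) \<Rightarrow> nat set \<Rightarrow> nat set" where
  "on_facet d n p I = {j. j < n \<and> offset d (vertices p I) (p j) = 0}"

text \<open>
  The hyperplane through the points with index in \<open>I\<close> supports the polytope. The zero set
  \<^const>\<open>on_facet\<close> may be larger than \<open>I\<close> when the points are not in general position. Keeping this
  case makes the number of facets a Borel function of the points everywhere.
\<close>

definition spans_facet :: "nat \<Rightarrow> nat \<Rightarrow> (nat \<Rightarrow> nat \<Rightarrow> real) \<Rightarrow> nat set \<Rightarrow> bool" where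
  "spans_facet d n p I \<longleftrightarrow> I \<subseteq> {..<n} \<and> card I = d \<and> spanning d (vertices p I) \<and>
     ((\<forall>j<n. 0 \<le> offset d (vertices p I) (p j)) \<or> (\<forall>j<n. offset d (vertices p I) (p j) \<le> 0))"

lemma bij_betw_nth_sorted_list:
  assumes "finite I"
  shows "bij_betw (\<lambda>i. sorted_list_of_set I ! i) {..<card I} I"
  using assms by (intro bij_betw_nth) auto

text \<open>
  The functional is zero on the affine hull of the points on the hyperplane and has a strict sign on the
  convex hull of the others, so these hulls are disjoint and the former points generate a face. Its
  affine hull is that of the \<open>d\<close> independent points with index in \<open>I\<close>.
\<close>

lemma
  assumes d: "0 < d" and I: "spans_facet d n p I"
  defines "S \<equiv> (\<lambda>i. point d (p i)) ` {..<n}" and "F \<equiv> convex hull ((\<lambda>i. point d (p i)) ` on_facet d n p I)"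
  shows spans_facet_imp_face: "F face_of convex hull S"
    and spans_facet_imp_has_aff_dim: "has_aff_dim F (d - 1)"
    and spans_facet_mem_face: "j < n \<Longrightarrow> point d (p j) \<in> F \<Longrightarrow> j \<in> on_facet d n p I"
proof -
  define q where "q = vertices p I"
  let ?P = "\<lambda>i. point d (p i)"
  define T where "T = ?P ` on_facet d n p I"
  have F: "F = convex hull T" by (simp add: F_def T_def)
  have I': "I \<subseteq> {..<n}" "finite I" "card I = d" "spanning d q"
    using I finite_subset[of I "{..<n}"] by (auto simp: spans_facet_def q_def)
  have onf: "j \<in> on_facet d n p I \<longleftrightarrow> j < n \<and> height d q (?P j) = 0" for j
    by (simp add: on_facet_def height_point q_def)
  have T: "finite T" "T \<subseteq> S"
    by (auto simp: T_def S_def on_facet_def)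
  have T0: "height d q x = 0" if "x \<in> affine hull T" for x
    by (rule height_affine_hull[OF T(1) _ that]) (auto simp: T_def onf)
  have FT: "F \<subseteq> affine hull T" by (simp add: F convex_hull_subset_affine_hull)
  \<comment> \<open>The sign \<open>\<sigma>\<close> reduces both sides of the hyperplane to one case.\<close>
  obtain \<sigma> :: real where \<sigma>: "\<sigma> = 1 \<or> \<sigma> = -1" "\<And>j. j < n \<Longrightarrow> 0 \<le> \<sigma> * height d q (?P j)"
  proof (cases "\<forall>j<n. 0 \<le> offset d q (p j)")
    case True then show ?thesis using that[of 1] by (simp add: height_point)
  next
    case False
    then have "\<forall>j<n. offset d q (p j) \<le> 0" using I by (auto simp: spans_facet_def q_def)
    then show ?thesis using that[of "-1"] by (simp add: height_point)
  qed
  show "F face_of convex hull S"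
    unfolding F
  proof (rule face_of_convex_hulls)
    show "affine hull T \<inter> convex hull (S - T) = {}"
    proof (rule ccontr)
      assume "affine hull T \<inter> convex hull (S - T) \<noteq> {}"
      then obtain x where x: "x \<in> affine hull T" "x \<in> convex hull (S - T)" by auto
      have "0 < \<sigma> * height d q x"
      proof (rule height_convex_hull_pos[OF _ _ x(2)])
        fix s assume "s \<in> S - T"
        then obtain j where j: "j < n" "s = ?P j" "j \<notin> on_facet d n p I"
          by (auto simp: S_def T_def)
        then show "0 < \<sigma> * height d q s" using \<sigma>(1) \<sigma>(2)[OF j(1)] by (auto simp: onf)
      qed (simp add: S_def)
      with T0[OF x(1)] show False by simp
    qed
  qed (use T in \<open>auto simp: S_def\<close>)
  show "j < n \<Longrightarrow> ?P j \<in> F \<Longrightarrow> j \<in> on_facet d n p I"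
    using FT T0 by (auto simp: onf)
  define A where "A = (\<lambda>i. point d (q i)) ` {..<d}"
  have A: "A = ?P ` I"
  proof -
    have "?P ` I = ?P ` (\<lambda>i. sorted_list_of_set I ! i) ` {..<d}"
      using bij_betw_imp_surj_on[OF bij_betw_nth_sorted_list[OF I'(2)]] I'(3) by simp
    then show ?thesis by (simp add: A_def q_def vertices_def image_image)
  qed
  have "I \<subseteq> on_facet d n p I"
  proof
    fix i assume i: "i \<in> I"
    then obtain l where "l < d" "i = sorted_list_of_set I ! l"
      using bij_betw_imp_surj_on[OF bij_betw_nth_sorted_list[OF I'(2)]] I'(3) by (metis imageE lessThan_iff)
    then have "p i = q l" by (simp add: q_def vertices_def)
    then show "i \<in> on_facet d n p I"
      using i I'(1) offset_vertex[OF \<open>l < d\<close>, of q] by (auto simp: onf height_point)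
  qed
  then have "A \<subseteq> T" by (auto simp: A T_def)
  have "T \<subseteq> affine hull A"
  proof
    fix x assume "x \<in> T"
    then obtain j where j: "x = ?P j" "height d q x = 0" by (auto simp: T_def onf)
    obtain b where "(\<Sum>i<d. b i) = 1" "x = (\<Sum>i<d. b i *\<^sub>R point d (q i))"
      using on_hyperplane_imp_point_combination[OF I'(4) j(2)] j(1) by (auto simp: lookup_point)
    then show "x \<in> affine hull A"
      unfolding A_def by (simp add: affine_combination_in_hull)
  qed
  then have "affine hull T = affine hull A"
    using \<open>A \<subseteq> T\<close> by (metis affine_affine_hull hull_minimal hull_mono subset_antisym)
  then have "affine hull F = affine hull A" by (simp add: F affine_hull_convex_hull)
  moreover have "card A = d" "\<not> affine_dependent A"
    using spanning_imp_affinely_independent_points[OF I'(4)] by (auto simp: A_def card_image)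
  ultimately show "has_aff_dim F (d - 1)"
    unfolding has_aff_dim_def
  proof (intro exI[of _ A] conjI)
    show "finite A" by (simp add: A_def)
    show "card A = d - 1 + 1" using d \<open>card A = d\<close> by simp
  qed simp_all
qed

text \<open>
  A face \<open>F\<close> of dimension \<open>d - 1\<close> contains \<open>d\<close> affinely independent points of the given family. Let \<open>c\<close>
  be their barycentre. If a point \<open>z\<close> of the polytope lies in the hyperplane that they span, then \<open>c\<close> is
  in the open segment between \<open>z\<close> and a point of \<open>F\<close> slightly beyond \<open>c\<close>, so \<open>z \<in> F\<close>. If two points
  were strictly on opposite sides, then their segment would cross the hyperplane in a point of \<open>F\<close>,
  and both would belong to \<open>F\<close>.
\<close>

lemma face_imp_spans_facet:
  assumes d: "0 < d" and face: "F face_of convex hull ((\<lambda>i. point d (p i)) ` {..<n})"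
    and dim: "has_aff_dim F (d - 1)"
  obtains I where "spans_facet d n p I" "F = convex hull ((\<lambda>i. point d (p i)) ` on_facet d n p I)"
proof -
  let ?P = "\<lambda>i. point d (p i)"
  define S where "S = ?P ` {..<n}"
  define Q where "Q = convex hull S"
  have S: "finite S" and FQ: "F face_of Q" using face by (simp_all add: S_def Q_def)
  have F: "F = convex hull (F \<inter> S)"
    using face_of_finite_convex_hull[OF S] FQ by (simp add: Q_def)
  have "affine hull F = affine hull (F \<inter> S)"
    by (subst F) (rule affine_hull_convex_hull)
  then obtain A where A: "A \<subseteq> F \<inter> S" "finite A" "\<not> affine_dependent A" "card A = d"
      "affine hull A = affine hull F"
    using has_aff_dim_basis[OF dim] d by (metis Suc_diff_1 Suc_eq_plus1)
  define g where "g = inv_into {..<n} ?P"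
  define I where "I = g ` A"
  have g: "g a < n" "?P (g a) = a" if "a \<in> A" for a
    using that A(1) inv_into_into[of a ?P "{..<n}"] f_inv_into_f[of a ?P "{..<n}"]
    by (auto simp: g_def S_def)
  have injg: "inj_on g A" using g(2) by (metis inj_onI)
  have I: "I \<subseteq> {..<n}" "finite I" "card I = d"
    using g A by (auto simp: I_def card_image[OF injg])
  define q where "q = vertices p I"
  let ?h = "height d q"
  define r where "r i = point d (q i)" for i
  have PI: "bij_betw ?P I A"
    unfolding bij_betw_def I_def by (auto simp: inj_on_def image_image g)
  have r: "bij_betw r {..<d} A"
    using bij_betw_trans[OF bij_betw_nth_sorted_list[OF I(2)] PI] I(3)
    unfolding r_def q_def vertices_def by (simp add: comp_def)
  have sp: "spanning d q"
  proof (rule affinely_independent_imp_spanning[OF d])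
    fix c assume c: "(\<Sum>i<d. c i) = 0" "\<And>k. k < d \<Longrightarrow> (\<Sum>i<d. c i * q i k) = 0"
    have "(\<Sum>i<d. c i *\<^sub>R r i) = 0"
    proof (rule poly_mapping_eqI)
      fix k show "Poly_Mapping.lookup (\<Sum>i<d. c i *\<^sub>R r i) k = Poly_Mapping.lookup 0 k"
        using c(2)[of k] by (cases "k < d") (simp_all add: lookup_sum lookup_scaleR lookup_point r_def)
    qed
    define u where "u a = c (inv_into {..<d} r a)" for a
    have ur: "u (r i) = c i" if "i < d" for i
      using that bij_betw_imp_inj_on[OF r] by (simp add: u_def)
    have "sum u A = 0"
      using c(1) sum.reindex_bij_betw[OF r, of u] by (simp add: ur)
    moreover have "(\<Sum>a\<in>A. u a *\<^sub>R a) = 0"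
      using \<open>(\<Sum>i<d. c i *\<^sub>R r i) = 0\<close> sum.reindex_bij_betw[OF r, of "\<lambda>a. u a *\<^sub>R a"] by (simp add: ur)
    ultimately have "\<forall>a\<in>A. u a = 0"
      using A(3) by (auto simp: affine_dependent_explicit_finite[OF A(2)])
    then show "\<forall>i<d. c i = 0" using ur bij_betwE[OF r] by (metis lessThan_iff)
  qed
  have convF: "convex F" using FQ by (simp add: face_of_def)
  have rF: "r i \<in> F" if "i < d" for i using that bij_betwE[OF r] A(1) by auto
  \<comment> \<open>The point \<open>y\<close> below is \<open>c + e * (c - z)\<close>; \<open>e\<close> is chosen such that its weights stay nonnegative.\<close>
  have on: "z \<in> F" if z: "z \<in> Q" "?h z = 0" for z
  proof -
    have "\<And>k. d \<le> k \<Longrightarrow> Poly_Mapping.lookup z k = 0"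
      using lookup_convex_hull_points[of z d "p ` {..<n}"] z(1) by (simp add: Q_def S_def image_image)
    then obtain b where b: "(\<Sum>i<d. b i) = 1" "z = (\<Sum>i<d. b i *\<^sub>R r i)"
      using on_hyperplane_imp_point_combination[OF sp z(2)] unfolding r_def by blast
    define e where "e = 1 / real d / (1 + (\<Sum>i<d. \<bar>b i\<bar>))"
    have e: "0 < e" using d by (simp add: e_def sum_nonneg add_pos_nonneg)
    have eb: "e * b i \<le> 1 / real d" if "i < d" for i
    proof -
      have "b i \<le> \<bar>b i\<bar>" by simp
      also have "\<dots> \<le> (\<Sum>i<d. \<bar>b i\<bar>)" using that by (intro member_le_sum) auto
      finally have "e * b i \<le> e * (1 + (\<Sum>i<d. \<bar>b i\<bar>))" using e by (intro mult_left_mono) auto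
      also have "\<dots> = 1 / real d"
      proof -
        have "0 \<le> (\<Sum>i<d. \<bar>b i\<bar>)" by (simp add: sum_nonneg)
        then have "1 + (\<Sum>i<d. \<bar>b i\<bar>) \<noteq> 0" by linarith
        then show ?thesis by (simp add: e_def)
      qed
      finally show ?thesis .
    qed
    define c where "c = (\<Sum>i<d. (1 / real d) *\<^sub>R r i)"
    define y where "y = (\<Sum>i<d. (1 / real d + e * (1 / real d - b i)) *\<^sub>R r i)"
    have c: "c \<in> F" unfolding c_def
      by (rule convex_sum) (use convF rF d in auto)
    have y: "y \<in> F" unfolding y_def
    proof (rule convex_sum)
      show "(\<Sum>i<d. 1 / real d + e * (1 / real d - b i)) = 1"
        using d b(1) by (simp add: sum.distrib sum_subtractf flip: sum_distrib_left)
      show "0 \<le> 1 / real d + e * (1 / real d - b i)" if "i \<in> {..<d}" for i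
      proof -
        have "0 \<le> e / real d" using e by simp
        then show ?thesis using eb[of i] that by (simp add: algebra_simps)
      qed
    qed (use convF rF in auto)
    have yc: "y = c + e *\<^sub>R (c - z)"
      by (simp add: y_def c_def b(2) scaleR_sum_right algebra_simps sum.distrib sum_subtractf)
    show ?thesis
    proof (cases "y = z")
      case False
      have "c = (1 - e / (1 + e)) *\<^sub>R y + (e / (1 + e)) *\<^sub>R z"
      proof -
        have "(1 + e) *\<^sub>R ((1 - e / (1 + e)) *\<^sub>R y + (e / (1 + e)) *\<^sub>R z) = y + e *\<^sub>R z"
          using e by (simp add: scaleR_add_right field_simps)
        also have "\<dots> = (1 + e) *\<^sub>R c" by (simp add: yc algebra_simps)
        finally show ?thesis using e by (subst (asm) scaleR_cancel_left) auto
      qed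
      then have "c \<in> open_segment y z"
        using False e by (auto simp: in_segment intro!: exI[of _ "e / (1 + e)"])
      then show ?thesis
        using FQ c y z(1) face_of_imp_subset[OF FQ] unfolding face_of_def by blast
    qed (use y in simp)
  qed
  have F0: "?h x = 0" if "x \<in> F" for x
  proof (rule height_affine_hull[OF A(2)])
    show "x \<in> affine hull A" using that A(5) by (simp add: hull_inc)
    show "?h s = 0" if "s \<in> A" for s
      using that bij_betw_imp_surj_on[OF r] offset_vertex[of _ d q] by (auto simp: r_def height_point)
  qed
  have PQ: "?P j \<in> Q" if "j < n" for j using that by (auto simp: Q_def S_def hull_inc)
  have side: "\<not> (0 < ?h (?P i) \<and> ?h (?P j) < 0)" if "i < n" "j < n" for i j
  proof
    assume *: "0 < ?h (?P i) \<and> ?h (?P j) < 0"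
    define t where "t = ?h (?P i) / (?h (?P i) - ?h (?P j))"
    have t: "0 < t" "t < 1" using * by (auto simp: t_def field_simps)
    define z where "z = (1 - t) *\<^sub>R ?P i + t *\<^sub>R ?P j"
    have "?P i \<noteq> ?P j" using * by auto
    then have z: "z \<in> open_segment (?P i) (?P j)"
      using t by (auto simp: in_segment z_def)
    have "?h z = (1 - t) * ?h (?P i) + t * ?h (?P j)"
      using height_affine_combination[of "\<lambda>b. if b then 1 - t else t" "{True, False}" d q "\<lambda>b. if b then ?P i else ?P j"]
      by (simp add: z_def)
    also have "\<dots> = ?h (?P i) - t * (?h (?P i) - ?h (?P j))"
      by (simp add: left_diff_distrib right_diff_distrib)
    also have "\<dots> = 0" using * by (simp add: t_def)
    finally have "?h z = 0" .
    moreover have "z \<in> Q"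
      using z PQ that convex_contains_open_segment[of Q] by (auto simp: Q_def)
    ultimately have "z \<in> F" by (rule on[rotated])
    then have "?P i \<in> F" using FQ z PQ that unfolding face_of_def by blast
    with F0 * show False by force
  qed
  have "spans_facet d n p I"
    unfolding spans_facet_def q_def[symmetric]
  proof (intro conjI I sp)
    show "(\<forall>j<n. 0 \<le> offset d q (p j)) \<or> (\<forall>j<n. offset d q (p j) \<le> 0)"
    proof (rule ccontr)
      assume "\<not> ?thesis"
      then obtain i j where "i < n" "j < n" "0 < offset d q (p i)" "offset d q (p j) < 0"
        by (auto simp: not_le)
      then show False using side[of i j] by (simp add: height_point)
    qed
  qed
  moreover have "F = convex hull (?P ` on_facet d n p I)"
  proof -
    have "F \<inter> S = ?P ` on_facet d n p I"
    proof (intro equalityI subsetI)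
      fix x assume "x \<in> F \<inter> S"
      then obtain j where "j < n" "x = ?P j" "?h x = 0" using F0 by (auto simp: S_def)
      then show "x \<in> ?P ` on_facet d n p I"
        by (auto simp: on_facet_def q_def[symmetric] height_point)
    next
      fix x assume "x \<in> ?P ` on_facet d n p I"
      then obtain j where j: "j < n" "x = ?P j" "?h x = 0"
        by (auto simp: on_facet_def q_def[symmetric] height_point)
      then show "x \<in> F \<inter> S" using on[of x] PQ[OF j(1)] by (auto simp: S_def)
    qed
    then show ?thesis using F by simp
  qed
  ultimately show ?thesis by (rule that)
qed

text \<open>
  A facet is determined by the set of indices of all the given points that it contains, and these sets
  are the sets \<^const>\<open>on_facet\<close> of the supporting hyperplanes.
\<close>

theorem num_facets_eq:
  assumes d: "0 < d"
  shows "num_faces (d - 1) (convex hull ((\<lambda>i. point d (p i)) ` {..<n}))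
    = card (on_facet d n p ` {I. spans_facet d n p I})"
proof -
  let ?hull = "\<lambda>Z. convex hull ((\<lambda>i. point d (p i)) ` Z)"
  have eq: "{F. F face_of ?hull {..<n} \<and> has_aff_dim F (d - 1)} = ?hull ` on_facet d n p ` {I. spans_facet d n p I}"
  proof (intro equalityI subsetI)
    fix F assume "F \<in> {F. F face_of ?hull {..<n} \<and> has_aff_dim F (d - 1)}"
    then have F: "F face_of ?hull {..<n}" "has_aff_dim F (d - 1)" by simp_all
    obtain I where I: "spans_facet d n p I" "F = ?hull (on_facet d n p I)"
      by (rule face_imp_spans_facet[OF d F])
    then have "on_facet d n p I \<in> on_facet d n p ` {I. spans_facet d n p I}" by simp
    with I(2) show "F \<in> ?hull ` on_facet d n p ` {I. spans_facet d n p I}" by (rule image_eqI)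
  next
    fix F assume "F \<in> ?hull ` on_facet d n p ` {I. spans_facet d n p I}"
    then obtain I where "spans_facet d n p I" "F = ?hull (on_facet d n p I)" by blast
    then show "F \<in> {F. F face_of ?hull {..<n} \<and> has_aff_dim F (d - 1)}"
      using spans_facet_imp_face[OF d, of n p I] spans_facet_imp_has_aff_dim[OF d, of n p I] by simp
  qed
  have "on_facet d n p I = {j. j < n \<and> point d (p j) \<in> ?hull (on_facet d n p I)}" if "spans_facet d n p I" for I
  proof (intro equalityI subsetI)
    fix j assume "j \<in> on_facet d n p I"
    then show "j \<in> {j. j < n \<and> point d (p j) \<in> ?hull (on_facet d n p I)}"
      by (simp add: hull_inc on_facet_def)
  next
    fix j assume "j \<in> {j. j < n \<and> point d (p j) \<in> ?hull (on_facet d n p I)}"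
    then show "j \<in> on_facet d n p I" using spans_facet_mem_face[OF d that, of j] by blast
  qed
  then have "inj_on ?hull (on_facet d n p ` {I. spans_facet d n p I})"
    by (intro inj_on_inverseI[where g = "\<lambda>G. {j. j < n \<and> point d (p j) \<in> G}"]) auto
  then show ?thesis unfolding num_faces_def eq by (rule card_image)
qed

section \<open>Rotation invariance of Gaussian arrays\<close>

abbreviation std_normal :: "real measure" where
  "std_normal \<equiv> density lborel (\<lambda>x. ennreal (std_normal_density x))"

lemma prob_space_std_normal: "prob_space std_normal"
  by (rule prob_space_normal_density) simp

text \<open>
  The joint density is a function of \<open>x\<^sup>2 + y\<^sup>2\<close>, and a rotation preserves the Lebesgue measure of
  the plane. For \<open>c \<noteq> 0\<close> the latter needs only affine substitutions in one variable: substituting for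
  \<open>x\<close> at fixed \<open>y\<close> gives the factor \<open>1 / \<bar>c\<bar>\<close>, and substituting for \<open>y\<close> afterwards gives \<open>\<bar>c\<bar>\<close>.
\<close>

lemma nn_integral_std_normal_rotation:
  fixes f :: "real \<Rightarrow> real \<Rightarrow> ennreal"
  assumes f [measurable]: "(\<lambda>(x, y). f x y) \<in> borel_measurable (borel \<Otimes>\<^sub>M borel)"
    and cs: "c\<^sup>2 + s\<^sup>2 = 1" "c \<noteq> 0"
  shows "(\<integral>\<^sup>+x. \<integral>\<^sup>+y. f (c * x + s * y) (c * y - s * x) \<partial>std_normal \<partial>std_normal)
       = (\<integral>\<^sup>+x. \<integral>\<^sup>+y. f x y \<partial>std_normal \<partial>std_normal)"
proof -
  let ?\<phi> = "\<lambda>x. ennreal (std_normal_density x)"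
  define g where "g x y = ?\<phi> x * ?\<phi> y * f x y" for x y
  have [measurable (raw)]: "(\<lambda>x. f (h x) (k x)) \<in> borel_measurable M"
    if "h \<in> borel_measurable M" "k \<in> borel_measurable M" for h k and M :: "'z measure"
    using measurable_compose[OF measurable_Pair[OF that] f] by simp
  have rot: "(c * x + s * y)\<^sup>2 + (c * y - s * x)\<^sup>2 = x\<^sup>2 + y\<^sup>2" for x y
  proof -
    have "(c * x + s * y)\<^sup>2 + (c * y - s * x)\<^sup>2 = (c\<^sup>2 + s\<^sup>2) * (x\<^sup>2 + y\<^sup>2)"
      by (simp add: power2_eq_square algebra_simps)
    then show ?thesis by (simp add: cs)
  qed
  have dens: "?\<phi> x * ?\<phi> y = ennreal (1 / (2 * pi) * exp (- (x\<^sup>2 + y\<^sup>2) / 2))" for x y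
    by (simp add: std_normal_density_def ennreal_mult[symmetric] mult_exp_exp[symmetric]
        real_sqrt_mult[symmetric] add_divide_distrib flip: mult_exp_exp)
      (simp add: exp_add[symmetric] exp_diff exp_minus field_simps)
  have to_g: "(\<integral>\<^sup>+x. \<integral>\<^sup>+y. h x y \<partial>std_normal \<partial>std_normal) = (\<integral>\<^sup>+x. \<integral>\<^sup>+y. ?\<phi> x * ?\<phi> y * h x y \<partial>lborel \<partial>lborel)"
    if [measurable]: "(\<lambda>(x, y). h x y) \<in> borel_measurable (borel \<Otimes>\<^sub>M borel)" for h :: "real \<Rightarrow> real \<Rightarrow> ennreal"
  proof -
    have "(\<integral>\<^sup>+x. \<integral>\<^sup>+y. h x y \<partial>std_normal \<partial>std_normal) = (\<integral>\<^sup>+x. ?\<phi> x * (\<integral>\<^sup>+y. ?\<phi> y * h x y \<partial>lborel) \<partial>lborel)"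
      by (simp add: nn_integral_density)
    also have "\<dots> = (\<integral>\<^sup>+x. \<integral>\<^sup>+y. ?\<phi> x * ?\<phi> y * h x y \<partial>lborel \<partial>lborel)"
      by (simp add: nn_integral_cmult[symmetric] mult.assoc)
    finally show ?thesis .
  qed
  have [measurable]: "(\<lambda>(x, y). g x y) \<in> borel_measurable (borel \<Otimes>\<^sub>M borel)"
    unfolding g_def by measurable
  have [measurable (raw)]: "(\<lambda>x. g (h x) (k x)) \<in> borel_measurable M"
    if [measurable]: "h \<in> borel_measurable M" "k \<in> borel_measurable M" for h k and M :: "'z measure"
    unfolding g_def by measurable
  define L where "L = (\<integral>\<^sup>+x. \<integral>\<^sup>+y. g (c * x + s * y) (c * y - s * x) \<partial>lborel \<partial>lborel)"
  have "(\<integral>\<^sup>+x. \<integral>\<^sup>+y. f (c * x + s * y) (c * y - s * x) \<partial>std_normal \<partial>std_normal) = L"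
    unfolding L_def g_def by (subst to_g) (simp_all add: dens rot)
  have "ennreal \<bar>c\<bar> * L = ennreal \<bar>c\<bar> * (\<integral>\<^sup>+y. \<integral>\<^sup>+x. g (c * x + s * y) (c * y - s * x) \<partial>lborel \<partial>lborel)"
    unfolding L_def by (subst lborel_pair.Fubini') simp_all
  also have "\<dots> = (\<integral>\<^sup>+y. ennreal \<bar>c\<bar> * (\<integral>\<^sup>+x. g (c * x + s * y) (c * y - s * x) \<partial>lborel) \<partial>lborel)"
    by (rule nn_integral_cmult[symmetric]) measurable
  also have "\<dots> = (\<integral>\<^sup>+y. \<integral>\<^sup>+u. g u ((y - s * u) / c) \<partial>lborel \<partial>lborel)"
  proof (rule nn_integral_cong)
    fix y
    have "(y - s * (s * y + c * x)) / c = c * y - s * x" for x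
    proof -
      have "y - s * (s * y + c * x) = (c\<^sup>2 + s\<^sup>2) * y - s * (s * y + c * x)" by (simp add: cs)
      also have "\<dots> = c * (c * y - s * x)" by (simp add: power2_eq_square algebra_simps)
      finally show ?thesis using cs by simp
    qed
    then show "ennreal \<bar>c\<bar> * (\<integral>\<^sup>+x. g (c * x + s * y) (c * y - s * x) \<partial>lborel) = (\<integral>\<^sup>+u. g u ((y - s * u) / c) \<partial>lborel)"
      by (subst nn_integral_real_affine[OF _ \<open>c \<noteq> 0\<close>, of "\<lambda>u. g u ((y - s * u) / c)" "s * y"])
        (simp_all add: add.commute)
  qed
  also have "\<dots> = (\<integral>\<^sup>+u. \<integral>\<^sup>+y. g u ((y - s * u) / c) \<partial>lborel \<partial>lborel)"
    by (subst lborel_pair.Fubini') simp_all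
  also have "\<dots> = (\<integral>\<^sup>+u. ennreal \<bar>c\<bar> * (\<integral>\<^sup>+v. g u v \<partial>lborel) \<partial>lborel)"
  proof (rule nn_integral_cong)
    fix u
    have "(s * u + c * v - s * u) / c = v" for v using cs by simp
    then show "(\<integral>\<^sup>+y. g u ((y - s * u) / c) \<partial>lborel) = ennreal \<bar>c\<bar> * (\<integral>\<^sup>+v. g u v \<partial>lborel)"
      by (subst nn_integral_real_affine[OF _ \<open>c \<noteq> 0\<close>, of "\<lambda>y. g u ((y - s * u) / c)" "s * u"]) simp_all
  qed
  also have "\<dots> = ennreal \<bar>c\<bar> * (\<integral>\<^sup>+u. \<integral>\<^sup>+v. g u v \<partial>lborel \<partial>lborel)"
    by (rule nn_integral_cmult) measurable
  finally have "L = (\<integral>\<^sup>+u. \<integral>\<^sup>+v. g u v \<partial>lborel \<partial>lborel)"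
    using cs by (simp add: ennreal_mult_cancel_left)
  also have "\<dots> = (\<integral>\<^sup>+x. \<integral>\<^sup>+y. f x y \<partial>std_normal \<partial>std_normal)"
    unfolding g_def by (rule to_g[symmetric]) measurable
  finally show ?thesis using \<open>_ = L\<close> by simp
qed

lemma measurable_fun_upd_same [measurable (raw)]:
  assumes "i \<in> I" "f \<in> measurable M (PiM I N)" "h \<in> measurable M (N i)"
  shows "(\<lambda>x. (f x)(i := h x)) \<in> measurable M (PiM I N)"
  using assms by (intro measurable_fun_upd[where J = I]) auto

text \<open>
  This form of Fubini's theorem replaces one component by an independent copy and keeps the index set, so
  that it can be applied several times in a row.
\<close>

lemma nn_integral_PiM_resample:
  assumes I: "finite I" "i \<in> I" and N: "\<And>i. prob_space (N i)"
    and f [measurable]: "f \<in> borel_measurable (PiM I N)"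
  shows "(\<integral>\<^sup>+x. f x \<partial>PiM I N) = (\<integral>\<^sup>+x. \<integral>\<^sup>+y. f (x(i := y)) \<partial>N i \<partial>PiM I N)"
proof -
  interpret product_prob_space N I by (rule product_prob_spaceI) (rule N)
  interpret Ni: prob_space "N i" by (rule N)
  define J where "J = I - {i}"
  have J: "I = insert i J" "finite J" "i \<notin> J" using I by (auto simp: J_def)
  have [measurable]: "(\<lambda>x. \<integral>\<^sup>+y. f (x(i := y)) \<partial>N i) \<in> borel_measurable (PiM I N)"
    using I by measurable
  have [measurable]: "f \<in> borel_measurable (PiM (insert i J) N)"
    "(\<lambda>x. \<integral>\<^sup>+y. f (x(i := y)) \<partial>N i) \<in> borel_measurable (PiM (insert i J) N)"
    unfolding J(1)[symmetric] by measurable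
  have "(\<integral>\<^sup>+x. \<integral>\<^sup>+y. f (x(i := y)) \<partial>N i \<partial>PiM I N)
      = (\<integral>\<^sup>+x. \<integral>\<^sup>+z. \<integral>\<^sup>+y. f (x(i := z, i := y)) \<partial>N i \<partial>N i \<partial>PiM J N)"
    unfolding J(1) by (rule product_nn_integral_insert) (use J in auto)
  also have "\<dots> = (\<integral>\<^sup>+x. \<integral>\<^sup>+y. f (x(i := y)) \<partial>N i \<partial>PiM J N)"
    by (simp add: prob_space.emeasure_space_1[OF N])
  also have "\<dots> = (\<integral>\<^sup>+x. f x \<partial>PiM I N)"
    unfolding J(1) by (rule product_nn_integral_insert[symmetric]) (use J in auto)
  finally show ?thesis ..
qed

lemma prob_space_std_gaussian: "prob_space (std_gaussian d)"
  unfolding std_gaussian_def by (intro prob_space_PiM prob_space_std_normal)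

lemma sets_std_gaussian [measurable_cong]: "sets (std_gaussian d) = sets (PiM {..<d} (\<lambda>_. borel))"
  unfolding std_gaussian_def by (rule sets_PiM_cong) auto

definition gaussian_array :: "'i set \<Rightarrow> nat \<Rightarrow> ('i \<Rightarrow> nat \<Rightarrow> real) measure" where
  "gaussian_array I d = PiM I (\<lambda>_. std_gaussian d)"

lemma sets_gaussian_array [measurable_cong]:
  "sets (gaussian_array I d) = sets (PiM I (\<lambda>_. PiM {..<d} (\<lambda>_. borel)))"
  unfolding gaussian_array_def by (rule sets_PiM_cong) (auto simp: sets_std_gaussian)

lemma measurable_gaussian_array_entry [measurable (raw)]:
  assumes "f \<in> measurable M (gaussian_array I d)" "i \<in> I" "k < d"
  shows "(\<lambda>x. f x i k) \<in> borel_measurable M"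
proof -
  have "(\<lambda>x. f x i) \<in> measurable M (PiM {..<d} (\<lambda>_. borel))"
    using assms by (intro measurable_compose[OF assms(1)]) (auto simp: gaussian_array_def sets_std_gaussian
      cong: measurable_cong_sets intro!: measurable_component_singleton)
  from measurable_compose[OF this measurable_component_singleton[of k]] assms(3)
  show ?thesis by simp
qed

lemma prob_space_gaussian_array: "prob_space (gaussian_array I d)"
  unfolding gaussian_array_def by (intro prob_space_PiM prob_space_std_gaussian)

lemma nn_integral_gaussian_array_resample:
  assumes "finite I" "i \<in> I" "f \<in> borel_measurable (gaussian_array I d)"
  shows "(\<integral>\<^sup>+p. f p \<partial>gaussian_array I d) = (\<integral>\<^sup>+p. \<integral>\<^sup>+x. f (p(i := x)) \<partial>std_gaussian d \<partial>gaussian_array I d)"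
  using assms unfolding gaussian_array_def
  by (intro nn_integral_PiM_resample prob_space_std_gaussian)

lemma nn_integral_gaussian_array_resample_entry:
  assumes I: "finite I" "i \<in> I" and k: "k < d" and f [measurable]: "f \<in> borel_measurable (gaussian_array I d)"
  shows "(\<integral>\<^sup>+p. f p \<partial>gaussian_array I d)
       = (\<integral>\<^sup>+p. \<integral>\<^sup>+a. f (p(i := (p i)(k := a))) \<partial>std_normal \<partial>gaussian_array I d)"
proof -
  let ?G = "gaussian_array I d"
  note I(2)[simp] k[simp]
  interpret N: prob_space std_normal by (rule prob_space_std_normal)
  have "(\<integral>\<^sup>+p. f p \<partial>?G) = (\<integral>\<^sup>+p. \<integral>\<^sup>+x. f (p(i := x)) \<partial>std_gaussian d \<partial>?G)"
    by (intro nn_integral_gaussian_array_resample I f)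
  also have "\<dots> = (\<integral>\<^sup>+p. \<integral>\<^sup>+x. \<integral>\<^sup>+a. f (p(i := x(k := a))) \<partial>std_normal \<partial>std_gaussian d \<partial>?G)"
  proof (rule nn_integral_cong)
    fix p assume "p \<in> space ?G"
    then have [measurable]: "(\<lambda>x. p(i := x)) \<in> measurable (std_gaussian d) ?G"
      unfolding gaussian_array_def using I(2) by (intro measurable_fun_upd_same) auto
    have "(\<lambda>x. f (p(i := x))) \<in> borel_measurable (PiM {..<d} (\<lambda>_. std_normal))"
      unfolding std_gaussian_def[symmetric] by measurable
    then show "(\<integral>\<^sup>+x. f (p(i := x)) \<partial>std_gaussian d) = (\<integral>\<^sup>+x. \<integral>\<^sup>+a. f (p(i := x(k := a))) \<partial>std_normal \<partial>std_gaussian d)"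
      unfolding std_gaussian_def by (intro nn_integral_PiM_resample) (auto intro: prob_space_std_normal)
  qed
  also have "\<dots> = (\<integral>\<^sup>+p. \<integral>\<^sup>+x. \<integral>\<^sup>+a. f ((p(i := x))(i := ((p(i := x)) i)(k := a))) \<partial>std_normal \<partial>std_gaussian d \<partial>?G)"
    by simp
  also have "\<dots> = (\<integral>\<^sup>+p. \<integral>\<^sup>+a. f (p(i := (p i)(k := a))) \<partial>std_normal \<partial>?G)"
    by (intro nn_integral_gaussian_array_resample[symmetric] I) measurable
  finally show ?thesis .
qed

text \<open>
  The rotation is restricted to the coordinates in \<open>K\<close>, so that invariance can be proved one coordinate
  at a time.
\<close>

definition rotate_rows :: "real \<Rightarrow> real \<Rightarrow> 'i \<Rightarrow> 'i \<Rightarrow> nat set \<Rightarrow> ('i \<Rightarrow> nat \<Rightarrow> real) \<Rightarrow> 'i \<Rightarrow> nat \<Rightarrow> real" where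
  "rotate_rows c s i j K p =
     p(i := (\<lambda>k. if k \<in> K then c * p i k + s * p j k else p i k),
       j := (\<lambda>k. if k \<in> K then c * p j k - s * p i k else p j k))"

lemma measurable_rotate_rows:
  assumes [simp]: "i \<in> I" "j \<in> I" and K: "K \<subseteq> {..<d}"
  shows "rotate_rows c s i j K \<in> measurable (gaussian_array I d) (gaussian_array I d)"
proof -
  let ?G = "gaussian_array I d"
  have *: "(\<lambda>p. (\<lambda>k. if k \<in> K then c * p i k + t * p j k else p i k)) \<in> measurable ?G (PiM {..<d} (\<lambda>_. borel))"
    if [simp]: "i \<in> I" "j \<in> I" for i j t
  proof (rule measurable_PiM_single')
    show "(\<lambda>p. if k \<in> K then c * p i k + t * p j k else p i k) \<in> borel_measurable ?G"
      if "k \<in> {..<d}" for k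
      proof -
      have [simp]: "k < d" using that by simp
      show ?thesis
      proof (cases "k \<in> K")
        case True
        have "(\<lambda>p. c * p i k + t * p j k) \<in> borel_measurable ?G" by measurable
        with True show ?thesis by simp
      next
        case False
        have "(\<lambda>p. p i k) \<in> borel_measurable ?G" by measurable
        with False show ?thesis by simp
      qed
    qed
    show "(\<lambda>p k. if k \<in> K then c * p i k + t * p j k else p i k) \<in> space ?G \<rightarrow> {..<d} \<rightarrow>\<^sub>E space borel"
      using K by (auto simp: gaussian_array_def space_PiM PiE_def Pi_def extensional_def std_gaussian_def)
  qed
  note [measurable] = *[of i j s] *[of j i "- s"]
  have "rotate_rows c s i j K = (\<lambda>p. p(i := (\<lambda>k. if k \<in> K then c * p i k + s * p j k else p i k),
       j := (\<lambda>k. if k \<in> K then c * p j k + (- s) * p i k else p j k)))"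
    by (auto simp: rotate_rows_def[abs_def] fun_eq_iff)
  also have "\<dots> \<in> measurable ?G ?G"
    by measurable
  finally show ?thesis .
qed

text \<open>
  For a single coordinate, resample the two entries concerned and use the rotation invariance of the
  normal distribution in the plane. The rotation in all coordinates is a composition of these.
\<close>

lemma nn_integral_gaussian_array_rotation:
  assumes I: "finite I" "i \<in> I" "j \<in> I" "i \<noteq> j" and cs: "c\<^sup>2 + s\<^sup>2 = 1" "c \<noteq> 0"
    and K: "finite K" "K \<subseteq> {..<d}" and f: "f \<in> borel_measurable (gaussian_array I d)"
  shows "(\<integral>\<^sup>+p. f (rotate_rows c s i j K p) \<partial>gaussian_array I d) = (\<integral>\<^sup>+p. f p \<partial>gaussian_array I d)"
  using K f
proof (induction K arbitrary: f rule: finite_induct)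
  case empty
  then show ?case by (simp add: rotate_rows_def)
next
  case (insert k K)
  let ?N = "std_normal"
  let ?G = "gaussian_array I d"
  note [measurable] = insert.prems(2)
  interpret N: prob_space ?N by (rule prob_space_std_normal)
  have k: "k < d" "k \<in> {..<d}" using insert.prems by auto
  note [simp] = I(2,3) k
  have rk [measurable]: "rotate_rows c s i j {k} \<in> measurable ?G ?G"
    by (rule measurable_rotate_rows) auto
  define u where "u p a b = p(i := (p i)(k := a), j := (p j)(k := b))" for p :: "'a \<Rightarrow> nat \<Rightarrow> real" and a b
  have twice: "(\<integral>\<^sup>+p. g p \<partial>?G) = (\<integral>\<^sup>+p. \<integral>\<^sup>+a. \<integral>\<^sup>+b. g (u p a b) \<partial>?N \<partial>?N \<partial>?G)"
    if [measurable]: "g \<in> borel_measurable ?G" for g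
  proof -
    have "(\<integral>\<^sup>+p. g p \<partial>?G) = (\<integral>\<^sup>+p. \<integral>\<^sup>+b. g (p(j := (p j)(k := b))) \<partial>?N \<partial>?G)"
      by (intro nn_integral_gaussian_array_resample_entry I k) measurable
    also have "\<dots> = (\<integral>\<^sup>+p. \<integral>\<^sup>+a. \<integral>\<^sup>+b. g ((p(i := (p i)(k := a)))(j := ((p(i := (p i)(k := a))) j)(k := b))) \<partial>?N \<partial>?N \<partial>?G)"
      by (intro nn_integral_gaussian_array_resample_entry I k) measurable
    finally show ?thesis using I(4) by (simp add: u_def)
  qed
  have split: "rotate_rows c s i j (insert k K) p = rotate_rows c s i j K (rotate_rows c s i j {k} p)" for p
    using I(4) insert.hyps by (auto simp: rotate_rows_def fun_eq_iff)
  have ru: "rotate_rows c s i j {k} (u p a b) = u p (c * a + s * b) (c * b - s * a)" for p a b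
    using I(4) by (auto simp: rotate_rows_def u_def fun_eq_iff)
  have [measurable]: "rotate_rows c s i j K \<in> measurable ?G ?G"
    using insert.prems by (intro measurable_rotate_rows) auto
  have "(\<integral>\<^sup>+p. f (rotate_rows c s i j (insert k K) p) \<partial>?G)
      = (\<integral>\<^sup>+p. \<integral>\<^sup>+a. \<integral>\<^sup>+b. f (rotate_rows c s i j K (u p (c * a + s * b) (c * b - s * a))) \<partial>?N \<partial>?N \<partial>?G)"
    unfolding split ru[symmetric] by (rule twice) measurable
  also have "\<dots> = (\<integral>\<^sup>+p. \<integral>\<^sup>+a. \<integral>\<^sup>+b. f (rotate_rows c s i j K (u p a b)) \<partial>?N \<partial>?N \<partial>?G)"
  proof (rule nn_integral_cong)
    fix p assume p: "p \<in> space ?G"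
    have pi: "p l \<in> space (PiM {..<d} (\<lambda>_. borel))" if "l \<in> I" for l
      using p that by (auto simp: gaussian_array_def space_PiM std_gaussian_def PiE_iff)
    have [measurable]: "(\<lambda>(a, b). u p a b) \<in> measurable (borel \<Otimes>\<^sub>M borel) ?G"
    proof -
      have [measurable]: "(\<lambda>_. p) \<in> measurable (borel \<Otimes>\<^sub>M borel) (PiM I (\<lambda>_. PiM {..<d} (\<lambda>_. borel)))"
        using p sets_eq_imp_space_eq[OF sets_gaussian_array] by (intro measurable_const) blast
      have [measurable]: "(\<lambda>_. p l) \<in> measurable (borel \<Otimes>\<^sub>M borel) (PiM {..<d} (\<lambda>_. borel))" if "l \<in> I" for l
        using pi[OF that] by (rule measurable_const)
      show ?thesis
        unfolding u_def case_prod_unfold by measurable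
    qed
    show "(\<integral>\<^sup>+a. \<integral>\<^sup>+b. f (rotate_rows c s i j K (u p (c * a + s * b) (c * b - s * a))) \<partial>?N \<partial>?N)
        = (\<integral>\<^sup>+a. \<integral>\<^sup>+b. f (rotate_rows c s i j K (u p a b)) \<partial>?N \<partial>?N)"
      by (rule nn_integral_std_normal_rotation[OF _ cs]) measurable
  qed
  also have "\<dots> = (\<integral>\<^sup>+p. f (rotate_rows c s i j K p) \<partial>?G)"
    by (rule twice[symmetric]) measurable
  also have "\<dots> = (\<integral>\<^sup>+p. f p \<partial>?G)"
    by (rule insert.IH) (use insert.prems in auto)
  finally show ?case .
qed

section \<open>The distance of a Gaussian hyperplane from the origin\<close>

text \<open>
  Sums of independent normal variables are normal, and the division normalizes the variance. The vanishing
  coefficients are left out because a normal distribution needs a positive variance.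
\<close>

lemma std_gaussian_linear_form:
  assumes w: "\<exists>k<d. w k \<noteq> 0"
  shows "distr (std_gaussian d) borel (\<lambda>x. (\<Sum>k<d. w k * x k) / sqrt (\<Sum>k<d. (w k)\<^sup>2)) = std_normal"
proof -
  let ?N = "std_gaussian d"
  interpret prob_space "?N" by (rule prob_space_std_gaussian)
  define K where "K = {k. k < d \<and> w k \<noteq> 0}"
  have K: "finite K" "K \<noteq> {}" "K \<subseteq> {..<d}" using w by (auto simp: K_def)
  define r where "r = sqrt (\<Sum>k<d. (w k)\<^sup>2)"
  have r: "r = sqrt (\<Sum>k\<in>K. \<bar>w k\<bar>\<^sup>2)"
    unfolding r_def power2_abs by (rule arg_cong[where f = sqrt], rule sum.mono_neutral_right) (auto simp: K_def)
  have "0 < (\<Sum>k\<in>K. \<bar>w k\<bar>\<^sup>2)" using K by (intro sum_pos) (auto simp: K_def)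
  then have "0 < r" by (simp add: r)
  have comp [measurable]: "random_variable borel (\<lambda>x. x k)" if "k < d" for k
    using that by (simp add: measurable_cong_sets[OF sets_std_gaussian refl])
  have dk: "distr ?N borel (\<lambda>x. x k) = std_normal" if "k < d" for k
  proof -
    have "distr ?N borel (\<lambda>x. x k) = distr ?N std_normal (\<lambda>x. x k)"
      by (rule distr_cong) auto
    also have "\<dots> = std_normal"
      unfolding std_gaussian_def using that by (intro distr_PiM_component prob_space_std_normal) auto
    finally show ?thesis .
  qed
  have "indep_vars (\<lambda>_. borel) (\<lambda>k x. x k) {..<d}"
  proof (subst indep_vars_iff_distr_eq_PiM')
    show "{..<d} \<noteq> {}" using w by auto
    have "distr ?N (PiM {..<d} (\<lambda>_. borel)) (\<lambda>x. \<lambda>k\<in>{..<d}. x k) = distr ?N ?N (\<lambda>x. x)"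
    proof (rule distr_cong)
      fix x assume "x \<in> space ?N"
      then show "(\<lambda>k\<in>{..<d}. x k) = x"
        unfolding std_gaussian_def space_PiM by (rule PiE_restrict)
    qed (auto simp: sets_std_gaussian)
    also have "\<dots> = PiM {..<d} (\<lambda>k. distr ?N borel (\<lambda>x. x k))"
      unfolding distr_id by (subst std_gaussian_def) (rule PiM_cong, auto simp: dk)
    finally show "distr ?N (PiM {..<d} (\<lambda>_. borel)) (\<lambda>x. \<lambda>k\<in>{..<d}. x k) = PiM {..<d} (\<lambda>k. distr ?N borel (\<lambda>x. x k))" .
  qed auto
  then have "indep_vars (\<lambda>_. borel) (\<lambda>k x. x k) K" by (rule indep_vars_subset) (use K in auto)
  then have ind: "indep_vars (\<lambda>_. borel) (\<lambda>k x. w k * x k) K"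
    by (rule indep_vars_compose2) auto
  have "distributed ?N lborel (\<lambda>x. w k * x k) (normal_density 0 \<bar>w k\<bar>)" if "k \<in> K" for k
  proof -
    have "distributed ?N lborel (\<lambda>x. x k) (normal_density 0 1)"
      unfolding distributed_def using that K dk[of k] by (auto simp: distr_cong[OF refl sets_lborel refl])
    from normal_density_affine[OF this, of "w k" 0] show ?thesis using that by (auto simp: K_def)
  qed
  then have "distributed ?N lborel (\<lambda>x. \<Sum>k\<in>K. w k * x k) (normal_density (\<Sum>k\<in>K. 0) (sqrt (\<Sum>k\<in>K. \<bar>w k\<bar>\<^sup>2)))"
    using K ind by (intro sum_indep_normal) (auto simp: K_def)
  then have "distributed ?N lborel (\<lambda>x. \<Sum>k\<in>K. w k * x k) (normal_density 0 r)"
    by (simp add: r)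
  from normal_density_affine[OF this \<open>0 < r\<close>, of "1 / r" 0] \<open>0 < r\<close>
  have "distributed ?N lborel (\<lambda>x. (\<Sum>k\<in>K. w k * x k) / r) std_normal_density"
    by simp
  then have "distr ?N lborel (\<lambda>x. (\<Sum>k\<in>K. w k * x k) / r) = std_normal"
    by (rule distributed_distr_eq_density)
  moreover have "(\<Sum>k<d. w k * x k) = (\<Sum>k\<in>K. w k * x k)" for x
    by (rule sum.mono_neutral_right) (auto simp: K_def)
  ultimately show ?thesis
    unfolding r_def[symmetric] by (simp cong: distr_cong)
qed

lemma AE_std_normal_neq: "AE x in std_normal. x \<noteq> t"
  using AE_lborel_singleton[of t] by (subst AE_density) (auto elim!: eventually_mono)

lemma norm_pos_iff_coord:
  fixes w :: "nat \<Rightarrow> real"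
  shows "0 < sqrt (\<Sum>k<d. (w k)\<^sup>2) \<longleftrightarrow> (\<exists>k<d. w k \<noteq> 0)"
proof -
  have "(\<Sum>k<d. (w k)\<^sup>2) = 0 \<longleftrightarrow> (\<forall>k<d. w k = 0)"
    by (subst sum_nonneg_eq_0_iff) auto
  moreover have "0 \<le> (\<Sum>k<d. (w k)\<^sup>2)" by (simp add: sum_nonneg)
  ultimately show ?thesis by (auto simp: less_le)
qed

lemma borel_measurable_linear_form [measurable]:
  "(\<lambda>x. \<Sum>k<d. w k * x k :: real) \<in> borel_measurable (std_gaussian d)"
proof -
  have [measurable]: "(\<lambda>x. x k) \<in> borel_measurable (std_gaussian d)" if "k < d" for k
    using that by (simp add: measurable_cong_sets[OF sets_std_gaussian refl])
  show ?thesis by measurable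
qed

lemma AE_std_gaussian_linear_form_neq:
  assumes w: "\<exists>k<d. w k \<noteq> 0"
  shows "AE x in std_gaussian d. (\<Sum>k<d. w k * x k) \<noteq> t"
proof -
  let ?N = "std_gaussian d"
  let ?r = "sqrt (\<Sum>k<d. (w k)\<^sup>2)"
  have "AE y in distr ?N borel (\<lambda>x. (\<Sum>k<d. w k * x k) / ?r). y \<noteq> t / ?r"
    unfolding std_gaussian_linear_form[OF w] by (rule AE_std_normal_neq)
  then have "AE x in ?N. (\<Sum>k<d. w k * x k) / ?r \<noteq> t / ?r"
    by (subst (asm) AE_distr_iff) auto
  then show ?thesis by eventually_elim auto
qed

lemma AE_gaussian_array_resample:
  assumes I: "finite I" "i \<in> I" and P [measurable]: "Measurable.pred (gaussian_array I d) P"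
    and ae: "AE p in gaussian_array I d. AE x in std_gaussian d. P (p(i := x))"
  shows "AE p in gaussian_array I d. P p"
proof -
  let ?G = "gaussian_array I d"
  interpret N: prob_space "std_gaussian d" by (rule prob_space_std_gaussian)
  note I(2)[simp]
  let ?f = "\<lambda>p. if P p then 0 else 1 :: ennreal"
  have "(\<integral>\<^sup>+p. ?f p \<partial>?G) = (\<integral>\<^sup>+p. \<integral>\<^sup>+x. ?f (p(i := x)) \<partial>std_gaussian d \<partial>?G)"
    by (intro nn_integral_gaussian_array_resample I) measurable
  also have "\<dots> = (\<integral>\<^sup>+p. 0 \<partial>?G)"
  proof (rule nn_integral_cong_AE, use ae in eventually_elim)
    fix p assume "AE x in std_gaussian d. P (p(i := x))"
    then have "AE x in std_gaussian d. ?f (p(i := x)) = 0" by eventually_elim auto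
    then have "(\<integral>\<^sup>+x. ?f (p(i := x)) \<partial>std_gaussian d) = (\<integral>\<^sup>+x. 0 \<partial>std_gaussian d)" by (rule nn_integral_cong_AE)
    then show "(\<integral>\<^sup>+x. ?f (p(i := x)) \<partial>std_gaussian d) = 0" by simp
  qed
  finally have "(\<integral>\<^sup>+p. ?f p \<partial>?G) = 0" by simp
  then have "AE p in ?G. ?f p = 0"
    by (subst (asm) nn_integral_0_iff_AE) auto
  then show ?thesis by eventually_elim (simp split: if_splits)
qed

text \<open>
  Start from the identity matrix and replace its rows by Gaussian rows one by one. The determinant is a
  linear form in the new row, and its coefficient at the entry \<open>m\<close> is the determinant before the
  replacement; since that one is almost surely not zero, neither is the new one.
\<close>

lemma AE_rows_det_neq_0: "AE p in gaussian_array {..<d} d. rows_det d p \<noteq> 0"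
proof -
  let ?G = "gaussian_array {..<d} d"
  define q where "q m p = (\<lambda>i. if i < m then p i else unit_row i)" for m and p :: "nat \<Rightarrow> nat \<Rightarrow> real"
  have "AE p in ?G. rows_det d (q m p) \<noteq> 0" if "m \<le> d" for m
    using that
  proof (induction m)
    case 0
    then show ?case by (simp add: q_def rows_det_unit cong: if_cong)
  next
    case (Suc m)
    then have m: "m < d" by simp
    have [measurable]: "(\<lambda>p. rows_det d (q (Suc m) p)) \<in> borel_measurable ?G"
    proof (rule borel_measurable_rows_det)
      fix i k assume [simp]: "i < d" "k < d"
      show "(\<lambda>p. q (Suc m) p i k) \<in> borel_measurable ?G"
        by (cases "i < Suc m") (simp_all add: q_def)
    qed
    have step: "q (Suc m) (p(m := x)) = (q m p)(m := x)" for p x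
      by (auto simp: q_def fun_eq_iff)
    have cof: "rows_cof d (q m p) m m = rows_det d (q m p)" for p
      unfolding rows_cof_def by (rule arg_cong[where f = "rows_det d"]) (auto simp: q_def)
    show ?case
    proof (rule AE_gaussian_array_resample)
      have "AE p in ?G. rows_det d (q m p) \<noteq> 0" using Suc by simp
      then show "AE p in ?G. AE x in std_gaussian d. rows_det d (q (Suc m) (p(m := x))) \<noteq> 0"
      proof eventually_elim
        case (elim p)
        then have "\<exists>k<d. rows_cof d (q m p) m k \<noteq> 0" using m cof by auto
        from AE_std_gaussian_linear_form_neq[OF this, of 0] show ?case
          unfolding step rows_det_expand[OF m] by (simp add: mult.commute)
      qed
    qed (use m in auto)
  qed
  from this[of d] have "AE p in ?G. rows_det d (q d p) \<noteq> 0" by simp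
  moreover have "rows_det d (q d p) = rows_det d p" for p
    by (rule rows_det_cong) (auto simp: q_def)
  ultimately show ?thesis by simp
qed

text \<open>
  Cramer's rule: this vector \<open>u\<close> satisfies \<open>p i \<bullet> u = det p * a i\<close> for all \<open>i < d\<close>.
\<close>

definition solution_dir :: "nat \<Rightarrow> (nat \<Rightarrow> nat \<Rightarrow> real) \<Rightarrow> (nat \<Rightarrow> real) \<Rightarrow> nat \<Rightarrow> real" where
  "solution_dir d p a k = (\<Sum>i<d. a i * rows_cof d p i k)"

text \<open>
  For an invertible matrix with rows \<open>p i\<close> this is \<open>1 / \<parallel>v\<parallel>\<close>, where \<open>v\<close> is the solution of
  \<open>p i \<bullet> v = a i\<close>. If all the \<open>a i\<close> are \<open>1\<close>, then \<open>v \<bullet> x = 1\<close> is the equation of the hyperplane through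
  the points \<open>p i\<close>, and the value is its distance from the origin. Other right-hand sides \<open>a\<close> are
  needed because rotations of the rows act on \<open>p\<close> and \<open>a\<close> simultaneously.
\<close>

definition hyp_dist :: "nat \<Rightarrow> (nat \<Rightarrow> nat \<Rightarrow> real) \<Rightarrow> (nat \<Rightarrow> real) \<Rightarrow> real" where
  "hyp_dist d p a = \<bar>rows_det d p\<bar> / sqrt (\<Sum>k<d. (solution_dir d p a k)\<^sup>2)"

lemma solution_dir_mult:
  assumes "j < d"
  shows "(\<Sum>k<d. p j k * solution_dir d p a k) = rows_det d p * a j"
proof -
  have "(\<Sum>k<d. p j k * solution_dir d p a k) = (\<Sum>i<d. a i * (\<Sum>k<d. p j k * rows_cof d p i k))"
    unfolding solution_dir_def sum_distrib_left by (subst sum.swap) (simp add: mult_ac)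
  also have "\<dots> = (\<Sum>i<d. if i = j then rows_det d p * a j else 0)"
    by (intro sum.cong) (auto simp: rows_cof_mult assms)
  finally show ?thesis using assms by simp
qed

text \<open>
  For invertible \<open>p\<close>, the solutions \<open>(w, b)\<close> of \<open>p i \<bullet> w = b * a i\<close> form a line.
\<close>

lemma hyp_dist_eq:
  assumes D: "rows_det d p \<noteq> 0" and w: "\<exists>k<d. w k \<noteq> 0"
    and sol: "\<And>i. i < d \<Longrightarrow> (\<Sum>k<d. p i k * w k) = b * a i"
  shows "hyp_dist d p a = \<bar>b\<bar> / sqrt (\<Sum>k<d. (w k)\<^sup>2)"
proof -
  let ?D = "rows_det d p" and ?u = "solution_dir d p a"
  have eq: "?D * w k = b * ?u k" if "k < d" for k
  proof (rule ccontr)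
    assume "?D * w k \<noteq> b * ?u k"
    moreover have "(\<Sum>k<d. p i k * (?D * w k - b * ?u k)) = 0" if "i < d" for i
    proof -
      have "(\<Sum>k<d. p i k * (?D * w k - b * ?u k)) = ?D * (\<Sum>k<d. p i k * w k) - b * (\<Sum>k<d. p i k * ?u k)"
        by (simp add: algebra_simps sum_subtractf sum_distrib_left)
      then show ?thesis by (simp add: sol solution_dir_mult that)
    qed
    ultimately have "?D = 0"
      unfolding rows_det_zero_iff_kernel using that by (intro exI[of _ "\<lambda>k. ?D * w k - b * ?u k"]) auto
    with D show False by simp
  qed
  have b: "b \<noteq> 0" using eq w D by fastforce
  have "?D\<^sup>2 * (\<Sum>k<d. (w k)\<^sup>2) = (\<Sum>k<d. (?D * w k)\<^sup>2)" by (simp add: sum_distrib_left power_mult_distrib)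
  also have "\<dots> = (\<Sum>k<d. (b * ?u k)\<^sup>2)" by (intro sum.cong) (simp_all add: eq)
  also have "\<dots> = b\<^sup>2 * (\<Sum>k<d. (?u k)\<^sup>2)" by (simp add: sum_distrib_left power_mult_distrib)
  finally have "\<bar>?D\<bar> * sqrt (\<Sum>k<d. (w k)\<^sup>2) = \<bar>b\<bar> * sqrt (\<Sum>k<d. (?u k)\<^sup>2)"
    by (metis real_sqrt_abs real_sqrt_mult)
  moreover have "0 < sqrt (\<Sum>k<d. (w k)\<^sup>2)" using w by (simp only: norm_pos_iff_coord)
  moreover from calculation b D have "sqrt (\<Sum>k<d. (?u k)\<^sup>2) \<noteq> 0" by auto
  ultimately show ?thesis
    unfolding hyp_dist_def by (simp add: field_simps)
qed

lemma rotate_rows_apply: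
  assumes "i \<noteq> j" "i < d" "j < d"
  shows "(\<Sum>k<d. rotate_rows c s i j {..<d} p l k * w k)
    = (if l = i then c * (\<Sum>k<d. p i k * w k) + s * (\<Sum>k<d. p j k * w k)
       else if l = j then c * (\<Sum>k<d. p j k * w k) - s * (\<Sum>k<d. p i k * w k)
       else (\<Sum>k<d. p l k * w k))"
  using assms by (simp add: rotate_rows_def sum_distrib_left algebra_simps sum.distrib sum_subtractf)

lemma rows_det_rotate_rows:
  assumes ij: "i \<noteq> j" "i < d" "j < d" and cs: "c\<^sup>2 + s\<^sup>2 = 1" and D: "rows_det d p \<noteq> 0"
  shows "rows_det d (rotate_rows c s i j {..<d} p) \<noteq> 0"
proof
  assume "rows_det d (rotate_rows c s i j {..<d} p) = 0"
  then obtain v where v: "\<exists>k<d. v k \<noteq> 0" "\<And>l. l < d \<Longrightarrow> (\<Sum>k<d. rotate_rows c s i j {..<d} p l k * v k) = 0"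
    unfolding rows_det_zero_iff_kernel by blast
  define x y where "x = (\<Sum>k<d. p i k * v k)" and "y = (\<Sum>k<d. p j k * v k)"
  have e: "c * x + s * y = 0" "c * y - s * x = 0"
    using v(2)[OF ij(2)] v(2)[OF ij(3)] ij(1) by (simp_all add: rotate_rows_apply[OF ij] x_def y_def)
  have fx: "x = c * (c * x + s * y) - s * (c * y - s * x)"
  proof -
    have "c * (c * x + s * y) - s * (c * y - s * x) = (c\<^sup>2 + s\<^sup>2) * x"
      by (simp add: power2_eq_square algebra_simps)
    then show ?thesis using cs by simp
  qed
  have fy: "y = s * (c * x + s * y) + c * (c * y - s * x)"
  proof -
    have "s * (c * x + s * y) + c * (c * y - s * x) = (c\<^sup>2 + s\<^sup>2) * y"
      by (simp add: power2_eq_square algebra_simps)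
    then show ?thesis using cs by simp
  qed
  have "x = 0" using fx unfolding e by simp
  have "y = 0" using fy unfolding e by simp
  have "(\<Sum>k<d. p l k * v k) = 0" if "l < d" for l
    using v(2)[OF that] \<open>x = 0\<close> \<open>y = 0\<close> by (auto simp: rotate_rows_apply[OF ij] x_def y_def split: if_splits)
  then have "rows_det d p = 0" unfolding rows_det_zero_iff_kernel using v(1) by blast
  with D show False by simp
qed

text \<open>
  The solution of a linear system does not change when its equations are rotated.
\<close>

lemma hyp_dist_rotate_rows:
  assumes ij: "i \<noteq> j" "i < d" "j < d" and cs: "c\<^sup>2 + s\<^sup>2 = 1" and D: "rows_det d p \<noteq> 0"
    and a: "\<exists>l<d. a l \<noteq> 0"
  shows "hyp_dist d (rotate_rows c s i j {..<d} p) (a(i := c * a i + s * a j, j := c * a j - s * a i)) = hyp_dist d p a"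
  unfolding hyp_dist_def[of d p a]
proof (rule hyp_dist_eq)
  show "rows_det d (rotate_rows c s i j {..<d} p) \<noteq> 0" by (rule rows_det_rotate_rows) fact+
  obtain l where l: "l < d" "a l \<noteq> 0" using a by blast
  then have "(\<Sum>k<d. p l k * solution_dir d p a k) \<noteq> 0" using D by (simp add: solution_dir_mult)
  then show "\<exists>k<d. solution_dir d p a k \<noteq> 0" by (metis (mono_tags, lifting) lessThan_iff mult_zero_right sum.neutral)
  show "(\<Sum>k<d. rotate_rows c s i j {..<d} p l k * solution_dir d p a k)
      = rows_det d p * (a(i := c * a i + s * a j, j := c * a j - s * a i)) l" if "l < d" for l
    unfolding rotate_rows_apply[OF ij] using that ij
    by (cases "l = i"; cases "l = j"; simp add: solution_dir_mult; simp add: algebra_simps)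
qed

lemma borel_measurable_rows_cof [measurable (raw)]:
  assumes "\<And>i k. i < d \<Longrightarrow> k < d \<Longrightarrow> (\<lambda>x. q x i k) \<in> borel_measurable M"
  shows "(\<lambda>x. rows_cof d (q x) i k) \<in> borel_measurable M"
  unfolding rows_cof_def
proof (rule borel_measurable_rows_det)
  fix l m assume "l < d" "m < d"
  with assms show "(\<lambda>x. ((q x)(i := unit_row k)) l m) \<in> borel_measurable M" by (cases "l = i") auto
qed

lemma borel_measurable_hyp_dist [measurable]:
  "(\<lambda>p. hyp_dist d p a) \<in> borel_measurable (gaussian_array {..<d} d)"
proof -
  have [measurable]: "(\<lambda>p. rows_det d p) \<in> borel_measurable (gaussian_array {..<d} d)"
    by (rule borel_measurable_rows_det) measurable
  have [measurable]: "(\<lambda>p. rows_cof d p i k) \<in> borel_measurable (gaussian_array {..<d} d)" for i k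
    by (rule borel_measurable_rows_cof) measurable
  show ?thesis unfolding hyp_dist_def solution_dir_def by measurable
qed

lemma nn_integral_hyp_dist_rotate:
  fixes F :: "real \<Rightarrow> ennreal"
  assumes F [measurable]: "F \<in> borel_measurable borel" and ij: "i \<noteq> j" "i < d" "j < d"
    and cs: "c\<^sup>2 + s\<^sup>2 = 1" "c \<noteq> 0" and a: "\<exists>l<d. a l \<noteq> 0"
  shows "(\<integral>\<^sup>+p. F (hyp_dist d p a) \<partial>gaussian_array {..<d} d)
    = (\<integral>\<^sup>+p. F (hyp_dist d p (a(i := c * a i + s * a j, j := c * a j - s * a i))) \<partial>gaussian_array {..<d} d)"
    (is "_ = (\<integral>\<^sup>+p. F (hyp_dist d p ?a) \<partial>_)")
proof -
  let ?H = "gaussian_array {..<d} d"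
  have "(\<integral>\<^sup>+p. F (hyp_dist d p a) \<partial>?H)
      = (\<integral>\<^sup>+p. F (hyp_dist d (rotate_rows c s i j {..<d} p) ?a) \<partial>?H)"
  proof (rule nn_integral_cong_AE, use AE_rows_det_neq_0 in eventually_elim)
    fix p assume "rows_det d p \<noteq> 0"
    then show "F (hyp_dist d p a) = F (hyp_dist d (rotate_rows c s i j {..<d} p) ?a)"
      using hyp_dist_rotate_rows[OF ij cs(1) _ a] by simp
  qed
  also have "\<dots> = (\<integral>\<^sup>+p. F (hyp_dist d p ?a) \<partial>?H)"
  proof (rule nn_integral_gaussian_array_rotation[OF _ _ _ ij(1) cs, where f = "\<lambda>p. F (hyp_dist d p ?a)"])
    show "(\<lambda>p. F (hyp_dist d p ?a)) \<in> borel_measurable ?H"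
      by (rule measurable_compose[OF borel_measurable_hyp_dist F])
  qed (use ij in simp_all)
  finally show ?thesis .
qed

text \<open>
  Rotating the equations \<open>0\<close> and \<open>m\<close>, for \<open>m = 1, 2, \<dots>\<close>, turns the right-hand side \<open>(1, \<dots>, 1)\<close> into
  \<open>(sqrt d, 0, \<dots>, 0)\<close> without changing the law of the coefficients. For the latter right-hand side the
  solution is orthogonal to all rows but the first. Its direction is that of the cofactors of row \<open>0\<close>,
  hence independent of this row, and the distance is \<open>1 / sqrt d\<close> times the length of the projection of
  a Gaussian vector to an independent direction.
\<close>

theorem nn_integral_hyp_dist_ones:
  fixes F :: "real \<Rightarrow> ennreal"
  assumes F [measurable]: "F \<in> borel_measurable borel" and d: "0 < d"
  shows "(\<integral>\<^sup>+p. F (hyp_dist d p (\<lambda>_. 1)) \<partial>gaussian_array {..<d} d) = (\<integral>\<^sup>+t. F (\<bar>t\<bar> / sqrt d) \<partial>std_normal)"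
proof -
  let ?G = "gaussian_array {..<d} d"
  \<comment> \<open>The right-hand side after \<open>m - 1\<close> rotations; \<open>a 1\<close> consists of ones.\<close>
  define a where "a m i = (if i = 0 then sqrt m else if i < m then 0 else 1)" for m i :: nat
  have "(\<integral>\<^sup>+p. F (hyp_dist d p (\<lambda>_. 1)) \<partial>?G) = (\<integral>\<^sup>+p. F (hyp_dist d p (a m)) \<partial>?G)" if "1 \<le> m" "m \<le> d" for m
    using that
  proof (induction m rule: dec_induct)
    case base
    have "a 1 = (\<lambda>_. 1)" by (auto simp: a_def fun_eq_iff)
    then show ?case by simp
  next
    case (step m)
    define c s where "c = sqrt m / sqrt (real (Suc m))" and "s = 1 / sqrt (real (Suc m))"
    have cs: "c\<^sup>2 + s\<^sup>2 = 1" "c \<noteq> 0"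
      using step.hyps by (auto simp: c_def s_def power_divide field_simps)
    have "(\<integral>\<^sup>+p. F (hyp_dist d p (\<lambda>_. 1)) \<partial>?G) = (\<integral>\<^sup>+p. F (hyp_dist d p (a m)) \<partial>?G)"
      using step by simp
    also have "\<dots> = (\<integral>\<^sup>+p. F (hyp_dist d p ((a m)(0 := c * a m 0 + s * a m m, m := c * a m m - s * a m 0))) \<partial>?G)"
      using step d cs by (intro nn_integral_hyp_dist_rotate F) (auto intro!: exI[of _ 0] simp: a_def)
    also have "(a m)(0 := c * a m 0 + s * a m m, m := c * a m m - s * a m 0) = a (Suc m)"
    proof -
      have "c * a m 0 + s * a m m = (sqrt m * sqrt m + 1) / sqrt (real (Suc m))"
        using step.hyps by (simp add: c_def s_def a_def add_divide_distrib)
      also have "\<dots> = real (Suc m) / sqrt (real (Suc m))" by simp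
      also have "\<dots> = sqrt (real (Suc m))" by (rule real_div_sqrt) simp
      finally have "c * a m 0 + s * a m m = sqrt (real (Suc m))" .
      moreover have "c * a m m - s * a m 0 = 0"
        using step.hyps by (simp add: c_def s_def a_def)
      ultimately show ?thesis using step.hyps by (auto simp: a_def fun_eq_iff)
    qed
    finally show ?case .
  qed
  then have "(\<integral>\<^sup>+p. F (hyp_dist d p (\<lambda>_. 1)) \<partial>?G) = (\<integral>\<^sup>+p. F (hyp_dist d p (a d)) \<partial>?G)" using d by simp
  also have "\<dots> = (\<integral>\<^sup>+p. \<integral>\<^sup>+x. F (hyp_dist d (p(0 := x)) (a d)) \<partial>std_gaussian d \<partial>?G)"
  proof (rule nn_integral_gaussian_array_resample)
    show "(\<lambda>p. F (hyp_dist d p (a d))) \<in> borel_measurable ?G"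
      by (rule measurable_compose[OF borel_measurable_hyp_dist F])
  qed (use d in simp_all)
  also have "\<dots> = (\<integral>\<^sup>+p. \<integral>\<^sup>+t. F (\<bar>t\<bar> / sqrt d) \<partial>std_normal \<partial>?G)"
  proof (rule nn_integral_cong_AE, use AE_rows_det_neq_0 in eventually_elim)
    fix p assume D: "rows_det d p \<noteq> 0"
    define w where "w = rows_cof d p 0"
    have w: "\<exists>k<d. w k \<noteq> 0"
    proof (rule ccontr)
      assume "\<not> ?thesis"
      then have "rows_det d (p(0 := p 0)) = 0"
        unfolding rows_det_expand[OF d] w_def by (intro sum.neutral) auto
      with D show False by simp
    qed
    let ?r = "sqrt (\<Sum>k<d. (w k)\<^sup>2)"
    have "hyp_dist d (p(0 := x)) (a d) = \<bar>(\<Sum>k<d. w k * x k) / ?r\<bar> / sqrt d" for x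
    proof -
      have "solution_dir d (p(0 := x)) (a d) k = sqrt d * w k" if "k < d" for k
      proof -
        have "solution_dir d (p(0 := x)) (a d) k = (\<Sum>i<d. if i = 0 then sqrt d * w k else 0)"
          unfolding solution_dir_def by (intro sum.cong) (auto simp: a_def w_def rows_cof_def)
        then show ?thesis using d by simp
      qed
      then have "(\<Sum>k<d. (solution_dir d (p(0 := x)) (a d) k)\<^sup>2) = d * (\<Sum>k<d. (w k)\<^sup>2)"
        by (simp add: power_mult_distrib sum_distrib_left)
      moreover have "rows_det d (p(0 := x)) = (\<Sum>k<d. w k * x k)"
        by (simp add: rows_det_expand[OF d] w_def mult.commute)
      ultimately have "hyp_dist d (p(0 := x)) (a d) = \<bar>\<Sum>k<d. w k * x k\<bar> / (sqrt d * ?r)"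
        unfolding hyp_dist_def by (simp only: real_sqrt_mult)
      moreover have "\<bar>(\<Sum>k<d. w k * x k) / ?r\<bar> = \<bar>\<Sum>k<d. w k * x k\<bar> / ?r"
        by (simp only: abs_divide abs_of_nonneg[OF real_sqrt_ge_zero[OF sum_nonneg[OF zero_le_power2]]])
      ultimately show ?thesis by (simp only: divide_divide_eq_left mult.commute)
    qed
    then have "(\<integral>\<^sup>+x. F (hyp_dist d (p(0 := x)) (a d)) \<partial>std_gaussian d)
        = (\<integral>\<^sup>+x. F (\<bar>(\<Sum>k<d. w k * x k) / ?r\<bar> / sqrt d) \<partial>std_gaussian d)" by simp
    also have "\<dots> = (\<integral>\<^sup>+t. F (\<bar>t\<bar> / sqrt d) \<partial>distr (std_gaussian d) borel (\<lambda>x. (\<Sum>k<d. w k * x k) / ?r))"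
      by (subst nn_integral_distr) auto
    finally show "(\<integral>\<^sup>+x. F (hyp_dist d (p(0 := x)) (a d)) \<partial>std_gaussian d) = (\<integral>\<^sup>+t. F (\<bar>t\<bar> / sqrt d) \<partial>std_normal)"
      by (simp only: std_gaussian_linear_form[OF w])
  qed
  also have "\<dots> = (\<integral>\<^sup>+t. F (\<bar>t\<bar> / sqrt d) \<partial>std_normal)"
    by (simp add: prob_space.emeasure_space_1[OF prob_space_gaussian_array])
  finally show ?thesis .
qed

section \<open>The probability that given points span a facet\<close>

definition std_cdf :: "real \<Rightarrow> real" where
  "std_cdf t = measure std_normal {..t}"

lemma std_cdf_nonneg: "0 \<le> std_cdf t"
  by (simp add: std_cdf_def)

lemma std_cdf_le_1: "std_cdf t \<le> 1"
proof -
  interpret prob_space std_normal by (rule prob_space_std_normal)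
  show ?thesis unfolding std_cdf_def by (rule prob_le_1)
qed

lemma borel_measurable_std_cdf [measurable]: "std_cdf \<in> borel_measurable borel"
proof (rule borel_measurable_mono)
  interpret prob_space std_normal by (rule prob_space_std_normal)
  show "mono std_cdf"
    unfolding std_cdf_def by (intro monoI finite_measure_mono) auto
qed

lemma emeasure_std_normal_atMost: "emeasure std_normal {..t} = ennreal (std_cdf t)"
proof -
  interpret prob_space std_normal by (rule prob_space_std_normal)
  show ?thesis unfolding std_cdf_def by (rule emeasure_eq_measure)
qed

lemma emeasure_std_normal_lessThan: "emeasure std_normal {..<t} = ennreal (std_cdf t)"
proof -
  have "emeasure std_normal {..<t} = emeasure std_normal {..t}"
    by (rule emeasure_eq_AE) (use AE_std_normal_neq[of t] in \<open>auto elim!: eventually_mono\<close>)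
  then show ?thesis by (simp add: emeasure_std_normal_atMost)
qed

lemma emeasure_std_normal_greaterThan: "emeasure std_normal {t<..} = ennreal (std_cdf (- t))"
proof -
  have "emeasure std_normal {t<..} = (\<integral>\<^sup>+x. ennreal (std_normal_density x) * indicator {t<..} x \<partial>lborel)"
    by (simp add: emeasure_density)
  also have "\<dots> = (\<integral>\<^sup>+x. ennreal (std_normal_density (0 + -1 * x)) * indicator {t<..} (0 + -1 * x) \<partial>lborel)"
    by (subst nn_integral_real_affine[where t = 0 and c = "-1"]) auto
  also have "\<dots> = (\<integral>\<^sup>+x. ennreal (std_normal_density x) * indicator {..<- t} x \<partial>lborel)"
    by (intro nn_integral_cong) (auto simp: std_normal_density_def indicator_def)
  also have "\<dots> = emeasure std_normal {..<- t}"
    by (simp add: emeasure_density)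
  finally show ?thesis by (simp add: emeasure_std_normal_lessThan)
qed

lemma std_cdf_minus: "std_cdf (- t) = 1 - std_cdf t"
proof -
  interpret prob_space std_normal by (rule prob_space_std_normal)
  have "std_cdf (- t) = measure std_normal {t<..}"
    using emeasure_std_normal_greaterThan[of t] std_cdf_nonneg by (simp add: measure_def)
  also have "{t<..} = space std_normal - {..t}" by auto
  finally show ?thesis unfolding std_cdf_def by (subst (asm) prob_compl) auto
qed

text \<open>
  The signed distance of the hyperplane from the origin, in the direction of \<^const>\<open>hyp_normal\<close>.
\<close>

definition signed_dist :: "nat \<Rightarrow> (nat \<Rightarrow> nat \<Rightarrow> real) \<Rightarrow> real" where
  "signed_dist d p = (\<Sum>k<d. hyp_normal d p k * p 0 k) / sqrt (\<Sum>k<d. (hyp_normal d p k)\<^sup>2)"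

lemma offset_eq_linear_form:
  "offset d p x = (\<Sum>k<d. hyp_normal d p k * x k) - (\<Sum>k<d. hyp_normal d p k * p 0 k)"
  by (simp add: offset_def algebra_simps sum_subtractf)

lemma borel_measurable_offset_const [measurable]: "offset d p \<in> borel_measurable (std_gaussian d)"
  unfolding offset_eq_linear_form[abs_def] by measurable

text \<open>
  The other points fall on either side of the hyperplane according to the projection to its unit normal,
  which is standard normal.
\<close>

lemma
  assumes sp: "spanning d p"
  shows emeasure_offset_pos: "emeasure (std_gaussian d) {x \<in> space (std_gaussian d). 0 < offset d p x} = ennreal (std_cdf (- signed_dist d p))"
    and emeasure_offset_neg: "emeasure (std_gaussian d) {x \<in> space (std_gaussian d). offset d p x < 0} = ennreal (std_cdf (signed_dist d p))"
    and AE_offset_neq_0: "AE x in std_gaussian d. offset d p x \<noteq> 0"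
proof -
  let ?w = "hyp_normal d p"
  let ?r = "sqrt (\<Sum>k<d. (?w k)\<^sup>2)" and ?h = "signed_dist d p"
  let ?L = "\<lambda>x. (\<Sum>k<d. ?w k * x k) / ?r"
  have w: "\<exists>k<d. ?w k \<noteq> 0" using sp by (simp add: spanning_def)
  then have r: "0 < ?r" by (simp only: norm_pos_iff_coord)
  have off: "offset d p x = ?r * (?L x - ?h)" for x
    using r by (simp add: offset_eq_linear_form signed_dist_def right_diff_distrib)
  have pos: "0 < offset d p x \<longleftrightarrow> ?L x \<in> {?h<..}" and neg: "offset d p x < 0 \<longleftrightarrow> ?L x \<in> {..<?h}" for x
    unfolding off using r by (simp_all add: zero_less_mult_iff mult_less_0_iff)
  have em: "emeasure (std_gaussian d) {x \<in> space (std_gaussian d). ?L x \<in> A} = emeasure std_normal A"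
    if "A \<in> sets borel" for A
  proof -
    have "emeasure (distr (std_gaussian d) borel ?L) A = emeasure (std_gaussian d) (?L -` A \<inter> space (std_gaussian d))"
      using that by (intro emeasure_distr) auto
    also have "?L -` A \<inter> space (std_gaussian d) = {x \<in> space (std_gaussian d). ?L x \<in> A}" by auto
    finally show ?thesis unfolding std_gaussian_linear_form[OF w] by simp
  qed
  show "emeasure (std_gaussian d) {x \<in> space (std_gaussian d). 0 < offset d p x} = ennreal (std_cdf (- ?h))"
    unfolding pos by (subst em) (auto simp: emeasure_std_normal_greaterThan)
  show "emeasure (std_gaussian d) {x \<in> space (std_gaussian d). offset d p x < 0} = ennreal (std_cdf ?h)"
    unfolding neg by (subst em) (auto simp: emeasure_std_normal_lessThan)
  show "AE x in std_gaussian d. offset d p x \<noteq> 0"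
    using AE_std_gaussian_linear_form_neq[OF w, of "\<Sum>k<d. ?w k * p 0 k"]
    by eventually_elim (simp add: offset_eq_linear_form)
qed

lemma rows_det_neq_0_imp_spanning:
  assumes "0 < d" "rows_det d p \<noteq> 0"
  shows "spanning d p"
proof (rule affinely_independent_imp_spanning[OF assms(1)])
  fix c assume "\<And>k. k < d \<Longrightarrow> (\<Sum>i<d. c i * p i k) = 0"
  with assms(2) show "\<forall>i<d. c i = 0" unfolding rows_det_zero_iff_dependent by blast
qed

lemma hyp_dist_ones_eq_signed_dist:
  assumes "0 < d" "rows_det d p \<noteq> 0"
  shows "hyp_dist d p (\<lambda>_. 1) = \<bar>signed_dist d p\<bar>"
proof -
  let ?w = "hyp_normal d p"
  have "hyp_dist d p (\<lambda>_. 1) = \<bar>\<Sum>k<d. ?w k * p 0 k\<bar> / sqrt (\<Sum>k<d. (?w k)\<^sup>2)"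
  proof (rule hyp_dist_eq[OF assms(2)])
    show "\<exists>k<d. ?w k \<noteq> 0" using rows_det_neq_0_imp_spanning[OF assms] by (simp add: spanning_def)
    show "(\<Sum>k<d. p i k * ?w k) = (\<Sum>k<d. ?w k * p 0 k) * 1" if "i < d" for i
      using offset_vertex[OF that, of p] by (simp add: offset_eq_linear_form mult.commute)
  qed
  then show ?thesis by (simp add: signed_dist_def sum_nonneg)
qed

lemma hyp_normal_cong:
  assumes "0 < d" "\<And>i k. i < d \<Longrightarrow> k < d \<Longrightarrow> p i k = p' i k"
  shows "hyp_normal d p k = hyp_normal d p' k"
  unfolding hyp_normal_eq_rows_det by (rule rows_det_cong) (use assms in auto)

lemma offset_cong:
  assumes "0 < d" "\<And>i k. i < d \<Longrightarrow> k < d \<Longrightarrow> p i k = p' i k" "\<And>k. k < d \<Longrightarrow> x k = x' k"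
  shows "offset d p x = offset d p' x'"
  using hyp_normal_cong[of d p p'] assms by (simp add: offset_def)

lemma nth_sorted_list_in:
  assumes "finite I" "i < card I"
  shows "sorted_list_of_set I ! i \<in> I"
  using bij_betwE[OF bij_betw_nth_sorted_list[OF assms(1)]] assms(2) by auto

lemma borel_measurable_hyp_normal_vertices:
  assumes "finite I" "I \<subseteq> K" "card I = d"
  shows "(\<lambda>p. hyp_normal d (vertices p I) k) \<in> borel_measurable (gaussian_array K d)"
proof -
  let ?G = "gaussian_array K d"
  have "(\<lambda>p. vertices p I i l) \<in> borel_measurable ?G" if [simp]: "i < d" "l < d" for i l
  proof -
    have [simp]: "sorted_list_of_set I ! i \<in> K" using nth_sorted_list_in[of I i] assms by auto
    show ?thesis unfolding vertices_def by measurable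
  qed
  note this [measurable]
  show ?thesis
  proof (cases "d = 0")
    case False
    show ?thesis
      unfolding hyp_normal_def
      by (rule borel_measurable_rows_cof) (use False in \<open>simp; measurable\<close>)
  next
    case True
    then show ?thesis by (simp add: hyp_normal_def rows_cof_def rows_det_def)
  qed
qed

lemma borel_measurable_offset_vertices:
  assumes "finite I" "I \<subseteq> K" "card I = d" "j \<in> K"
  shows "(\<lambda>p. offset d (vertices p I) (p j)) \<in> borel_measurable (gaussian_array K d)"
proof (cases "d = 0")
  case False
  have [simp]: "sorted_list_of_set I ! 0 \<in> K" using nth_sorted_list_in[of I 0] assms False by auto
  note [measurable] = borel_measurable_hyp_normal_vertices[OF assms(1-3)]
  note [simp] = assms(4)
  show ?thesis
    unfolding offset_def vertices_def[of _ _ 0] by measurable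
qed (simp add: offset_def)

lemma nn_integral_gaussian_array_reindex:
  assumes inj: "inj_on f A" "f \<in> A \<rightarrow> K" and G [measurable]: "G \<in> borel_measurable (gaussian_array A d)"
  shows "(\<integral>\<^sup>+p. G (\<lambda>i\<in>A. p (f i)) \<partial>gaussian_array K d) = (\<integral>\<^sup>+p. G p \<partial>gaussian_array A d)"
proof -
  have *: "distr (gaussian_array K d) (gaussian_array A d) (\<lambda>p. \<lambda>i\<in>A. p (f i)) = gaussian_array A d"
    unfolding gaussian_array_def by (rule distr_PiM_reindex) (use inj prob_space_std_gaussian in auto)
  have "(\<lambda>p. \<lambda>i\<in>A. p (f i)) \<in> measurable (gaussian_array K d) (gaussian_array A d)"
    unfolding gaussian_array_def using inj by (intro measurable_restrict measurable_component_singleton) auto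
  then have "(\<integral>\<^sup>+p. G p \<partial>distr (gaussian_array K d) (gaussian_array A d) (\<lambda>p. \<lambda>i\<in>A. p (f i)))
     = (\<integral>\<^sup>+p. G (\<lambda>i\<in>A. p (f i)) \<partial>gaussian_array K d)"
    by (rule nn_integral_distr) measurable
  then show ?thesis unfolding * by simp
qed

lemma AE_rows_det_vertices:
  assumes "finite K" "I \<subseteq> K" "card I = d"
  shows "AE p in gaussian_array K d. rows_det d (vertices p I) \<noteq> 0"
proof -
  let ?G = "gaussian_array K d"
  have I: "finite I" using assms finite_subset by blast
  let ?e = "\<lambda>i. sorted_list_of_set I ! i"
  have e: "inj_on ?e {..<d}" "?e \<in> {..<d} \<rightarrow> K"
    using bij_betw_imp_inj_on[OF bij_betw_nth_sorted_list[OF I]] nth_sorted_list_in[OF I] assms by auto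
  have [measurable]: "(\<lambda>p. rows_det d p) \<in> borel_measurable (gaussian_array {..<d} d)"
    by (rule borel_measurable_rows_det) measurable
  have meas: "(\<lambda>p. rows_det d (vertices p I)) \<in> borel_measurable ?G"
  proof (rule borel_measurable_rows_det)
    fix i k assume [simp]: "i < d" "k < d"
    have [simp]: "?e i \<in> K" using e by auto
    show "(\<lambda>p. vertices p I i k) \<in> borel_measurable ?G"
      unfolding vertices_def by measurable
  qed
  let ?f = "\<lambda>p. if rows_det d p \<noteq> 0 then 0 else 1 :: ennreal"
  have "(\<integral>\<^sup>+p. ?f (vertices p I) \<partial>?G) = (\<integral>\<^sup>+p. ?f (\<lambda>i\<in>{..<d}. p (?e i)) \<partial>?G)"
    using rows_det_cong[of d "vertices p I" "\<lambda>i\<in>{..<d}. p (?e i)" for p]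
    by (intro nn_integral_cong) (simp add: vertices_def)
  also have "\<dots> = (\<integral>\<^sup>+p. ?f p \<partial>gaussian_array {..<d} d)"
    by (rule nn_integral_gaussian_array_reindex[OF e, where G = ?f]) measurable
  also have "\<dots> = (\<integral>\<^sup>+p. 0 \<partial>gaussian_array {..<d} d)"
    by (rule nn_integral_cong_AE) (use AE_rows_det_neq_0 in \<open>auto elim!: eventually_mono\<close>)
  finally have "(\<integral>\<^sup>+p. ?f (vertices p I) \<partial>?G) = 0" by simp
  moreover have "(\<lambda>p. ?f (vertices p I)) \<in> borel_measurable ?G"
    using meas by measurable
  ultimately have "AE p in ?G. ?f (vertices p I) = 0"
    by (subst (asm) nn_integral_0_iff_AE)
  then show ?thesis by eventually_elim (simp split: if_splits)
qed

lemma AE_offset_vertices: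
  assumes "finite K" "I \<subseteq> K" "card I = d" "0 < d" "j \<in> K - I"
  shows "AE p in gaussian_array K d. offset d (vertices p I) (p j) \<noteq> 0"
proof (rule AE_gaussian_array_resample)
  have I: "finite I" using assms finite_subset by blast
  have upd: "offset d (vertices (p(j := x)) I) y = offset d (vertices p I) y" for p x y
    using nth_sorted_list_in[OF I] assms by (intro offset_cong) (auto simp: vertices_def)
  show "AE p in gaussian_array K d. AE x in std_gaussian d. offset d (vertices (p(j := x)) I) ((p(j := x)) j) \<noteq> 0"
    using AE_rows_det_vertices[OF assms(1-3)]
  proof eventually_elim
    case (elim p)
    from AE_offset_neq_0[OF rows_det_neq_0_imp_spanning[OF assms(4) this]]
    show ?case unfolding upd by simp
  qed
  have [measurable]: "(\<lambda>p. offset d (vertices p I) (p j)) \<in> borel_measurable (gaussian_array K d)"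
    using assms I by (intro borel_measurable_offset_vertices) auto
  show "Measurable.pred (gaussian_array K d) (\<lambda>p. offset d (vertices p I) (p j) \<noteq> 0)" by measurable
qed (use assms in auto)

text \<open>
  The probability that \<open>m\<close> further independent points lie on one side of a hyperplane at signed
  distance \<open>h\<close> from the origin.
\<close>

definition side_prob :: "nat \<Rightarrow> real \<Rightarrow> real" where
  "side_prob m h = std_cdf (- h) ^ m + std_cdf h ^ m"

lemma borel_measurable_side_prob [measurable]: "side_prob m \<in> borel_measurable borel"
  unfolding side_prob_def[abs_def] by measurable

lemma side_prob_nonneg: "0 \<le> side_prob m h"
  by (simp add: side_prob_def std_cdf_nonneg)

lemma side_prob_abs: "side_prob m \<bar>h\<bar> = side_prob m h"
  by (cases "0 \<le> h") (auto simp: side_prob_def)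

abbreviation all_above :: "nat \<Rightarrow> nat set \<Rightarrow> nat set \<Rightarrow> (nat \<Rightarrow> nat \<Rightarrow> real) \<Rightarrow> bool" where
  "all_above d K I p \<equiv> \<forall>j\<in>K - I. 0 < offset d (vertices p I) (p j)"

abbreviation all_below :: "nat \<Rightarrow> nat set \<Rightarrow> nat set \<Rightarrow> (nat \<Rightarrow> nat \<Rightarrow> real) \<Rightarrow> bool" where
  "all_below d K I p \<equiv> \<forall>j\<in>K - I. offset d (vertices p I) (p j) < 0"

text \<open>
  Condition on the points with index in \<open>I\<close>. The other points are independent of them, so the
  conditional probability is a function of the distance of the hyperplane, whose law is known.
\<close>

lemma nn_integral_one_sided:
  assumes K: "finite K" "I \<subseteq> K" "card I = d" and d: "0 < d"
  shows "(\<integral>\<^sup>+p. of_bool (all_above d K I p) + of_bool (all_below d K I p) \<partial>gaussian_array K d)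
    = (\<integral>\<^sup>+t. ennreal (side_prob (card (K - I)) (t / sqrt d)) \<partial>std_normal)"
proof -
  define J where "J = K - I"
  have IJ: "I \<inter> J = {}" "finite I" "finite J" "K = I \<union> J"
    using K finite_subset[of I K] by (auto simp: J_def)
  let ?m = "card J"
  let ?N = "std_gaussian d"
  let ?GK = "gaussian_array K d"
  let ?GI = "gaussian_array I d"
  let ?GJ = "gaussian_array J d"
  interpret product_prob_space "\<lambda>_::nat. ?N" I
    by (rule product_prob_spaceI) (rule prob_space_std_gaussian)
  have [measurable]: "(\<lambda>p. offset d (vertices p I) (p j)) \<in> borel_measurable ?GK" if "j \<in> J" for j
    using K(2,3) IJ(2) that unfolding J_def by (intro borel_measurable_offset_vertices) simp_all
  let ?f = "\<lambda>p. of_bool (\<forall>j\<in>J. 0 < offset d (vertices p I) (p j)) + of_bool (\<forall>j\<in>J. offset d (vertices p I) (p j) < 0) :: ennreal"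
  have f: "?f \<in> borel_measurable ?GK"
    using IJ(3) by measurable
  have prodJ: "(\<integral>\<^sup>+y. of_bool (\<forall>j\<in>J. y j \<in> A) \<partial>?GJ) = emeasure ?N A ^ ?m"
    if A: "A \<in> sets ?N" for A
  proof -
    have "(\<integral>\<^sup>+y. of_bool (\<forall>j\<in>J. y j \<in> A) \<partial>?GJ) = (\<integral>\<^sup>+y. indicator (Pi\<^sub>E J (\<lambda>_. A)) y \<partial>?GJ)"
      by (rule nn_integral_cong) (auto simp: gaussian_array_def space_PiM PiE_iff indicator_def)
    also have "\<dots> = emeasure ?GJ (Pi\<^sub>E J (\<lambda>_. A))"
      by (rule nn_integral_indicator) (use A IJ in \<open>auto simp: gaussian_array_def intro!: sets_PiM_I_finite\<close>)
    also have "\<dots> = emeasure ?N A ^ ?m"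
      unfolding gaussian_array_def using A IJ by (subst emeasure_PiM) auto
    finally show ?thesis .
  qed
  let ?e = "\<lambda>i. sorted_list_of_set I ! i"
  have e: "inj_on ?e {..<d}" "?e \<in> {..<d} \<rightarrow> I"
    using bij_betw_imp_inj_on[OF bij_betw_nth_sorted_list[OF IJ(2)]] nth_sorted_list_in[OF IJ(2)] K by auto
  have "(\<integral>\<^sup>+p. ?f p \<partial>?GK) = (\<integral>\<^sup>+x. \<integral>\<^sup>+y. ?f (merge I J (x, y)) \<partial>?GJ \<partial>?GI)"
    using f unfolding gaussian_array_def IJ(4) by (intro product_nn_integral_fold IJ(1-3))
  also have "\<dots> = (\<integral>\<^sup>+x. ennreal (side_prob ?m (signed_dist d (vertices x I))) \<partial>?GI)"
  proof (rule nn_integral_cong_AE, use AE_rows_det_vertices[OF IJ(2) subset_refl K(3)] in eventually_elim)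
    fix x assume D: "rows_det d (vertices x I) \<noteq> 0"
    let ?q = "vertices x I"
    have sp: "spanning d ?q" by (rule rows_det_neq_0_imp_spanning[OF d D])
    have mrg: "offset d (vertices (merge I J (x, y)) I) (merge I J (x, y) j) = offset d ?q (y j)" if "j \<in> J" for j y
      using that IJ(1) nth_sorted_list_in[OF IJ(2)] K(3) by (intro offset_cong d) (auto simp: vertices_def merge_def)
    define A B where "A = {z \<in> space ?N. 0 < offset d ?q z}" and "B = {z \<in> space ?N. offset d ?q z < 0}"
    have AB: "A \<in> sets ?N" "B \<in> sets ?N" unfolding A_def B_def by measurable
    have "(\<integral>\<^sup>+y. ?f (merge I J (x, y)) \<partial>?GJ)
        = (\<integral>\<^sup>+y. of_bool (\<forall>j\<in>J. y j \<in> A) + of_bool (\<forall>j\<in>J. y j \<in> B) \<partial>?GJ)"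
    proof (rule nn_integral_cong)
      fix y assume "y \<in> space ?GJ"
      then have "y j \<in> space ?N" if "j \<in> J" for j
        using that by (auto simp: gaussian_array_def space_PiM)
      then show "?f (merge I J (x, y)) = of_bool (\<forall>j\<in>J. y j \<in> A) + of_bool (\<forall>j\<in>J. y j \<in> B)"
        by (simp add: mrg A_def B_def cong: ball_cong)
    qed
    also have "\<dots> = (\<integral>\<^sup>+y. of_bool (\<forall>j\<in>J. y j \<in> A) \<partial>?GJ) + (\<integral>\<^sup>+y. of_bool (\<forall>j\<in>J. y j \<in> B) \<partial>?GJ)"
    proof (rule nn_integral_add)
      have [measurable]: "(\<lambda>y. y j) \<in> measurable ?GJ ?N" if "j \<in> J" for j
        unfolding gaussian_array_def using that by measurable
      note [measurable] = AB
      show "(\<lambda>y. of_bool (\<forall>j\<in>J. y j \<in> A) :: ennreal) \<in> borel_measurable ?GJ"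
        using IJ(3) by measurable
      show "(\<lambda>y. of_bool (\<forall>j\<in>J. y j \<in> B) :: ennreal) \<in> borel_measurable ?GJ"
        using IJ(3) by measurable
    qed
    also have "\<dots> = ennreal (side_prob ?m (signed_dist d ?q))"
      unfolding prodJ[OF AB(1)] prodJ[OF AB(2)]
      unfolding A_def B_def emeasure_offset_pos[OF sp] emeasure_offset_neg[OF sp]
      by (simp add: side_prob_def ennreal_power std_cdf_nonneg flip: ennreal_plus)
    finally show "(\<integral>\<^sup>+y. ?f (merge I J (x, y)) \<partial>?GJ) = ennreal (side_prob ?m (signed_dist d ?q))" .
  qed
  also have "\<dots> = (\<integral>\<^sup>+x. ennreal (side_prob ?m (hyp_dist d (vertices x I) (\<lambda>_. 1))) \<partial>?GI)"
    by (rule nn_integral_cong_AE, use AE_rows_det_vertices[OF IJ(2) subset_refl K(3)] in eventually_elim)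
      (simp add: hyp_dist_ones_eq_signed_dist[OF d] side_prob_abs)
  also have "\<dots> = (\<integral>\<^sup>+x. ennreal (side_prob ?m (hyp_dist d (\<lambda>i\<in>{..<d}. x (?e i)) (\<lambda>_. 1))) \<partial>?GI)"
  proof -
    have "hyp_dist d (vertices x I) a = hyp_dist d (\<lambda>i\<in>{..<d}. x (?e i)) a" for x a
    proof -
      have "rows_det d (vertices x I) = rows_det d (\<lambda>i\<in>{..<d}. x (?e i))"
        by (rule rows_det_cong) (simp add: vertices_def)
      moreover have "rows_cof d (vertices x I) i k = rows_cof d (\<lambda>i\<in>{..<d}. x (?e i)) i k" for i k
        unfolding rows_cof_def by (rule rows_det_cong) (simp add: vertices_def)
      ultimately show ?thesis by (simp add: hyp_dist_def solution_dir_def)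
    qed
    then show ?thesis by simp
  qed
  also have "\<dots> = (\<integral>\<^sup>+x. ennreal (side_prob ?m (hyp_dist d x (\<lambda>_. 1))) \<partial>gaussian_array {..<d} d)"
    by (rule nn_integral_gaussian_array_reindex[OF e, where G = "\<lambda>p. ennreal (side_prob ?m (hyp_dist d p (\<lambda>_. 1)))"]) measurable
  also have "\<dots> = (\<integral>\<^sup>+t. ennreal (side_prob ?m (\<bar>t\<bar> / sqrt d)) \<partial>std_normal)"
    by (rule nn_integral_hyp_dist_ones[OF _ d, where F = "\<lambda>h. ennreal (side_prob ?m h)"]) measurable
  also have "\<dots> = (\<integral>\<^sup>+t. ennreal (side_prob ?m (t / sqrt d)) \<partial>std_normal)"
  proof -
    have "side_prob ?m (\<bar>t\<bar> / sqrt d) = side_prob ?m (t / sqrt d)" for t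
      using side_prob_abs[of ?m "t / sqrt d"] by (simp add: abs_divide)
    then show ?thesis by simp
  qed
  finally show ?thesis by (simp add: J_def)
qed

section \<open>The expected number of facets as an integral\<close>

definition facet_count :: "nat \<Rightarrow> nat \<Rightarrow> (nat \<Rightarrow> nat \<Rightarrow> real) \<Rightarrow> nat" where
  "facet_count d n p = card (on_facet d n p ` {I. spans_facet d n p I})"

lemma borel_measurable_facet_count:
  "(\<lambda>p. real (facet_count d n p)) \<in> borel_measurable (gaussian_array {..<n} d)"
proof -
  let ?G = "gaussian_array {..<n} d"
  let ?o = "\<lambda>p I. offset d (vertices p I)"
  let ?S = "{I. I \<subseteq> {..<n} \<and> card I = d}"
  have S: "finite ?S" by (rule finite_subset[of _ "Pow {..<n}"]) auto
  have spans: "spans_facet d n p I \<longleftrightarrow> I \<in> ?S \<and> (\<exists>k<d. hyp_normal d (vertices p I) k \<noteq> 0) \<and>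
     ((\<forall>j<n. 0 \<le> ?o p I (p j)) \<or> (\<forall>j<n. ?o p I (p j) \<le> 0))" for p I
    by (simp add: spans_facet_def spanning_def)
  have pred: "Measurable.pred ?G (\<lambda>p. spans_facet d n p I \<and> on_facet d n p I = Z)"
    if I: "I \<in> ?S" and Z: "Z \<subseteq> {..<n}" for I Z
  proof -
    have fin: "finite I" using I finite_subset by auto
    have [measurable]: "(\<lambda>p. hyp_normal d (vertices p I) k) \<in> borel_measurable ?G" for k
      using I fin by (intro borel_measurable_hyp_normal_vertices) auto
    have [measurable]: "(\<lambda>p. ?o p I (p j)) \<in> borel_measurable ?G" if "j < n" for j
      using I fin that by (intro borel_measurable_offset_vertices) auto
    have "on_facet d n p I = Z \<longleftrightarrow> (\<forall>j\<in>{..<n}. ?o p I (p j) = 0 \<longleftrightarrow> j \<in> Z)" for p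
      using Z by (auto simp: on_facet_def)
    moreover have "spans_facet d n p I \<longleftrightarrow> (\<exists>k\<in>{..<d}. hyp_normal d (vertices p I) k \<noteq> 0) \<and>
     ((\<forall>j\<in>{..<n}. 0 \<le> ?o p I (p j)) \<or> (\<forall>j\<in>{..<n}. ?o p I (p j) \<le> 0))" for p
      using I unfolding spans by auto
    ultimately show ?thesis by simp
  qed
  have "facet_count d n p = (\<Sum>Z\<in>Pow {..<n}. of_bool (\<exists>I\<in>?S. spans_facet d n p I \<and> on_facet d n p I = Z))" for p
  proof -
    have "on_facet d n p ` {I. spans_facet d n p I} = Pow {..<n} \<inter> {Z. \<exists>I\<in>?S. spans_facet d n p I \<and> on_facet d n p I = Z}"
      by (auto simp: spans on_facet_def)
    then show ?thesis by (simp add: facet_count_def sum_of_bool_eq)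
  qed
  then have "real (facet_count d n p) = (\<Sum>Z\<in>Pow {..<n}. of_bool (\<exists>I\<in>?S. spans_facet d n p I \<and> on_facet d n p I = Z))" for p
    by simp
  moreover have "(\<lambda>p. \<Sum>Z\<in>Pow {..<n}. of_bool (\<exists>I\<in>?S. spans_facet d n p I \<and> on_facet d n p I = Z) :: real) \<in> borel_measurable ?G"
  proof (rule borel_measurable_sum)
    fix Z assume "Z \<in> Pow {..<n}"
    then have "Measurable.pred ?G (\<lambda>p. \<exists>I\<in>?S. spans_facet d n p I \<and> on_facet d n p I = Z)"
      using S pred by (intro pred_intros_finite) auto
    then show "(\<lambda>p. of_bool (\<exists>I\<in>?S. spans_facet d n p I \<and> on_facet d n p I = Z) :: real) \<in> borel_measurable ?G"
      by measurable
  qed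
  ultimately show ?thesis by simp
qed

text \<open>
  In general position every supporting hyperplane contains exactly the \<open>d\<close> points that span it. Since
  \<open>d < n\<close>, there is another point, so the two sides are mutually exclusive.
\<close>

lemma facet_count_general_position:
  assumes d: "0 < d" and n: "d < n"
    and sp: "\<And>I. I \<subseteq> {..<n} \<Longrightarrow> card I = d \<Longrightarrow> spanning d (vertices p I)"
    and off: "\<And>I j. I \<subseteq> {..<n} \<Longrightarrow> card I = d \<Longrightarrow> j \<in> {..<n} - I \<Longrightarrow> offset d (vertices p I) (p j) \<noteq> 0"
  shows "facet_count d n p = (\<Sum>I | I \<subseteq> {..<n} \<and> card I = d.
      of_bool (all_above d {..<n} I p) + of_bool (all_below d {..<n} I p))"
proof -
  let ?o = "\<lambda>I. offset d (vertices p I)"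
  let ?S = "{I. I \<subseteq> {..<n} \<and> card I = d}"
  have S: "finite ?S" by (rule finite_subset[of _ "Pow {..<n}"]) auto
  let ?A = "\<lambda>I. all_above d {..<n} I p"
  let ?B = "\<lambda>I. all_below d {..<n} I p"
  have zero: "?o I (p j) = 0" if "I \<in> ?S" "j \<in> I" for I j
  proof -
    have I: "finite I" "card I = d" using that finite_subset[of I "{..<n}"] by auto
    have "j \<in> (\<lambda>i. sorted_list_of_set I ! i) ` {..<d}"
      using bij_betw_imp_surj_on[OF bij_betw_nth_sorted_list[OF I(1)]] that(2) I(2) by simp
    then obtain i where "i < d" "j = sorted_list_of_set I ! i" by auto
    then show ?thesis using offset_vertex[of i d "vertices p I"] by (simp add: vertices_def)
  qed
  have on: "on_facet d n p I = I" if "I \<in> ?S" for I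
    using that zero[OF that] off[of I] by (auto simp: on_facet_def)
  have spans: "spans_facet d n p I \<longleftrightarrow> I \<in> ?S \<and> (?A I \<or> ?B I)" for I
  proof (cases "I \<in> ?S")
    case True
    then have I: "I \<subseteq> {..<n}" "card I = d" by auto
    have "(\<forall>j<n. 0 \<le> ?o I (p j)) \<longleftrightarrow> ?A I"
      using zero[OF True] off[OF I] by (metis DiffE DiffI lessThan_iff less_le order_refl)
    moreover have "(\<forall>j<n. ?o I (p j) \<le> 0) \<longleftrightarrow> ?B I"
      using zero[OF True] off[OF I] by (metis DiffE DiffI lessThan_iff less_le order_refl)
    ultimately show ?thesis using True sp[OF I] by (simp add: spans_facet_def)
  qed (auto simp: spans_facet_def)
  have "facet_count d n p = card {I. spans_facet d n p I}"
    unfolding facet_count_def using on by (intro card_image inj_onI) (simp add: spans)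
  also have "{I. spans_facet d n p I} = {I \<in> ?S. ?A I \<or> ?B I}"
    using spans by blast
  also have "card \<dots> = (\<Sum>I\<in>?S. of_bool (?A I \<or> ?B I))"
    using sum.inter_filter[OF S, of "\<lambda>_. 1::nat" "\<lambda>I. ?A I \<or> ?B I"] unfolding of_bool_def by simp
  also have "\<dots> = (\<Sum>I\<in>?S. of_bool (?A I) + of_bool (?B I))"
  proof (rule sum.cong[OF refl])
    fix I assume I: "I \<in> ?S"
    then have "\<not> {..<n} \<subseteq> I" using n card_mono[of I "{..<n}"] finite_subset[of I "{..<n}"] by auto
    then obtain j where "j \<in> {..<n} - I" by blast
    then have "\<not> (?A I \<and> ?B I)" by (meson less_asym)
    then show "(of_bool (?A I \<or> ?B I) :: nat) = of_bool (?A I) + of_bool (?B I)" by auto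
  qed
  finally show ?thesis .
qed

lemma nn_integral_facet_count:
  assumes d: "0 < d" and n: "d < n"
  shows "(\<integral>\<^sup>+p. ennreal (real (facet_count d n p)) \<partial>gaussian_array {..<n} d)
    = of_nat (n choose d) * (\<integral>\<^sup>+t. ennreal (side_prob (n - d) (t / sqrt d)) \<partial>std_normal)"
proof -
  let ?G = "gaussian_array {..<n} d"
  let ?S = "{I. I \<subseteq> {..<n} \<and> card I = d}"
  have S: "finite ?S" by (rule finite_subset[of _ "Pow {..<n}"]) auto
  let ?f = "\<lambda>I p. of_bool (all_above d {..<n} I p) + of_bool (all_below d {..<n} I p) :: ennreal"
  have "AE p in ?G. \<forall>I\<in>?S. rows_det d (vertices p I) \<noteq> 0 \<and> (\<forall>j\<in>{..<n} - I. offset d (vertices p I) (p j) \<noteq> 0)"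
  proof (rule AE_finite_allI[OF S])
    fix I assume I: "I \<in> ?S"
    then have "AE p in ?G. rows_det d (vertices p I) \<noteq> 0"
      by (intro AE_rows_det_vertices) auto
    moreover have "AE p in ?G. \<forall>j\<in>{..<n} - I. offset d (vertices p I) (p j) \<noteq> 0"
      using I d by (intro AE_finite_allI AE_offset_vertices) auto
    ultimately show "AE p in ?G. rows_det d (vertices p I) \<noteq> 0 \<and> (\<forall>j\<in>{..<n} - I. offset d (vertices p I) (p j) \<noteq> 0)"
      by eventually_elim blast
  qed
  then have "AE p in ?G. ennreal (real (facet_count d n p)) = (\<Sum>I\<in>?S. ?f I p)"
  proof eventually_elim
    case (elim p)
    have eq: "facet_count d n p = (\<Sum>I\<in>?S. of_bool (all_above d {..<n} I p) + of_bool (all_below d {..<n} I p))"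
      by (rule facet_count_general_position[OF d n]) (use elim rows_det_neq_0_imp_spanning[OF d] in auto)
    have "ennreal (real (facet_count d n p)) = of_nat (facet_count d n p)"
      by (rule ennreal_of_nat_eq_real_of_nat[symmetric])
    also have "\<dots> = (\<Sum>I\<in>?S. ?f I p)"
      unfolding eq of_nat_sum of_nat_add of_nat_of_bool ..
    finally show ?case .
  qed
  then have "(\<integral>\<^sup>+p. ennreal (real (facet_count d n p)) \<partial>?G) = (\<integral>\<^sup>+p. (\<Sum>I\<in>?S. ?f I p) \<partial>?G)"
    by (rule nn_integral_cong_AE)
  also have "\<dots> = (\<Sum>I\<in>?S. \<integral>\<^sup>+p. ?f I p \<partial>?G)"
  proof (rule nn_integral_sum)
    fix I assume I: "I \<in> ?S"
    have "finite I" using I finite_subset by auto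
    then have [measurable]: "(\<lambda>p. offset d (vertices p I) (p j)) \<in> borel_measurable ?G" if "j \<in> {..<n} - I" for j
      using I that by (intro borel_measurable_offset_vertices) auto
    show "?f I \<in> borel_measurable ?G" by measurable
  qed
  also have "\<dots> = (\<Sum>I\<in>?S. \<integral>\<^sup>+t. ennreal (side_prob (n - d) (t / sqrt d)) \<partial>std_normal)"
  proof (rule sum.cong[OF refl])
    fix I assume I: "I \<in> ?S"
    then have "card ({..<n} - I) = n - d" using finite_subset[of I "{..<n}"] by (simp add: card_Diff_subset)
    then show "(\<integral>\<^sup>+p. ?f I p \<partial>?G) = (\<integral>\<^sup>+t. ennreal (side_prob (n - d) (t / sqrt d)) \<partial>std_normal)"
      using nn_integral_one_sided[of "{..<n}" I d] I d by simp
  qed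
  also have "\<dots> = of_nat (n choose d) * (\<integral>\<^sup>+t. ennreal (side_prob (n - d) (t / sqrt d)) \<partial>std_normal)"
    by (simp add: n_subsets[of "{..<n}" d, simplified])
  finally show ?thesis .
qed

lemma gaussian_polytope_num_faces:
  assumes "0 < d"
  shows "num_faces (d - 1) (gaussian_polytope d n X \<omega>) = facet_count d n (\<lambda>i\<in>{..<n}. X i \<omega>)"
proof -
  have "gaussian_polytope d n X \<omega> = convex hull ((\<lambda>i. point d ((\<lambda>i\<in>{..<n}. X i \<omega>) i)) ` {..<n})"
    unfolding gaussian_polytope_def by (intro arg_cong[where f = "\<lambda>S. convex hull S"] image_cong) auto
  then show ?thesis using num_facets_eq[OF assms] by (simp only: facet_count_def)
qed

text \<open>
  By linearity and exchangeability, the expected number of facets is the number of \<open>d\<close>-subsets times the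
  probability that a given one spans a facet.
\<close>

theorem expectation_num_facets:
  assumes X: "indep_std_gaussians M d n X" and d: "0 < d" and n: "d < n"
  shows "prob_space.expectation M (\<lambda>\<omega>. real (num_faces (d - 1) (gaussian_polytope d n X \<omega>)))
    = (n choose d) * (LINT t|std_normal. side_prob (n - d) (t / sqrt d))"
proof -
  interpret prob_space M using X by (simp add: indep_std_gaussians_def)
  interpret N: prob_space std_normal by (rule prob_space_std_normal)
  let ?B = "PiM {..<d} (\<lambda>_. borel :: real measure)"
  let ?Y = "\<lambda>\<omega>. \<lambda>i\<in>{..<n}. X i \<omega>"
  let ?P = "PiM {..<n} (\<lambda>_. ?B)"
  have law: "distr M ?B (X i) = std_gaussian d" if "i < n" for i
    using X that unfolding indep_std_gaussians_def by blast
  have ind: "indep_vars (\<lambda>_. ?B) X {..<n}" using X by (simp add: indep_std_gaussians_def)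
  have rv: "random_variable ?B (X i)" if "i < n" for i
    using ind that by (auto simp: indep_vars_def)
  have "distr M ?P ?Y = PiM {..<n} (\<lambda>i. distr M ?B (X i))"
    using ind n rv by (subst (asm) indep_vars_iff_distr_eq_PiM') auto
  also have "\<dots> = gaussian_array {..<n} d"
    unfolding gaussian_array_def by (rule PiM_cong) (auto simp: law)
  finally have joint: "distr M ?P ?Y = gaussian_array {..<n} d" .
  have fc: "(\<lambda>p. real (facet_count d n p)) \<in> borel_measurable ?P"
    using borel_measurable_facet_count[of d n] by (simp add: measurable_cong_sets[OF sets_gaussian_array refl])
  have "expectation (\<lambda>\<omega>. real (num_faces (d - 1) (gaussian_polytope d n X \<omega>)))
      = expectation (\<lambda>\<omega>. real (facet_count d n (\<lambda>i\<in>{..<n}. X i \<omega>)))"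
    by (simp only: gaussian_polytope_num_faces[OF d])
  also have "\<dots> = (LINT p|distr M ?P ?Y. real (facet_count d n p))"
    using rv fc by (intro integral_distr[symmetric] measurable_restrict) auto
  also have "\<dots> = enn2real (\<integral>\<^sup>+p. ennreal (real (facet_count d n p)) \<partial>gaussian_array {..<n} d)"
    unfolding joint by (rule integral_eq_nn_integral) (auto intro: borel_measurable_facet_count)
  also have "\<dots> = enn2real (of_nat (n choose d) * (\<integral>\<^sup>+t. ennreal (side_prob (n - d) (t / sqrt d)) \<partial>std_normal))"
    by (simp add: nn_integral_facet_count[OF d n])
  also have "\<dots> = (n choose d) * (LINT t|std_normal. side_prob (n - d) (t / sqrt d))"
    by (simp add: enn2real_mult integral_eq_nn_integral side_prob_nonneg)
  finally show ?thesis .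
qed

section \<open>Normal tails and Beta integrals\<close>

lemma std_normal_density_pos: "0 < std_normal_density x"
  by (simp add: std_normal_density_def)

lemma continuous_on_std_normal_density: "continuous_on A std_normal_density"
  unfolding std_normal_density_def by (intro continuous_intros) auto

lemma std_cdf_eq_integral:
  assumes "a \<le> t"
  shows "std_cdf t = std_cdf a + integral {a..t} std_normal_density"
proof -
  interpret prob_space std_normal by (rule prob_space_std_normal)
  have "{..t} = {..a} \<union> {a<..t}" using assms by auto
  then have "std_cdf t = std_cdf a + measure std_normal {a<..t}"
    unfolding std_cdf_def by (simp only:) (rule finite_measure_Union; auto)
  also have "measure std_normal {a<..t} = measure std_normal {a..t}"
    by (rule measure_eq_AE) (use AE_std_normal_neq[of a] in \<open>auto elim!: eventually_mono\<close>)
  also have "\<dots> = integral {a..t} std_normal_density"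
  proof -
    have int: "set_integrable lborel {a..t} std_normal_density"
      by (rule borel_integrable_atLeastAtMost') (rule continuous_on_std_normal_density)
    have "emeasure std_normal {a..t} = (\<integral>\<^sup>+x. ennreal (indicator {a..t} x * std_normal_density x) \<partial>lborel)"
      by (simp add: emeasure_density) (intro nn_integral_cong, auto simp: indicator_def)
    also have "\<dots> = ennreal (LINT x|lborel. indicator {a..t} x * std_normal_density x)"
      using int by (intro nn_integral_eq_integral) (auto simp: set_integrable_def)
    finally have "measure std_normal {a..t} = (LINT x:{a..t}|lborel. std_normal_density x)"
      by (simp add: measure_def set_lebesgue_integral_def integral_nonneg_AE)
    then show ?thesis using set_borel_integral_eq_integral(2)[OF int] by simp
  qed
  finally show ?thesis .
qed

lemma std_cdf_has_derivative [derivative_intros]: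
  "(std_cdf has_real_derivative std_normal_density x) (at x)"
proof -
  have "((\<lambda>t. integral {x - 1..t} std_normal_density) has_real_derivative std_normal_density x) (at x within {x - 1..x + 1})"
    by (rule integral_has_real_derivative) (auto intro: continuous_on_std_normal_density)
  then have "((\<lambda>t. std_cdf (x - 1) + integral {x - 1..t} std_normal_density) has_real_derivative std_normal_density x) (at x within {x - 1..x + 1})"
    by (auto intro!: derivative_eq_intros)
  then have "(std_cdf has_real_derivative std_normal_density x) (at x within {x - 1..x + 1})"
    by (rule has_field_derivative_transform_within[where d = 1]) (auto intro: std_cdf_eq_integral[symmetric])
  then show ?thesis by (simp add: at_within_Icc_at)
qed

lemma std_normal_density_has_derivative [derivative_intros]:
  "(std_normal_density has_real_derivative - x * std_normal_density x) (at x)"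
  unfolding std_normal_density_def[abs_def]
  by (auto intro!: derivative_eq_intros simp: field_simps)

lemma std_normal_density_minus: "std_normal_density (- x) = std_normal_density x"
  by (simp add: std_normal_density_def)

lemma std_tail_has_derivative [derivative_intros]:
  "((\<lambda>x. std_cdf (- x)) has_real_derivative - std_normal_density x) (at x)"
  using std_cdf_has_derivative[of "- x"] by (simp add: DERIV_mirror std_normal_density_minus)

lemma std_cdf_strict_mono: "x < y \<Longrightarrow> std_cdf x < std_cdf y"
  by (rule DERIV_pos_imp_increasing) (use std_cdf_has_derivative std_normal_density_pos in blast)+

lemma std_cdf_mono: "x \<le> y \<Longrightarrow> std_cdf x \<le> std_cdf y"
  using std_cdf_strict_mono[of x y] by (cases "x = y") auto

lemma std_cdf_pos: "0 < std_cdf x"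
  using std_cdf_strict_mono[of "x - 1" x] std_cdf_nonneg[of "x - 1"] by simp

lemma std_cdf_at_bot: "(std_cdf \<longlongrightarrow> 0) at_bot"
proof -
  interpret real_distribution std_normal by (rule real_dist_normal_dist)
  have "std_cdf = cdf std_normal" by (auto simp: std_cdf_def cdf_def)
  then show ?thesis using cdf_lim_at_bot by simp
qed

lemma std_tail_at_top: "((\<lambda>x. std_cdf (- x)) \<longlongrightarrow> 0) at_top"
  by (rule filterlim_compose[OF std_cdf_at_bot filterlim_uminus_at_bot_at_top])

lemma nonneg_of_decreasing_to_0:
  fixes g g' :: "real \<Rightarrow> real"
  assumes der: "\<And>x. a \<le> x \<Longrightarrow> (g has_real_derivative g' x) (at x)" "\<And>x. a \<le> x \<Longrightarrow> g' x \<le> 0"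
    and lim: "(g \<longlongrightarrow> 0) at_top"
  shows "0 \<le> g a"
proof (rule tendsto_upperbound[OF lim])
  show "\<forall>\<^sub>F x in at_top. g x \<le> g a"
    using eventually_ge_at_top[of a]
  proof eventually_elim
    case (elim x)
    show ?case by (rule DERIV_nonpos_imp_nonincreasing[OF elim]) (use der in blast)
  qed
qed simp

text \<open>
  Both Mills bounds hold because the difference of the two sides, suitably divided, has a derivative of
  constant sign and tends to \<open>0\<close> at infinity.
\<close>

lemma mills_upper:
  assumes "0 < h"
  shows "h * std_cdf (- h) \<le> std_normal_density h"
proof -
  let ?\<phi> = "std_normal_density"
  have "0 \<le> ?\<phi> h / h - std_cdf (- h)"
  proof (rule nonneg_of_decreasing_to_0[where g = "\<lambda>x. ?\<phi> x / x - std_cdf (- x)" and g' = "\<lambda>x. - ?\<phi> x / x\<^sup>2"])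
    fix x assume "h \<le> x"
    with assms have "x \<noteq> 0" by simp
    then show "((\<lambda>x. ?\<phi> x / x - std_cdf (- x)) has_real_derivative - ?\<phi> x / x\<^sup>2) (at x)"
      by (auto intro!: derivative_eq_intros simp: field_simps power2_eq_square)
    show "- ?\<phi> x / x\<^sup>2 \<le> 0" using std_normal_density_pos[of x] by simp
  next
    have "((\<lambda>x. ?\<phi> x / x) \<longlongrightarrow> 0) at_top"
      unfolding std_normal_density_def[abs_def] by real_asymp
    from tendsto_diff[OF this std_tail_at_top]
    show "((\<lambda>x. ?\<phi> x / x - std_cdf (- x)) \<longlongrightarrow> 0) at_top" by simp
  qed
  then show ?thesis using assms by (simp add: field_simps)
qed

lemma mills_lower:
  assumes "0 < h"
  shows "h * std_normal_density h \<le> (1 + h\<^sup>2) * std_cdf (- h)"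
proof -
  let ?\<phi> = "std_normal_density"
  have "0 \<le> std_cdf (- h) - ?\<phi> h * h / (1 + h\<^sup>2)"
  proof (rule nonneg_of_decreasing_to_0[where g = "\<lambda>x. std_cdf (- x) - ?\<phi> x * x / (1 + x\<^sup>2)" and g' = "\<lambda>x. - 2 * ?\<phi> x / (1 + x\<^sup>2)\<^sup>2"])
    fix x :: real
    have nz: "1 + x\<^sup>2 \<noteq> 0" by (metis add_pos_nonneg less_numeral_extra(1) less_irrefl zero_le_power2)
    have "((\<lambda>x. std_cdf (- x) - ?\<phi> x * x / (1 + x\<^sup>2)) has_real_derivative
        - ?\<phi> x - ((- x * ?\<phi> x * x + ?\<phi> x) * (1 + x\<^sup>2) - ?\<phi> x * x * (2 * x)) / ((1 + x\<^sup>2) * (1 + x\<^sup>2))) (at x)"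
      using nz by (auto intro!: derivative_eq_intros)
    also have "- ?\<phi> x - ((- x * ?\<phi> x * x + ?\<phi> x) * (1 + x\<^sup>2) - ?\<phi> x * x * (2 * x)) / ((1 + x\<^sup>2) * (1 + x\<^sup>2))
       = - 2 * ?\<phi> x / (1 + x\<^sup>2)\<^sup>2"
      using nz by (simp add: divide_simps) (simp add: power2_eq_square algebra_simps)
    finally show "((\<lambda>x. std_cdf (- x) - ?\<phi> x * x / (1 + x\<^sup>2)) has_real_derivative - 2 * ?\<phi> x / (1 + x\<^sup>2)\<^sup>2) (at x)" .
    show "- 2 * ?\<phi> x / (1 + x\<^sup>2)\<^sup>2 \<le> 0" using std_normal_density_pos[of x] by simp
  next
    have "((\<lambda>x. ?\<phi> x * x / (1 + x\<^sup>2)) \<longlongrightarrow> 0) at_top"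
      unfolding std_normal_density_def[abs_def] by real_asymp
    from tendsto_diff[OF std_tail_at_top this]
    show "((\<lambda>x. std_cdf (- x) - ?\<phi> x * x / (1 + x\<^sup>2)) \<longlongrightarrow> 0) at_top" by simp
  qed
  moreover have "0 < 1 + h\<^sup>2" by (simp add: add_pos_nonneg)
  ultimately show ?thesis by (simp add: pos_le_divide_eq pos_divide_le_eq mult.commute)
qed

lemma std_normal_density_le: "std_normal_density h \<le> exp (- h\<^sup>2 / 2)"
proof -
  have "1 \<le> 2 * pi" using pi_gt3 by simp
  then have "1 / sqrt (2 * pi) \<le> 1" by simp
  then have "1 / sqrt (2 * pi) * exp (- h\<^sup>2 / 2) \<le> 1 * exp (- h\<^sup>2 / 2)"
    by (rule mult_right_mono) simp
  then show ?thesis by (simp add: std_normal_density_def)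
qed

text \<open>
  Let \<open>s\<close> be the tail and \<open>\<lambda>\<close> the hazard rate, that is the density divided by \<open>s\<close>. For \<open>h \<ge> 1\<close>, the Mills
  bounds give \<open>\<lambda> \<le> h + 1 / h\<close> and \<open>h\<^sup>2 \<le> 2 * ln (1 / s)\<close>; for \<open>h < 1\<close> the hazard rate is bounded. It
  matters that the error in \<open>\<lambda>\<^sup>2\<close> is additive and bounded: a weaker bound such as \<open>\<lambda> \<le> h + 1\<close> would be
  too large after raising it to the power \<open>d - 1\<close>.
\<close>

lemma hazard_rate_bound:
  "(std_normal_density h)\<^sup>2 \<le> (std_cdf (- h))\<^sup>2 * (- 2 * ln (std_cdf (- h)) + 12)"
proof -
  define \<phi> s where "\<phi> = std_normal_density h" and "s = std_cdf (- h)"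
  have \<phi>: "0 < \<phi>" and s: "0 < s" "s \<le> 1"
    by (simp_all add: \<phi>_def s_def std_normal_density_pos std_cdf_pos std_cdf_le_1)
  show ?thesis
  proof (cases "1 \<le> h")
    case True
    have "s \<le> h * s" using True s by simp
    also have "h * s \<le> \<phi>" using mills_upper[of h] True by (simp add: s_def \<phi>_def)
    also have "\<phi> \<le> exp (- h\<^sup>2 / 2)" unfolding \<phi>_def by (rule std_normal_density_le)
    finally have "ln s \<le> - h\<^sup>2 / 2" using s by (metis exp_gt_zero ln_exp ln_le_cancel_iff)
    then have a: "h\<^sup>2 \<le> - 2 * ln s" by simp
    have "h * \<phi> \<le> (1 + h\<^sup>2) * s" using mills_lower[of h] True by (simp add: s_def \<phi>_def)
    then have "(h * \<phi>)\<^sup>2 \<le> ((1 + h\<^sup>2) * s)\<^sup>2" using True \<phi> by (intro power_mono) auto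
    also have "\<dots> \<le> (h\<^sup>2 * (h\<^sup>2 + 3)) * s\<^sup>2"
    proof -
      have "1 \<le> h\<^sup>2" using True by simp
      then have "(1 + h\<^sup>2)\<^sup>2 \<le> h\<^sup>2 * (h\<^sup>2 + 3)" by (simp add: power2_eq_square algebra_simps)
      then show ?thesis by (simp add: power_mult_distrib mult_right_mono)
    qed
    finally have "h\<^sup>2 * \<phi>\<^sup>2 \<le> h\<^sup>2 * (s\<^sup>2 * (h\<^sup>2 + 3))" by (simp add: power_mult_distrib mult_ac)
    then have "\<phi>\<^sup>2 \<le> s\<^sup>2 * (h\<^sup>2 + 3)" using True by (subst (asm) mult_le_cancel_left_pos) auto
    also have "\<dots> \<le> s\<^sup>2 * (- 2 * ln s + 12)" using a by (intro mult_left_mono) auto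
    finally show ?thesis by (simp add: s_def \<phi>_def)
  next
    case False
    have "std_cdf (- 1) \<le> s" unfolding s_def using False by (intro std_cdf_mono) simp
    then have "std_normal_density 1 / 2 \<le> s" using mills_lower[of 1] by simp
    moreover have "\<phi> \<le> std_normal_density 1 * exp (1 / 2)"
      by (simp add: \<phi>_def std_normal_density_def flip: exp_add) (simp add: divide_right_mono)
    moreover from calculation(1) have "std_normal_density 1 * exp (1 / 2) \<le> 2 * s * exp (1 / 2)"
      by (intro mult_right_mono) auto
    ultimately have "\<phi> \<le> 2 * s * exp (1 / 2)" by linarith
    then have "\<phi>\<^sup>2 \<le> (2 * s * exp (1 / 2))\<^sup>2" using \<phi> by (intro power_mono) auto
    also have "\<dots> = s\<^sup>2 * (4 * exp 1)"
      by (simp add: power_mult_distrib flip: exp_double)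
    also have "\<dots> \<le> s\<^sup>2 * (- 2 * ln s + 12)"
    proof (rule mult_left_mono)
      have "ln s \<le> 0" using s by simp
      then show "4 * exp 1 \<le> - 2 * ln s + 12" using exp_le by linarith
    qed simp
    finally show ?thesis by (simp add: s_def \<phi>_def)
  qed
qed

text \<open>
  With \<open>s = std_cdf (- h)\<close>, which is uniformly distributed on the unit interval, this is the Beta integral
  of \<open>s ^ a * (1 - s) ^ b\<close>.
\<close>

definition beta_weight :: "nat \<Rightarrow> nat \<Rightarrow> real" where
  "beta_weight a b = (LINT h|std_normal. std_cdf (- h) ^ a * std_cdf h ^ b)"

lemma integrable_std_normal_bounded:
  fixes f :: "real \<Rightarrow> real"
  assumes "f \<in> borel_measurable borel" "\<And>x. \<bar>f x\<bar> \<le> C"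
  shows "integrable std_normal f"
proof -
  interpret prob_space std_normal by (rule prob_space_std_normal)
  show ?thesis by (rule integrable_const_bound[where B = C]) (use assms in auto)
qed

lemma std_cdf_powers_bound: "\<bar>std_cdf (- h) ^ a * std_cdf h ^ b\<bar> \<le> 1"
  by (simp add: abs_mult std_cdf_nonneg std_cdf_le_1 power_le_one mult_le_one)

lemma integrable_beta_weight: "integrable std_normal (\<lambda>h. std_cdf (- h) ^ a * std_cdf h ^ b)"
  by (rule integrable_std_normal_bounded[OF _ std_cdf_powers_bound]) measurable

lemma lebesgue_integral_std_normal:
  fixes f :: "real \<Rightarrow> real"
  assumes "f \<in> borel_measurable borel"
  shows "(LINT h|std_normal. f h) = (LINT h|lborel. std_normal_density h * f h)"
  using assms by (subst integral_density) auto

text \<open>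
  Integration by parts: integrate the derivative of \<open>std_cdf (- x) ^ a * std_cdf x ^ Suc b\<close> over the line.
\<close>

lemma beta_weight_rec: "real (Suc b) * beta_weight a b = real a * beta_weight (a - 1) (Suc b) + of_bool (a = 0)"
proof -
  let ?F = "\<lambda>x. std_cdf (- x) ^ a * std_cdf x ^ Suc b"
  let ?g = "\<lambda>x. real (Suc b) * (std_cdf (- x) ^ a * std_cdf x ^ b) - real a * (std_cdf (- x) ^ (a - 1) * std_cdf x ^ Suc b)"
  let ?f = "\<lambda>x. std_normal_density x * ?g x"
  have der: "(?F has_real_derivative ?f x) (at x)" for x
  proof -
    have "((\<lambda>x. std_cdf x ^ Suc b) has_real_derivative real (Suc b) * (std_normal_density x * std_cdf x ^ b)) (at x)"
      using DERIV_power[OF std_cdf_has_derivative, where n = "Suc b"] by (simp del: power_Suc of_nat_Suc)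
    moreover have "((\<lambda>x. std_cdf (- x) ^ a) has_real_derivative real a * (- std_normal_density x * std_cdf (- x) ^ (a - 1))) (at x)"
      using DERIV_power[OF std_tail_has_derivative, where n = a] by simp
    ultimately have "(?F has_real_derivative
        real a * (- std_normal_density x * std_cdf (- x) ^ (a - 1)) * std_cdf x ^ Suc b
        + real (Suc b) * (std_normal_density x * std_cdf x ^ b) * std_cdf (- x) ^ a) (at x)"
      by (rule DERIV_mult[rotated])
    then show ?thesis by (rule DERIV_cong) (simp add: algebra_simps del: power_Suc of_nat_Suc)
  qed
  have cont: "isCont std_cdf x" "isCont (\<lambda>x. std_cdf (- x)) x" "isCont std_normal_density x" for x
    using DERIV_isCont std_cdf_has_derivative std_tail_has_derivative std_normal_density_has_derivative by blast+
  have int: "integrable std_normal ?g"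
    by (intro Bochner_Integration.integrable_diff integrable_mult_right integrable_beta_weight)
  then have int': "integrable lborel ?f" by (subst (asm) integrable_density) auto
  have top: "(std_cdf \<longlongrightarrow> 1) at_top"
  proof -
    have "((\<lambda>x. 1 - std_cdf (- x)) \<longlongrightarrow> 1 - 0) at_top" by (intro tendsto_intros std_tail_at_top)
    then show ?thesis by (simp add: std_cdf_minus)
  qed
  have lim_bot: "(?F \<longlongrightarrow> 0) at_bot"
  proof -
    have "((\<lambda>x. std_cdf (- x)) \<longlongrightarrow> 1) at_bot"
      by (rule filterlim_compose[OF top filterlim_uminus_at_top_at_bot])
    then have "(?F \<longlongrightarrow> 1 ^ a * 0 ^ Suc b) at_bot" by (intro tendsto_intros std_cdf_at_bot)
    then show ?thesis by simp
  qed
  have lim_top: "(?F \<longlongrightarrow> of_bool (a = 0)) at_top"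
  proof -
    have "(?F \<longlongrightarrow> 0 ^ a * 1 ^ Suc b) at_top" by (intro tendsto_intros std_tail_at_top top)
    then show ?thesis by (simp add: power_0_left of_bool_def)
  qed
  have "(LBINT x=-\<infinity>..\<infinity>. ?f x) = of_bool (a = 0) - 0"
  proof (rule interval_integral_FTC_integrable)
    show "(?F has_vector_derivative ?f x) (at x)" for x
      using der by (simp add: has_real_derivative_iff_has_vector_derivative)
    show "isCont ?f x" for x using cont by (intro continuous_intros)
    show "set_integrable lborel (einterval (-\<infinity>) \<infinity>) ?f"
      using int' by (simp add: set_integrable_def)
    show "((?F \<circ> real_of_ereal) \<longlongrightarrow> 0) (at_right (-\<infinity>))"
      using lim_bot by (simp add: ereal_tendsto_simps1)
    show "((?F \<circ> real_of_ereal) \<longlongrightarrow> of_bool (a = 0)) (at_left \<infinity>)"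
      using lim_top by (simp add: ereal_tendsto_simps1)
  qed simp
  then have "of_bool (a = 0) = (LINT x|lborel. ?f x)"
    by (simp add: interval_lebesgue_integral_def set_lebesgue_integral_def)
  also have "\<dots> = (LINT x|std_normal. ?g x)" by (rule lebesgue_integral_std_normal[symmetric]) measurable
  also have "\<dots> = real (Suc b) * beta_weight a b - real a * beta_weight (a - 1) (Suc b)"
    unfolding beta_weight_def
    by (subst Bochner_Integration.integral_diff)
      (auto intro!: integrable_mult_right integrable_beta_weight simp del: power_Suc of_nat_Suc)
  finally show ?thesis by simp
qed

lemma beta_weight_eq: "beta_weight a b = fact a * fact b / fact (Suc (a + b))"
proof (induction a arbitrary: b)
  case 0
  have "real (Suc b) * beta_weight 0 b = 1" using beta_weight_rec[of b 0] by simp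
  then show ?case by (simp add: field_simps del: of_nat_Suc)
next
  case (Suc a)
  have "real (Suc b) * beta_weight (Suc a) b = real (Suc a) * beta_weight a (Suc b)"
    using beta_weight_rec[of b "Suc a"] by simp
  also have "\<dots> = real (Suc b) * (fact (Suc a) * fact b / fact (Suc (Suc a + b)))"
    unfolding Suc by (simp del: of_nat_Suc add: fact_Suc[of a] fact_Suc[of b])
  finally show ?case by (simp only: mult_left_cancel[OF of_nat_neq_0])
qed

section \<open>Bounds for the integral\<close>

text \<open>
  Up to explicit factors, \<open>density_moment (d - 1) (n - d)\<close> is the expected number of facets. Its quotient by
  \<open>beta_weight (d - 1) (n - d)\<close> is the mean of the \<open>(d - 1)\<close>-th power of the hazard rate when the tail has
  a Beta distribution.
\<close>

definition density_moment :: "nat \<Rightarrow> nat \<Rightarrow> real" where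
  "density_moment k m = (LINT h|std_normal. std_normal_density h ^ k * std_cdf h ^ m)"

lemma std_normal_density_le_1: "std_normal_density h \<le> 1"
  using std_normal_density_le[of h] by (rule order_trans) simp

lemma integrable_density_moment: "integrable std_normal (\<lambda>h. std_normal_density h ^ k * std_cdf h ^ m)"
  by (rule integrable_std_normal_bounded[where C = 1], measurable)
    (simp add: abs_mult std_cdf_nonneg std_cdf_le_1 power_le_one mult_le_one less_imp_le[OF std_normal_density_pos] std_normal_density_le_1)

lemma std_normal_density_scale:
  assumes "0 < d"
  shows "std_normal_density (sqrt d * h) = sqrt (2 * pi) ^ (d - 1) * std_normal_density h ^ d"
proof -
  have "std_normal_density h ^ d = 1 / sqrt (2 * pi) ^ d * exp (- h\<^sup>2 / 2) ^ d"
    by (simp add: std_normal_density_def power_divide)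
  also have "exp (- h\<^sup>2 / 2) ^ d = exp (- (sqrt d * h)\<^sup>2 / 2)"
    by (simp add: power_mult_distrib flip: exp_of_nat_mult)
  also have "sqrt (2 * pi) ^ d = sqrt (2 * pi) * sqrt (2 * pi) ^ (d - 1)"
    using assms by (cases d) auto
  finally show ?thesis by (simp add: std_normal_density_def)
qed

text \<open>
  The substitution \<open>t = sqrt d * h\<close> turns the density at \<open>t\<close> into the \<open>d\<close>-th power of the density at \<open>h\<close>;
  one of its factors is absorbed into the measure.
\<close>

lemma integral_side_prob:
  assumes d: "0 < d"
  shows "(LINT t|std_normal. side_prob m (t / sqrt d)) = 2 * sqrt d * sqrt (2 * pi) ^ (d - 1) * density_moment (d - 1) m"
proof -
  let ?C = "sqrt (2 * pi) ^ (d - 1)"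
  let ?N = "std_normal"
  have int: "integrable ?N (\<lambda>t. std_cdf (s * t) ^ m)" for s
    by (rule integrable_std_normal_bounded[where C = 1]) (simp_all add: std_cdf_nonneg std_cdf_le_1 power_le_one)
  have "(LINT t|?N. side_prob m (t / sqrt d))
      = (LINT t|?N. std_cdf ((- 1 / sqrt d) * t) ^ m + std_cdf ((1 / sqrt d) * t) ^ m)"
    by (simp add: side_prob_def)
  also have "\<dots> = (LINT t|?N. std_cdf ((- 1 / sqrt d) * t) ^ m) + (LINT t|?N. std_cdf ((1 / sqrt d) * t) ^ m)"
    by (intro Bochner_Integration.integral_add int)
  also have "(LINT t|?N. std_cdf ((- 1 / sqrt d) * t) ^ m) = (LINT t|?N. std_cdf ((1 / sqrt d) * t) ^ m)"
  proof -
    have "(LINT t|?N. std_cdf ((- 1 / sqrt d) * t) ^ m) = (LINT t|lborel. std_normal_density t * std_cdf ((- 1 / sqrt d) * t) ^ m)"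
      by (rule lebesgue_integral_std_normal) measurable
    also have "\<dots> = (LINT t|lborel. std_normal_density t * std_cdf ((1 / sqrt d) * t) ^ m)"
      by (subst lborel_integral_real_affine[where c = "-1" and t = 0]) (simp_all add: std_normal_density_minus)
    also have "\<dots> = (LINT t|?N. std_cdf ((1 / sqrt d) * t) ^ m)"
      by (rule lebesgue_integral_std_normal[symmetric]) measurable
    finally show ?thesis .
  qed
  also have "(LINT t|?N. std_cdf ((1 / sqrt d) * t) ^ m) = sqrt d * ?C * density_moment (d - 1) m"
  proof -
    have "(LINT t|?N. std_cdf ((1 / sqrt d) * t) ^ m) = (LINT t|lborel. std_normal_density t * std_cdf ((1 / sqrt d) * t) ^ m)"
      by (rule lebesgue_integral_std_normal) measurable
    also have "\<dots> = sqrt d * (LINT h|lborel. std_normal_density (sqrt d * h) * std_cdf h ^ m)"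
      using d by (subst lborel_integral_real_affine[where c = "sqrt d" and t = 0]) simp_all
    also have "(\<lambda>h. std_normal_density (sqrt d * h) * std_cdf h ^ m)
        = (\<lambda>h. ?C * (std_normal_density h * (std_normal_density h ^ (d - 1) * std_cdf h ^ m)))"
      using d unfolding std_normal_density_scale[OF d] by (cases d) (auto simp: mult_ac)
    also have "(LINT h|lborel. ?C * (std_normal_density h * (std_normal_density h ^ (d - 1) * std_cdf h ^ m)))
        = ?C * density_moment (d - 1) m"
      unfolding density_moment_def by (subst lebesgue_integral_std_normal) simp_all
    finally show ?thesis by simp
  qed
  finally show ?thesis by simp
qed

lemma binomial_beta_weight:
  assumes "0 < d" "d \<le> n"
  shows "real d * real (n choose d) * beta_weight (d - 1) (n - d) = 1"
proof -
  obtain k where k: "d = Suc k" using assms by (cases d) auto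
  have "beta_weight (d - 1) (n - d) = fact k * fact (n - d) / fact n"
    using assms by (simp add: beta_weight_eq k)
  moreover have "real (n choose d) = fact n / (fact d * fact (n - d))"
    using assms(2) by (rule binomial_fact)
  moreover have "fact d = real d * fact k" by (simp add: k)
  ultimately show ?thesis using assms by simp
qed

lemma expectation_num_facets_eq_moment:
  assumes X: "indep_std_gaussians M d n X" and d: "0 < d" and n: "d < n"
  shows "prob_space.expectation M (\<lambda>\<omega>. real (num_faces (d - 1) (gaussian_polytope d n X \<omega>)))
    = 2 / sqrt d * sqrt (2 * pi) ^ (d - 1) * (density_moment (d - 1) (n - d) / beta_weight (d - 1) (n - d))"
proof -
  let ?B = "beta_weight (d - 1) (n - d)"
  have B: "real d * real (n choose d) * ?B = 1" using binomial_beta_weight d n by simp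
  then have B0: "?B \<noteq> 0" by auto
  define r where "r = sqrt d"
  have r: "r \<noteq> 0" "real d = r * r" using d by (simp_all add: r_def)
  have "real (n choose d) = 1 / (r * r * ?B)"
    using B B0 r by (simp add: field_simps)
  then show ?thesis
    unfolding expectation_num_facets[OF X d n] integral_side_prob[OF d] unfolding r_def[symmetric]
    using r(1) B0 by (simp add: field_simps)
qed

lemma exp_convex_bound:
  fixes e y :: real
  assumes "0 \<le> e" "e \<le> 1"
  shows "exp (e * y) \<le> (1 - e) + e * exp y"
proof -
  have "1 = (1 - e) * (1 + - (e * y)) + e * (1 + (y - e * y))" by (simp add: algebra_simps)
  also have "\<dots> \<le> (1 - e) * exp (- (e * y)) + e * exp (y - e * y)"
    using assms by (intro add_mono mult_left_mono exp_ge_add_one_self) auto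
  finally have "exp (e * y) * 1 \<le> exp (e * y) * ((1 - e) * exp (- (e * y)) + e * exp (y - e * y))"
    by (intro mult_left_mono) auto
  also have "\<dots> = (1 - e) * (exp (e * y) * exp (- (e * y))) + e * (exp (e * y) * exp (y - e * y))"
    by (simp add: algebra_simps)
  also have "\<dots> = (1 - e) + e * exp y" by (simp flip: exp_add)
  finally show ?thesis by simp
qed

text \<open>
  Let \<open>s = std_cdf (- h)\<close>. By the bound on the hazard rate, the density is at most
  \<open>s * sqrt (2 * L) * sqrt z\<close> with \<open>z = (6 - ln s) / L\<close>, and \<open>z \<le> exp (z - 1)\<close>. The power \<open>d - 1\<close> of
  \<open>sqrt z\<close> is thus at most \<open>exp (6 * e) * (1 / (n * s)) powr e\<close>. Convexity replaces the last factor by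
  \<open>1 - e + e / (n * s)\<close>, whose mean with respect to the Beta distribution of \<open>s\<close> is at most \<open>1\<close>,
  because the mean of \<open>1 / s\<close> is \<open>n / (d - 1)\<close>.
\<close>

lemma density_moment_upper:
  assumes d: "2 \<le> d" and n: "d < n" and L: "L = ln (real n)" and e: "e = (real d - 1) / (2 * L)" "e \<le> 1"
  shows "density_moment (d - 1) (n - d) \<le> sqrt (2 * L) ^ (d - 1) * exp (6 * e) * beta_weight (d - 1) (n - d)"
proof -
  let ?\<phi> = "std_normal_density"
  let ?m = "n - d"
  let ?B = "beta_weight (d - 1) ?m"
  have L0: "0 < L" using d n by (simp add: L)
  have e0: "0 \<le> e" using d L0 by (simp add: e)
  define C where "C = sqrt (2 * L) ^ (d - 1) * exp (6 * e)"
  have C0: "0 \<le> C" by (simp add: C_def L0 less_imp_le)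
  have pw: "?\<phi> h ^ (d - 1) \<le> C * ((1 - e) * std_cdf (- h) ^ (d - 1) + e / n * std_cdf (- h) ^ (d - 2))" for h
  proof -
    define s where "s = std_cdf (- h)"
    have s: "0 < s" "s \<le> 1" by (simp_all add: s_def std_cdf_pos std_cdf_le_1)
    \<comment> \<open>The squared hazard rate is at most \<open>2 * L * z\<close>, and \<open>z\<close> is close to \<open>1\<close> for typical \<open>s\<close>.\<close>
    define z where "z = (6 - ln s) / L"
    have "ln s \<le> 0" using s by simp
    then have z0: "0 \<le> z" using L0 by (simp add: z_def)
    have "?\<phi> h ^ 2 \<le> s\<^sup>2 * (2 * L * z)"
    proof -
      have "2 * L * z = - 2 * ln s + 12" using L0 by (simp add: z_def)
      then show ?thesis using hazard_rate_bound[of h] unfolding s_def[symmetric] by (simp only:)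
    qed
    also have "\<dots> \<le> s\<^sup>2 * (2 * L * exp (z - 1))"
      using L0 exp_ge_add_one_self[of "z - 1"] by (intro mult_left_mono) auto
    also have "\<dots> = (s * (sqrt (2 * L) * exp ((z - 1) / 2)))\<^sup>2"
      using L0 by (simp add: power_mult_distrib flip: exp_double)
    finally have "?\<phi> h \<le> s * (sqrt (2 * L) * exp ((z - 1) / 2))"
      by (rule power2_le_imp_le) (use s L0 in auto)
    then have "?\<phi> h ^ (d - 1) \<le> (s * (sqrt (2 * L) * exp ((z - 1) / 2))) ^ (d - 1)"
      by (rule power_mono) (simp add: less_imp_le std_normal_density_pos)
    also have "\<dots> = s ^ (d - 1) * sqrt (2 * L) ^ (d - 1) * exp ((z - 1) / 2) ^ (d - 1)"
      by (simp add: power_mult_distrib)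
    also have "exp ((z - 1) / 2) ^ (d - 1) = exp (6 * e) * exp (e * (- ln (n * s)))"
    proof -
      have "real (d - 1) * ((z - 1) / 2) = 6 * e + e * (- ln (n * s))"
        using d n s L0 unfolding e z_def L by (simp add: ln_mult of_nat_diff field_simps)
      then show ?thesis by (simp flip: exp_of_nat_mult exp_add)
    qed
    also have "s ^ (d - 1) * sqrt (2 * L) ^ (d - 1) * (exp (6 * e) * exp (e * (- ln (n * s))))
        = C * (s ^ (d - 1) * exp (e * (- ln (n * s))))"
      by (simp add: C_def)
    also have "\<dots> \<le> C * (s ^ (d - 1) * ((1 - e) + e * exp (- ln (n * s))))"
      using C0 s e e0 by (intro mult_left_mono exp_convex_bound) auto
    also have "exp (- ln (n * s)) = 1 / (n * s)"
      using s n by (simp add: exp_minus inverse_eq_divide)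
    also have "s ^ (d - 1) * ((1 - e) + e * (1 / (n * s))) = (1 - e) * s ^ (d - 1) + e / n * s ^ (d - 2)"
    proof -
      have "s ^ (d - 1) = s * s ^ (d - 2)" using d by (metis Suc_diff_Suc Suc_1 Suc_le_lessD diff_Suc_1 power_Suc)
      then show ?thesis using s n by (simp add: field_simps)
    qed
    finally show ?thesis by (simp add: s_def)
  qed
  have "density_moment (d - 1) ?m
     \<le> (LINT h|std_normal. C * ((1 - e) * (std_cdf (- h) ^ (d - 1) * std_cdf h ^ ?m) + e / n * (std_cdf (- h) ^ (d - 2) * std_cdf h ^ ?m)))"
    unfolding density_moment_def
  proof (rule integral_mono)
    show "integrable std_normal (\<lambda>h. ?\<phi> h ^ (d - 1) * std_cdf h ^ ?m)" by (rule integrable_density_moment)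
    show "integrable std_normal (\<lambda>h. C * ((1 - e) * (std_cdf (- h) ^ (d - 1) * std_cdf h ^ ?m) + e / n * (std_cdf (- h) ^ (d - 2) * std_cdf h ^ ?m)))"
      by (intro integrable_mult_right Bochner_Integration.integrable_add integrable_beta_weight)
    fix h
    have "?\<phi> h ^ (d - 1) * std_cdf h ^ ?m
        \<le> C * ((1 - e) * std_cdf (- h) ^ (d - 1) + e / n * std_cdf (- h) ^ (d - 2)) * std_cdf h ^ ?m"
      by (rule mult_right_mono[OF pw]) (simp add: std_cdf_nonneg)
    then show "?\<phi> h ^ (d - 1) * std_cdf h ^ ?m
        \<le> C * ((1 - e) * (std_cdf (- h) ^ (d - 1) * std_cdf h ^ ?m) + e / n * (std_cdf (- h) ^ (d - 2) * std_cdf h ^ ?m))"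
      by (simp only: distrib_right mult.assoc)
  qed
  also have "\<dots> = C * ((1 - e) * ?B + e / n * beta_weight (d - 2) ?m)"
    unfolding beta_weight_def using integrable_beta_weight by simp
  also have "e / n * beta_weight (d - 2) ?m = e / (real d - 1) * ?B"
  proof -
    obtain k where k: "d = Suc (Suc k)" using d by (metis add_2_eq_Suc le_iff_add)
    have "?B = (real d - 1) / real n * beta_weight (d - 2) ?m"
    proof -
      obtain l where l: "n = Suc (Suc (k + l))" using n k by (metis add_Suc less_imp_le_nat le_iff_add)
      have "real (Suc (k + l)) + 1 = real n" by (simp add: l)
      then show ?thesis
        unfolding beta_weight_eq by (simp add: k l field_simps)
    qed
    then have eq: "?B = (real d - 1) / real n * beta_weight (d - 2) ?m" .
    have "real d - 1 \<noteq> 0" using d by simp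
    then show ?thesis unfolding eq by simp
  qed
  also have "C * ((1 - e) * ?B + e / (real d - 1) * ?B)
      \<le> C * ?B"
  proof (rule mult_left_mono[OF _ C0])
    have "e / (real d - 1) \<le> e" using d e0 by (simp add: divide_le_eq mult_right_le_one_le) (simp add: mult_left_mono mult_le_cancel_left1)
    then have "((1 - e) + e / (real d - 1)) * ?B \<le> 1 * ?B"
      by (intro mult_right_mono) (auto simp: beta_weight_eq)
    then show "(1 - e) * ?B + e / (real d - 1) * ?B \<le> ?B"
      by (simp add: distrib_right)
  qed
  finally show ?thesis by (simp add: C_def)
qed

text \<open>
  For \<open>h \<ge> h0\<close> the density is at least \<open>h0\<close> times the tail \<open>s\<close>. The contribution of \<open>h < h0\<close>, where
  \<open>s \<ge> d\<^sup>2 / n\<close>, is removed by the factor \<open>1 - n * s / d\<^sup>2\<close>, which is at most \<open>0\<close> there. Since the mean of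
  \<open>s\<close> is \<open>d / (n + 1)\<close>, this costs only the factor \<open>1 - 1 / d\<close> (Markov's inequality).
\<close>

lemma density_moment_lower:
  assumes d: "0 < d" and n: "d < n" and h0: "0 \<le> h0" and tail: "real d ^ 2 / n \<le> std_cdf (- h0)"
  shows "h0 ^ (d - 1) * (1 - 1 / d) * beta_weight (d - 1) (n - d) \<le> density_moment (d - 1) (n - d)"
proof -
  let ?\<phi> = "std_normal_density"
  let ?m = "n - d"
  let ?B = "beta_weight (d - 1) ?m"
  define q where "q = real n / real d ^ 2"
  have q0: "0 < q" using d n by (simp add: q_def)
  have pw: "h0 ^ (d - 1) * (std_cdf (- h) ^ (d - 1) - q * std_cdf (- h) ^ d) \<le> ?\<phi> h ^ (d - 1)" for h
  proof (cases "h0 \<le> h")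
    case True
    have "h0 * std_cdf (- h) \<le> ?\<phi> h"
    proof (cases "h = 0")
      case False
      have "h0 * std_cdf (- h) \<le> h * std_cdf (- h)" using True by (intro mult_right_mono std_cdf_nonneg)
      also have "\<dots> \<le> ?\<phi> h" using False True h0 by (intro mills_upper) simp
      finally show ?thesis .
    qed (use True h0 in \<open>simp add: less_imp_le std_normal_density_pos\<close>)
    then have "(h0 * std_cdf (- h)) ^ (d - 1) \<le> ?\<phi> h ^ (d - 1)"
      using h0 by (intro power_mono) (auto simp: std_cdf_nonneg)
    moreover have "h0 ^ (d - 1) * (std_cdf (- h) ^ (d - 1) - q * std_cdf (- h) ^ d) \<le> h0 ^ (d - 1) * std_cdf (- h) ^ (d - 1)"
      using h0 q0 by (intro mult_left_mono) (auto simp: std_cdf_nonneg)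
    ultimately show ?thesis by (simp add: power_mult_distrib)
  next
    case False
    then have "real d ^ 2 / n \<le> std_cdf (- h)" using tail std_cdf_mono[of "- h0" "- h"] by simp
    then have "q * (real d ^ 2 / n) \<le> q * std_cdf (- h)" using q0 by (intro mult_left_mono) auto
    then have "1 \<le> q * std_cdf (- h)" using d n by (simp add: q_def)
    then have "std_cdf (- h) ^ (d - 1) * 1 \<le> std_cdf (- h) ^ (d - 1) * (q * std_cdf (- h))"
      by (intro mult_left_mono) (auto simp: std_cdf_nonneg)
    also have "\<dots> = q * std_cdf (- h) ^ d" using d by (cases d) auto
    finally have "h0 ^ (d - 1) * (std_cdf (- h) ^ (d - 1) - q * std_cdf (- h) ^ d) \<le> 0"
      using h0 by (intro mult_nonneg_nonpos) auto
    also have "0 \<le> ?\<phi> h ^ (d - 1)" by (simp add: less_imp_le std_normal_density_pos)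
    finally show ?thesis .
  qed
  have "h0 ^ (d - 1) * (?B - q * beta_weight d ?m)
     = (LINT h|std_normal. h0 ^ (d - 1) * (std_cdf (- h) ^ (d - 1) * std_cdf h ^ ?m - q * (std_cdf (- h) ^ d * std_cdf h ^ ?m)))"
    unfolding beta_weight_def using integrable_beta_weight by simp
  also have "\<dots> \<le> density_moment (d - 1) ?m"
    unfolding density_moment_def
  proof (rule integral_mono)
    show "integrable std_normal (\<lambda>h. ?\<phi> h ^ (d - 1) * std_cdf h ^ ?m)" by (rule integrable_density_moment)
    show "integrable std_normal (\<lambda>h. h0 ^ (d - 1) * (std_cdf (- h) ^ (d - 1) * std_cdf h ^ ?m - q * (std_cdf (- h) ^ d * std_cdf h ^ ?m)))"
      by (intro integrable_mult_right Bochner_Integration.integrable_diff integrable_beta_weight)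
    fix h
    have "h0 ^ (d - 1) * (std_cdf (- h) ^ (d - 1) - q * std_cdf (- h) ^ d) * std_cdf h ^ ?m \<le> ?\<phi> h ^ (d - 1) * std_cdf h ^ ?m"
      by (rule mult_right_mono[OF pw]) (simp add: std_cdf_nonneg)
    then show "h0 ^ (d - 1) * (std_cdf (- h) ^ (d - 1) * std_cdf h ^ ?m - q * (std_cdf (- h) ^ d * std_cdf h ^ ?m)) \<le> ?\<phi> h ^ (d - 1) * std_cdf h ^ ?m"
      by (simp only: left_diff_distrib mult.assoc)
  qed
  finally have "h0 ^ (d - 1) * (?B - q * beta_weight d ?m) \<le> density_moment (d - 1) ?m" .
  moreover have "q * beta_weight d ?m \<le> 1 / d * ?B"
  proof -
    have "beta_weight d ?m = real d / (real n + 1) * ?B"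
    proof -
      obtain k where k: "d = Suc k" using d by (cases d) auto
      obtain l where l: "n = Suc (k + l)" using n k by (metis add_Suc less_imp_le_nat le_iff_add)
      have "beta_weight d ?m = fact (Suc k) * fact l / fact (Suc (Suc (k + l)))" "?B = fact k * fact l / fact (Suc (k + l))"
        unfolding beta_weight_eq by (simp_all add: k l)
      then show ?thesis by (simp add: k l field_simps)
    qed
    then have "q * beta_weight d ?m = (q * (real d / (real n + 1))) * ?B" by simp
    also have "\<dots> \<le> 1 / d * ?B"
    proof (rule mult_right_mono)
      show "q * (real d / (real n + 1)) \<le> 1 / d"
      proof -
        have "q * (real d / (real n + 1)) = 1 / d * (real n / (real n + 1))"
          using d by (simp add: q_def power2_eq_square)
        also have "\<dots> \<le> 1 / d * 1" by (intro mult_left_mono) auto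
        finally show ?thesis by simp
      qed
    qed (simp add: beta_weight_eq)
    finally show ?thesis .
  qed
  then have "h0 ^ (d - 1) * ((1 - 1 / d) * ?B) \<le> h0 ^ (d - 1) * (?B - q * beta_weight d ?m)"
    using h0 by (intro mult_left_mono) (auto simp: algebra_simps)
  ultimately show ?thesis by (simp add: mult.assoc)
qed

text \<open>
  A level \<open>h0\<close> with \<open>h0\<^sup>2 = 2 * (ln n - 2 * ln d - ln (ln n))\<close> is low enough for the preceding lemma: the
  term \<open>ln (ln n)\<close> outweighs the polynomial factor in the lower Mills bound, and \<open>64\<close> takes care of the
  constants, as \<open>4 * sqrt pi \<le> sqrt 64\<close>.
\<close>

lemma std_tail_lower:
  assumes d: "1 \<le> d" and L: "L = ln (real n)" "64 \<le> L" and x: "x = (2 * ln (real d) + ln L) / L" "x \<le> 1 / 2"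
    and h0: "h0 = sqrt (2 * L * (1 - x))"
  shows "real d ^ 2 / n \<le> std_cdf (- h0)"
proof -
  have n: "0 < n" using L by (cases "n = 0") auto
  have L0: "0 < L" using L(2) by simp
  have eL: "exp L = n" using n L(1) by simp
  have h0sq: "h0\<^sup>2 = 2 * L * (1 - x)" using L x by (simp add: h0)
  have "1 \<le> 2 * L * (1 - x)" using L(2) x(2) mult_mono[of 64 L "1/2" "1 - x"] by simp
  then have h1: "1 \<le> h0" by (simp add: h0)
  have ge0: "0 \<le> x" using d L by (simp add: x)
  have hle: "h0 \<le> sqrt (2 * L)" unfolding h0 using ge0 L by simp
  have "exp (- h0\<^sup>2 / 2) = exp (2 * ln (real d) + ln L - L)"
    unfolding h0sq using L by (simp add: x field_simps)
  also have "\<dots> = real d ^ 2 * L / n"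
    using d L0 by (simp add: exp_add exp_diff exp_double eL)
  finally have ex: "exp (- h0\<^sup>2 / 2) = real d ^ 2 * L / n" .
  have "4 * sqrt pi * sqrt L \<le> L"
  proof -
    have "sqrt pi \<le> 2" using pi_less_4 real_sqrt_le_mono[of pi 4] by simp
    then have "4 * sqrt pi \<le> sqrt 64" by simp
    also have "\<dots> \<le> sqrt L" using L(2) by (rule real_sqrt_le_mono)
    finally have "4 * sqrt pi * sqrt L \<le> sqrt L * sqrt L" using L by (intro mult_right_mono) auto
    then show ?thesis using L by simp
  qed
  moreover have "sqrt (2 * pi) * (2 * sqrt (2 * L)) = 4 * sqrt pi * sqrt L"
    by (simp add: real_sqrt_mult)
  ultimately have key0: "sqrt (2 * pi) * (2 * sqrt (2 * L)) \<le> L" by (simp only:)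
  have key: "sqrt (2 * pi) * (2 * h0) \<le> L"
  proof -
    have "sqrt (2 * pi) * (2 * h0) \<le> sqrt (2 * pi) * (2 * sqrt (2 * L))"
      using hle by (intro mult_left_mono) auto
    with key0 show ?thesis by linarith
  qed
  have "std_cdf (- h0) * (1 + h0\<^sup>2) \<ge> h0 * std_normal_density h0"
    using mills_lower[of h0] h1 by (simp add: mult.commute)
  moreover have "std_cdf (- h0) * (1 + h0\<^sup>2) \<le> std_cdf (- h0) * (2 * h0 * h0)"
  proof -
    have "1 \<le> h0 * h0" using mult_mono[of 1 h0 1 h0] h1 by simp
    then show ?thesis by (intro mult_left_mono) (auto simp: power2_eq_square std_cdf_nonneg)
  qed
  ultimately have "h0 * std_normal_density h0 \<le> h0 * (std_cdf (- h0) * (2 * h0))" by (simp add: mult_ac)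
  then have "std_normal_density h0 \<le> std_cdf (- h0) * (2 * h0)" using h1 by simp
  then have "sqrt (2 * pi) * std_normal_density h0 \<le> std_cdf (- h0) * (sqrt (2 * pi) * (2 * h0))"
    by (metis mult.left_commute mult_left_mono real_sqrt_ge_zero pi_ge_zero mult_nonneg_nonneg zero_le_numeral)
  also have "\<dots> \<le> std_cdf (- h0) * L" by (intro mult_left_mono key std_cdf_nonneg)
  also have "sqrt (2 * pi) * std_normal_density h0 = real d ^ 2 * L / n"
    using ex by (simp add: std_normal_density_def)
  finally have "(real d ^ 2 / n) * L \<le> std_cdf (- h0) * L" by simp
  then show ?thesis using L0 by (rule mult_right_le_imp_le)
qed

section \<open>The asymptotic formula\<close>

lemma sqrt_power_eq_powr:
  assumes "0 < x" "1 \<le> d"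
  shows "sqrt x ^ (d - 1) = x powr ((real d - 1) / 2)"
proof -
  have "x powr ((real d - 1) / 2) = (x powr (1 / 2)) powr real (d - 1)"
    using assms by (simp add: powr_powr of_nat_diff)
  also have "x powr (1 / 2) = sqrt x"
    using assms by (simp add: powr_half_sqrt)
  also have "sqrt x powr real (d - 1) = sqrt x ^ (d - 1)"
    using assms by (intro powr_realpow) simp
  finally show ?thesis ..
qed

lemma two_power_split:
  assumes "1 \<le> d"
  shows "(2::real) ^ d = 2 * sqrt 2 ^ (d - 1) * sqrt 2 ^ (d - 1)"
proof -
  have "(2::real) ^ d = 2 * 2 ^ (d - 1)" using assms by (cases d) auto
  also have "(2::real) ^ (d - 1) = (sqrt 2 * sqrt 2) ^ (d - 1)" by simp
  finally show ?thesis by (simp only: power_mult_distrib mult.assoc)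
qed

definition facet_asymptotics :: "nat \<Rightarrow> real \<Rightarrow> real" where
  "facet_asymptotics d L = 2 ^ d * pi powr ((real d - 1) / 2) * real d powr (- (1 / 2)) * L powr ((real d - 1) / 2)"

lemma facet_asymptotics_eq:
  assumes "1 \<le> d" "0 < L"
  shows "facet_asymptotics d L = 2 / sqrt d * sqrt (2 * pi) ^ (d - 1) * sqrt (2 * L) ^ (d - 1)"
proof -
  have "real d powr (- (1 / 2)) = 1 / sqrt d"
    using assms by (simp add: powr_minus powr_half_sqrt inverse_eq_divide)
  then have "facet_asymptotics d L = (2 * sqrt 2 ^ (d - 1) * sqrt 2 ^ (d - 1)) * sqrt pi ^ (d - 1) * (1 / sqrt d) * sqrt L ^ (d - 1)"
    unfolding facet_asymptotics_def using assms by (simp only: two_power_split sqrt_power_eq_powr[symmetric] pi_gt_zero)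
  then show ?thesis by (simp add: real_sqrt_mult power_mult_distrib)
qed

text \<open>
  Bernoulli's inequality, applied to \<open>h0 ^ (d - 1) = sqrt (2 * L) ^ (d - 1) * sqrt (1 - x) ^ (d - 1)\<close>.
\<close>

lemma moment_ratio_lower:
  assumes d: "2 \<le> d" and n: "d < n" and L: "L = ln (real n)" "64 \<le> L"
    and x: "x = (2 * ln (real d) + ln L) / L" "real d * x \<le> 1"
  shows "(1 - 1 / d) * (1 - d * x) \<le> density_moment (d - 1) (n - d) / (sqrt (2 * L) ^ (d - 1) * beta_weight (d - 1) (n - d))"
proof -
  let ?S = "sqrt (2 * L) ^ (d - 1)"
  let ?D = "density_moment (d - 1) (n - d)"
  let ?B = "beta_weight (d - 1) (n - d)"
  have L0: "0 < L" using L(2) by simp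
  have x0: "0 \<le> x" using d L by (simp add: x)
  have x2: "x \<le> 1 / 2"
  proof -
    have "2 * x \<le> real d * x" using d x0 by (intro mult_right_mono) auto
    then show ?thesis using x(2) by simp
  qed
  define h0 where "h0 = sqrt (2 * L * (1 - x))"
  have B: "0 < ?B" by (simp add: beta_weight_eq)
  have h0_pos: "0 \<le> h0" using x2 L0 by (simp add: h0_def)
  have "1 - d * x \<le> (1 - x) ^ (d - 1)"
  proof -
    have "1 - d * x \<le> 1 + real (d - 1) * (- x)" using d x0 by (simp add: of_nat_diff algebra_simps)
    also have "\<dots> \<le> (1 + - x) ^ (d - 1)" using x2 by (intro Bernoulli_inequality) simp
    finally show ?thesis by simp
  qed
  also have "\<dots> \<le> sqrt (1 - x) ^ (d - 1)"
  proof (rule power_mono)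
    have "(1 - x) * (1 - x) \<le> 1 * (1 - x)" using x0 x2 by (intro mult_right_mono) auto
    then show "1 - x \<le> sqrt (1 - x)" by (intro real_le_rsqrt) (simp add: power2_eq_square)
  qed (use x2 in simp)
  finally have y: "1 - d * x \<le> sqrt (1 - x) ^ (d - 1)" .
  have "(1 - 1 / d) * (1 - d * x) \<le> (1 - 1 / d) * sqrt (1 - x) ^ (d - 1)"
    using d by (intro mult_left_mono y) simp
  also have "\<dots> = (h0 ^ (d - 1) * (1 - 1 / d) * ?B) / (?S * ?B)"
  proof -
    have "h0 ^ (d - 1) = ?S * sqrt (1 - x) ^ (d - 1)"
      unfolding h0_def by (simp add: real_sqrt_mult power_mult_distrib)
    then show ?thesis using B L0 by simp
  qed
  also have "\<dots> \<le> ?D / (?S * ?B)"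
  proof (rule divide_right_mono)
    show "h0 ^ (d - 1) * (1 - 1 / d) * ?B \<le> ?D"
      using d n L x x2 h0_pos by (intro density_moment_lower std_tail_lower[of d L n x]) (auto simp: h0_def)
  qed (use B L0 in simp)
  finally show ?thesis .
qed

lemma moment_ratio_upper:
  assumes d: "2 \<le> d" and n: "d < n" and L: "L = ln (real n)" and e: "e = (real d - 1) / (2 * L)" "e \<le> 1"
  shows "density_moment (d - 1) (n - d) / (sqrt (2 * L) ^ (d - 1) * beta_weight (d - 1) (n - d)) \<le> exp (6 * e)"
proof -
  have L0: "0 < L" using d n by (simp add: L)
  have B: "0 < beta_weight (d - 1) (n - d)" by (simp add: beta_weight_eq)
  have "0 < sqrt (2 * L) ^ (d - 1) * beta_weight (d - 1) (n - d)" using L0 B by simp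
  then show ?thesis
    using density_moment_upper[OF d n L e] by (simp add: pos_divide_le_eq mult_ac)
qed

theorem corollary1p2:
  fixes n :: "nat \<Rightarrow> nat"
    and M :: "nat \<Rightarrow> 'a measure"
    and X :: "nat \<Rightarrow> nat \<Rightarrow> 'a \<Rightarrow> nat \<Rightarrow> real"
  assumes "\<And>d. d \<ge> 1 \<Longrightarrow> n d \<ge> 1"
    and "filterlim (\<lambda>d. ln (real (n d)) / (real d * ln (real d))) at_top at_top"
    and "\<And>d. d \<ge> 1 \<Longrightarrow> indep_std_gaussians (M d) d (n d) (X d)"
  shows "(\<lambda>d. prob_space.expectation (M d)
                (\<lambda>\<omega>. real (num_faces (d - 1) (gaussian_polytope d (n d) (X d) \<omega>))))
         \<sim>[at_top]
         (\<lambda>d. 2 ^ d * pi powr ((real d - 1) / 2) * real d powr (- (1 / 2))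
                * ln (real (n d)) powr ((real d - 1) / 2))"
proof -
  define L where "L d = ln (real (n d))" for d
  define \<rho> where "\<rho> d = L d / (real d * ln (real d))" for d
  define E where "E d = prob_space.expectation (M d)
      (\<lambda>\<omega>. real (num_faces (d - 1) (gaussian_polytope d (n d) (X d) \<omega>)))" for d
  define R where "R d = density_moment (d - 1) (n d - d) / (sqrt (2 * L d) ^ (d - 1) * beta_weight (d - 1) (n d - d))" for d
  define e where "e d = (real d - 1) / (2 * L d)" for d
  define x where "x d = (2 * ln (real d) + ln (L d)) / L d" for d
  have \<rho>: "filterlim \<rho> at_top at_top"
    using assms(2) by (simp add: \<rho>_def[abs_def] L_def[abs_def])
  \<comment> \<open>Eventually \<open>ln n \<ge> d * ln d\<close>, which implies in particular that there are more than \<open>d\<close> points.\<close>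
  have large: "\<forall>\<^sub>F d in at_top. 64 \<le> d \<and> 1 \<le> \<rho> d"
    using eventually_ge_at_top[of 64] \<rho>[unfolded filterlim_at_top, rule_format, of 1]
    by eventually_elim simp
  have facts: "1 \<le> ln (real d)" "L d = \<rho> d * (real d * ln (real d))" "real d \<le> L d" "64 \<le> L d" "d < n d"
    if "64 \<le> d \<and> 1 \<le> \<rho> d" for d
  proof -
    have "exp 1 \<le> real d" using that exp_le by simp
    then show ln1: "1 \<le> ln (real d)" using that by (subst ln_ge_iff) auto
    then have dl: "real d \<le> real d * ln (real d)" "0 < real d * ln (real d)" using that by auto
    then have "real d * ln (real d) \<noteq> 0" by linarith
    then show eq: "L d = \<rho> d * (real d * ln (real d))"
      unfolding \<rho>_def by (rule nonzero_divide_eq_eq[THEN iffD1, OF _ refl])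
    have "1 * (real d * ln (real d)) \<le> L d" unfolding eq using that dl by (intro mult_right_mono) auto
    then show "real d \<le> L d" using dl by simp
    then show L64: "64 \<le> L d" using that by linarith
    have "0 < n d" using L64 by (cases "n d = 0") (auto simp: L_def)
    have "ln (real d) < real d" using that by (intro ln_less_self) simp
    then have "ln (real d) < ln (real (n d))" using \<open>real d \<le> L d\<close> by (simp add: L_def)
    then show "d < n d" using that \<open>0 < n d\<close> by simp
  qed
  have \<rho>_inv: "((\<lambda>d. 1 / \<rho> d) \<longlongrightarrow> 0) at_top"
    by (rule tendsto_divide_0[OF tendsto_const filterlim_at_top_imp_at_infinity[OF \<rho>]])
  have \<rho>_ln: "((\<lambda>d. (ln (\<rho> d) + 4) / \<rho> d) \<longlongrightarrow> 0) at_top"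
  proof -
    have "((\<lambda>r::real. (ln r + 4) / r) \<longlongrightarrow> 0) at_top" by real_asymp
    from filterlim_compose[OF this \<rho>] show ?thesis .
  qed
  have e_lim: "(e \<longlongrightarrow> 0) at_top"
  proof (rule tendsto_sandwich[OF _ _ tendsto_const \<rho>_inv])
    show "\<forall>\<^sub>F d in at_top. 0 \<le> e d"
      using large by eventually_elim (use facts in \<open>force simp: e_def\<close>)
    show "\<forall>\<^sub>F d in at_top. e d \<le> 1 / \<rho> d"
      using large
    proof eventually_elim
      case (elim d)
      note f = facts[OF elim]
      have "(real d - 1) * \<rho> d \<le> real d * \<rho> d" using elim by (intro mult_right_mono) auto
      also have "\<dots> \<le> (\<rho> d * (real d * ln (real d)))"
        using f(1) elim by (simp add: mult_le_cancel_left1)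
      also have "\<dots> = L d" using f(2) by simp
      also have "\<dots> \<le> 2 * L d" using f(4) by simp
      finally show ?case using f(4) elim by (simp add: e_def field_simps)
    qed
  qed
  \<comment> \<open>As \<open>ln (ln n) = ln (\<rho> d) + ln d + ln (ln d)\<close>, the iterated logarithm is covered by the growth of \<open>\<rho>\<close>.\<close>
  have dx_lim: "((\<lambda>d. real d * x d) \<longlongrightarrow> 0) at_top"
  proof (rule tendsto_sandwich[OF _ _ tendsto_const \<rho>_ln])
    show "\<forall>\<^sub>F d in at_top. 0 \<le> real d * x d"
      using large
    proof eventually_elim
      case (elim d)
      then show ?case using facts[OF elim] by (simp add: x_def)
    qed
    show "\<forall>\<^sub>F d in at_top. real d * x d \<le> (ln (\<rho> d) + 4) / \<rho> d"
      using large
    proof eventually_elim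
      case (elim d)
      note f = facts[OF elim]
      let ?l = "ln (real d)"
      have pos: "0 < \<rho> d" "0 < real d" "0 < ?l" using elim f by auto
      have "ln (L d) = ln (\<rho> d) + (?l + ln ?l)"
        unfolding f(2) using pos by (simp add: ln_mult)
      also have "ln ?l \<le> ?l" using pos by (intro less_imp_le ln_less_self)
      finally have "2 * ?l + ln (L d) \<le> ln (\<rho> d) + 4 * ?l" by simp
      also have "\<dots> \<le> (ln (\<rho> d) + 4) * ?l"
      proof -
        have "ln (\<rho> d) * 1 \<le> ln (\<rho> d) * ?l" using f(1) elim by (intro mult_left_mono) auto
        then show ?thesis by (simp add: algebra_simps)
      qed
      finally have "real d * (2 * ?l + ln (L d)) / L d \<le> real d * ((ln (\<rho> d) + 4) * ?l) / L d"
        using f by (intro divide_right_mono mult_left_mono) auto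
      also have "\<dots> = (ln (\<rho> d) + 4) / \<rho> d"
        unfolding f(2) using pos by (simp add: field_simps)
      finally show ?case by (simp add: x_def)
    qed
  qed
  have small: "\<forall>\<^sub>F d in at_top. real d * x d < 1" "\<forall>\<^sub>F d in at_top. e d < 1"
    by (rule order_tendstoD(2)[OF dx_lim], simp) (rule order_tendstoD(2)[OF e_lim], simp)
  have R_lim: "(R \<longlongrightarrow> 1) at_top"
  proof (rule tendsto_sandwich)
    have "((\<lambda>d. (1 - 1 / real d) * (1 - real d * x d)) \<longlongrightarrow> (1 - 0) * (1 - 0)) at_top"
      by (intro tendsto_intros dx_lim lim_1_over_n)
    then show "((\<lambda>d. (1 - 1 / real d) * (1 - real d * x d)) \<longlongrightarrow> 1) at_top" by simp
    have "((\<lambda>d. exp (6 * e d)) \<longlongrightarrow> exp (6 * 0)) at_top" by (intro tendsto_intros e_lim)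
    then show "((\<lambda>d. exp (6 * e d)) \<longlongrightarrow> 1) at_top" by simp
    show "\<forall>\<^sub>F d in at_top. (1 - 1 / real d) * (1 - real d * x d) \<le> R d"
      using large small(1)
    proof eventually_elim
      case (elim d)
      show ?case
        unfolding R_def using facts[OF elim(1)] elim by (intro moment_ratio_lower) (auto simp: L_def x_def)
    qed
    show "\<forall>\<^sub>F d in at_top. R d \<le> exp (6 * e d)"
      using large small(2)
    proof eventually_elim
      case (elim d)
      show ?case
        unfolding R_def using facts[OF elim(1)] elim by (intro moment_ratio_upper) (auto simp: L_def e_def)
    qed
  qed
  have "E \<sim>[at_top] (\<lambda>d. facet_asymptotics d (L d))"
  proof (rule asymp_equivI', rule Lim_transform_eventually[OF R_lim], use large in eventually_elim)
    fix d assume "64 \<le> d \<and> 1 \<le> \<rho> d"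
    note f = this facts[OF this]
    have "E d = 2 / sqrt d * sqrt (2 * pi) ^ (d - 1) * (density_moment (d - 1) (n d - d) / beta_weight (d - 1) (n d - d))"
      unfolding E_def using f assms(3)[of d] by (intro expectation_num_facets_eq_moment) auto
    moreover have "facet_asymptotics d (L d) = 2 / sqrt d * sqrt (2 * pi) ^ (d - 1) * sqrt (2 * L d) ^ (d - 1)"
      using f by (intro facet_asymptotics_eq) auto
    moreover have "2 / sqrt d * sqrt (2 * pi) ^ (d - 1) \<noteq> 0" using f by simp
    moreover have "c * (K / B) / (c * S) = K / (S * B)" if "c \<noteq> 0" for c K B S :: real
      using that by (simp add: mult.commute)
    ultimately show "R d = E d / facet_asymptotics d (L d)"
      unfolding R_def by simp
  qed
  then show ?thesis
    by (simp only: E_def[abs_def] facet_asymptotics_def L_def)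
qed

end
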